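(* For fixed $h$ and $q$ tending to infinity, the algorithm RSDL-FQ (described in the context) for computing discrete logarithms in $\mathbb{F}_{q^h}$ has (expected) running time $O(h!\cdot q\,M(q))$, counted in operations over $\mathbb{F}_q$, and requires storing $O(q)$ elements of size $h\log q$.
   Context: $M(n)$ denotes the cost, in operations in the base field $\mathbb{F}_q$, of multiplying two polynomials of degree $n$, with the usual conventions for fast polynomial arithmetic (multipoint evaluation and interpolation at $n$ points, partial extended gcd in degree $n$, each within $O(M(n)\log n)$; multiplication modulo a fixed polynomial of degree $n$ in $O(M(n))$). An operation over $\mathbb{Z}/(q^s-1)\mathbb{Z}$ is assumed to cost $M(s)$ operations over $\mathbb{F}_q$. Solving an $n\times n$ sparse linear system over $\mathbb{Z}/(q^h-1)\mathbb{Z}$ with $O(h)$ nonzero coefficients per row is assumed to cost $O(h n^2)$ operations over $\mathbb{Z}/(q^h-1)\mathbb{Z}$, i.e. $O(h n^2 M(h))$ operations over $\mathbb{F}_q$. Algorithm RSDL-FQ. Input: $\mathbb{F}_{q^h}=\mathbb{F}_q[X]/(Q(X))$ with $Q$ monic primitive of degree $h$ over $\mathbb{F}_q$, $\omega$ the class of $X$, a generator of $\mathbb{F}_{q^h}^*$. Output: $\log_\omega(\omega-a)$ for all $a\in S:=\mathbb{F}_q$. Parameters: $n=q$, $\mu=q-h$, $k=\mu-h=q-2h$, $G(X)=\prod_{a\in\mathbb{F}_q}(X-a)=X^q-X$. Step 1: pick a random $u$ and compute $f(X)=X^u\bmod Q(X)$. Step 2: try to find $A\subset\mathbb{F}_q$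 with $|A|=\mu$ and $\prod_{a\in A}(X-a)\equiv f(X)\bmod Q(X)$ by uniquely decoding, up to $h$ errors, the word $y=\left(-f(a)/Q(a)-a^k\right)_{a\in\mathbb{F}_q}$ with respect to the Reed-Solomon code of dimension $k$ and support $\mathbb{F}_q$ (evaluation vectors on $\mathbb{F}_q$ of polynomials in $\mathbb{F}_q[X]$ of degree $<k$). Unique decoding is done with Gao's algorithm: compute the interpolation polynomial $I$ of $y$; run the extended Euclidean algorithm on the quotients of $G$ and of $I$ by $X^k$, stopping at the first remainder of degree $<(d-1)/2=h$, where $d=n-k+1=2h+1$, to obtain an error-locator candidate $v(X)$ (the cofactor of the quotient of $I$ by $X^k$); and test whether $v\mid G$ (by computing $X^q\bmod v$). If decoding fails, return to Step 1 with another random $u$. Step 3: on success, find the roots of $v$ in $\mathbb{F}_q$; $A$ is the complement of this set of roots, which gives the relation $u\equiv\sum_{a\in A}\log_\omega(\omega-a)\bmod (q^h-1)$, stored as $u$ together with the roots of $v$ (at most $h$ elements of $\mathbb{F}_q$), using the equivalent form $X^u v(X)\equiv G(X)\bmod Q(X)$ with $v$ normalized to be monic. If fewer than $n=q$ relations have been found, return to Step 1. Step 4: solve the resulting $q\times q$ linear system over $\mathbb{Z}/(q^h-1)\mathbb{Z}$. *)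

theory Defs
  imports
    "HOL-Probability.Probability"
    "HOL-Library.Landau_Symbols"
    "HOL-Library.Log_Nat"
    "HOL-Library.Monad_Syntax"
    "HOL-Number_Theory.Cong"
    "HOL-Algebra.Polynomial_Divisibility"
    "HOL-Algebra.Multiplicative_Group"
    "HOL-Algebra.Generated_Groups"
begin

section \<open>Counting operations\<close>

text \<open>
  Algorithms are written in a writer monad: a computation carries its result and the number of
  operations in the base field that it has performed. Only the primitive operations below charge
  anything; every other cost is accumulated by the bind operation.
\<close>

datatype 'b timed = Timed (result: 'b) (ops: nat)

definition ret :: "'b \<Rightarrow> 'b timed" where
  "ret x = Timed x 0"

definition bind_timed :: "'b timed \<Rightarrow> ('b \<Rightarrow> 'c timed) \<Rightarrow> 'c timed" where
  "bind_timed m f = Timed (result (f (result m))) (ops m + ops (f (result m)))"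

adhoc_overloading Monad_Syntax.bind \<rightleftharpoons> bind_timed

primrec mapT :: "('b \<Rightarrow> 'c timed) \<Rightarrow> 'b list \<Rightarrow> 'c list timed" where
  "mapT f [] = ret []"
| "mapT f (x # xs) = do { y \<leftarrow> f x; ys \<leftarrow> mapT f xs; ret (y # ys) }"

text \<open>
  \<open>mult_ops n\<close> is $M(n)$, the cost of multiplying two polynomials of degree at most \<open>n\<close>;
  \<open>mulmod_ops n\<close> the cost of a multiplication modulo a fixed polynomial of degree \<open>n\<close>;
  \<open>xgcd_ops n\<close> the cost of a partial extended gcd in degree \<open>n\<close>.
  These count operations in the base field, whatever that field is.
  \<open>sparse_ops w n\<close> is the number of operations over the ring of integers modulo \<open>q ^ w - 1\<close> for
  solving an \<open>n \<times> n\<close> sparse system with \<open>O(w)\<close> nonzero coefficients per row; one such ring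
  operation costs \<open>mult_ops w\<close> operations in the base field.
\<close>

record op_counts =
  mult_ops :: "nat \<Rightarrow> nat"
  mulmod_ops :: "nat \<Rightarrow> nat"
  xgcd_ops :: "nat \<Rightarrow> nat"
  sparse_ops :: "nat \<Rightarrow> nat \<Rightarrow> nat"

text \<open>
  The conditions on $M$ are the ones customary for multiplication times (von zur Gathen and
  Gerhard, Modern Computer Algebra, Section 8.3): it is at least linear, $M(n)/n$ is
  nondecreasing, and it is at most quadratic.
\<close>

definition usual_costs :: "op_counts \<Rightarrow> bool" where
  "usual_costs c \<longleftrightarrow>
     (\<forall>n. n \<le> mult_ops c n) \<and>
     (\<forall>m n. 1 \<le> m \<and> m \<le> n \<longrightarrow> real (mult_ops c m) / real m \<le> real (mult_ops c n) / real n) \<and>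
     (\<forall>m n. 1 \<le> m \<and> 1 \<le> n \<longrightarrow> mult_ops c (m * n) \<le> m\<^sup>2 * mult_ops c n) \<and>
     (\<lambda>n. real (mulmod_ops c n)) \<in> O(\<lambda>n. real (mult_ops c n)) \<and>
     (\<lambda>n. real (xgcd_ops c n)) \<in> O(\<lambda>n. real (mult_ops c n) * ln (real n)) \<and>
     (\<exists>K. \<forall>w n. sparse_ops c w n \<le> K * w * n\<^sup>2)"


section \<open>The input\<close>

text \<open>
  Polynomials are those of \<^theory>\<open>HOL-Algebra.Polynomials\<close>: coefficient lists, leading
  coefficient first. \<open>Q\<close> is primitive if the class of \<open>X\<close> generates the multiplicative group
  of the field $F[X]/(Q)$.
\<close>

definition primitive_poly :: "('a, 'b) ring_scheme \<Rightarrow> 'a list \<Rightarrow> bool" where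
  "primitive_poly F Q \<longleftrightarrow>
     Q \<in> carrier (poly_ring F) \<and> lead_coeff Q = \<one>\<^bsub>F\<^esub> \<and> pirreducible\<^bsub>F\<^esub> (carrier F) Q \<and>
     generate (mult_of (Rupt\<^bsub>F\<^esub> (carrier F) Q)) {ring.rupture_surj F (carrier F) Q X\<^bsub>F\<^esub>}
       = carrier (mult_of (Rupt\<^bsub>F\<^esub> (carrier F) Q))"

section \<open>The algorithm\<close>

text \<open>
  Data computed once: \<open>support\<close> lists $\mathbb{F}_q$ as $0, 1, g, g^2, \ldots$ for a generator
  $g$ of the multiplicative group; \<open>xk\<close> and \<open>qinv\<close> are the values of $X^k$ and $1/Q$ on it;
  \<open>chirp\<close> lists $g^{i(i-1)/2}$ for $i \le 2q - 4$ and \<open>chirp_inv\<close> the inverses of its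
  first $q - 1$ entries.
\<close>

record 'a tables =
  support :: "'a list"
  xk :: "'a list"
  qinv :: "'a list"
  chirp :: "'a list"
  chirp_inv :: "'a list"

context ring
begin

subsection \<open>Primitive operations\<close>

definition fmul :: "'a \<Rightarrow> 'a \<Rightarrow> 'a timed" where "fmul a b = Timed (a \<otimes> b) 1"
definition fsub :: "'a \<Rightarrow> 'a \<Rightarrow> 'a timed" where "fsub a b = Timed (a \<ominus> b) 1"
definition fneg :: "'a \<Rightarrow> 'a timed" where "fneg a = Timed (\<ominus> a) 1"
definition finv :: "'a \<Rightarrow> 'a timed" where "finv a = Timed (inv a) 1"
definition fzero :: "'a \<Rightarrow> bool timed" where "fzero a = Timed (a = \<zero>) 1"

definition peq :: "'a list \<Rightarrow> 'a list \<Rightarrow> bool timed" where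
  "peq p r = Timed (p = r) (max (length p) (length r))"

definition pmul :: "op_counts \<Rightarrow> 'a list \<Rightarrow> 'a list \<Rightarrow> 'a list timed" where
  "pmul c p r = Timed (p \<otimes>\<^bsub>poly_ring R\<^esub> r) (mult_ops c (max (degree p) (degree r)))"

definition pmulmod :: "op_counts \<Rightarrow> 'a list \<Rightarrow> 'a list \<Rightarrow> 'a list \<Rightarrow> 'a list timed" where
  "pmulmod c Q p r = Timed ((p \<otimes>\<^bsub>poly_ring R\<^esub> r) pmod Q) (mulmod_ops c (degree Q))"

text \<open>
  \<open>eea g0 g1 i\<close> consists of the $i$-th and $(i+1)$-st remainders $r$ of the extended Euclidean
  algorithm and of their cofactors $v$ with respect to \<open>g1\<close>,
  so that $r \equiv v g_1$ modulo $g_0$.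
\<close>

primrec eea :: "'a list \<Rightarrow> 'a list \<Rightarrow> nat \<Rightarrow> ('a list \<times> 'a list) \<times> ('a list \<times> 'a list)" where
  "eea g0 g1 0 = ((g0, g1), (\<zero>\<^bsub>poly_ring R\<^esub>, \<one>\<^bsub>poly_ring R\<^esub>))"
| "eea g0 g1 (Suc i) =
     (case eea g0 g1 i of ((r, r'), (v, v')) \<Rightarrow>
        ((r', r pmod r'), (v', v \<ominus>\<^bsub>poly_ring R\<^esub> (r pdiv r') \<otimes>\<^bsub>poly_ring R\<^esub> v')))"

text \<open>The cofactor belonging to the first remainder of degree less than \<open>d\<close>.\<close>

definition partial_xgcd :: "op_counts \<Rightarrow> 'a list \<Rightarrow> 'a list \<Rightarrow> nat \<Rightarrow> 'a list timed" where
  "partial_xgcd c g0 g1 d =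
     (let i = (LEAST i. degree (fst (fst (eea g0 g1 i))) < d)
      in Timed (fst (snd (eea g0 g1 i))) (xgcd_ops c (degree g0)))"

text \<open>
  The system given by the relations $X^u v \equiv G$ modulo $Q$, where $G$ is the product of all
  $X - a$. All rows share the sum over the whole field, which is the logarithm of the class of
  $G$; apart from it a row has one nonzero coefficient for each of the at most $h$ roots of $v$.
\<close>

definition solve_logs ::
  "op_counts \<Rightarrow> nat \<Rightarrow> (nat \<times> 'a list) list \<Rightarrow> ('a \<Rightarrow> nat) timed" where
  "solve_logs c h rels =
     Timed
       (SOME x. (\<forall>a\<in>carrier R. x a < order R ^ h - 1) \<and>
          (\<forall>(u, rs)\<in>set rels.
             [u + (\<Sum>b\<leftarrow>rs. x b) = (\<Sum>a\<in>carrier R. x a)] (mod (order R ^ h - 1))))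
       (sparse_ops c h (order R) * mult_ops c h)"

subsection \<open>Derived operations\<close>

fun powmod :: "op_counts \<Rightarrow> 'a list \<Rightarrow> 'a list \<Rightarrow> nat \<Rightarrow> 'a list timed" where
  "powmod c Q p e =
     (if e = 0 then ret (\<one>\<^bsub>poly_ring R\<^esub> pmod Q)
      else do {
        s \<leftarrow> powmod c Q p (e div 2);
        s2 \<leftarrow> pmulmod c Q s s;
        if odd e then pmulmod c Q s2 p else ret s2
      })"

declare powmod.simps [simp del]

primrec powers :: "'a \<Rightarrow> nat \<Rightarrow> ('a list \<times> 'a) timed" where
  "powers g 0 = ret ([], \<one>)"
| "powers g (Suc n) = do {
     (ps, p) \<leftarrow> powers g n;
     p' \<leftarrow> fmul p g;
     ret (ps @ [p], p')
   }"

primrec chirps :: "'a \<Rightarrow> nat \<Rightarrow> ('a list \<times> 'a \<times> 'a) timed" where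
  "chirps g 0 = ret ([], \<one>, \<one>)"
| "chirps g (Suc n) = do {
     (ts, t, p) \<leftarrow> chirps g n;
     t' \<leftarrow> fmul t p;
     p' \<leftarrow> fmul p g;
     ret (ts @ [t], t', p')
   }"

text \<open>
  The sums $\sum_{i < N} p_i g^{ij}$ for $j < N = q - 1$, by a single polynomial product
  (Bluestein's method), using $ij = {i + j \choose 2} - {i \choose 2} - {j \choose 2}$.
  The sequence $p$ is listed from index $0$ upwards; as a leading-coefficient-first list the
  first factor is therefore $\sum_i p_i g^{-i(i-1)/2} X^{N-1-i}$.
\<close>

definition dft :: "op_counts \<Rightarrow> 'a tables \<Rightarrow> 'a list \<Rightarrow> 'a list timed" where
  "dft c T p = do {
     s \<leftarrow> mapT (\<lambda>(x, t). fmul x t) (zip p (chirp_inv T));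
     r \<leftarrow> pmul c (normalize s) (normalize (rev (chirp T)));
     mapT (\<lambda>(j, t). fmul (coeff r (order R - 2 + j)) t)
       (zip [0..<order R - 1] (chirp_inv T))
   }"

text \<open>Values on \<open>support\<close> of a polynomial of degree less than $q - 1$.\<close>

definition eval_support :: "op_counts \<Rightarrow> 'a tables \<Rightarrow> 'a list \<Rightarrow> 'a list timed" where
  "eval_support c T p = do {
     d \<leftarrow> dft c T (map (coeff p) [0..<order R - 1]);
     ret (coeff p 0 # d)
   }"

text \<open>
  The polynomial of degree less than $q$ with the values \<open>y\<close> on \<open>support\<close>. It is
  $\sum_a y_a (1 - (X-a)^{q-1})$, and $(X - a)^{q-1} = \sum_m a^{q-1-m} X^m$.
\<close>

definition interpolate :: "op_counts \<Rightarrow> 'a tables \<Rightarrow> 'a list \<Rightarrow> 'a list timed" where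
  "interpolate c T y = do {
     d \<leftarrow> dft c T (tl y);
     e \<leftarrow> mapT fneg d;
     l \<leftarrow> fsub (hd e) (hd y);
     ret (normalize (l # tl e @ [hd y]))
   }"

subsection \<open>The relation search\<close>

text \<open>
  The class of $X$ raised to the power $(q^h-1)/(q-1)$ is a constant that generates the
  multiplicative group of the base field.
\<close>

definition precompute :: "op_counts \<Rightarrow> 'a list \<Rightarrow> 'a tables timed" where
  "precompute c Q = do {
     let q = order R;
     let h = degree Q;
     w \<leftarrow> powmod c Q X ((q ^ h - 1) div (q - 1));
     let g = coeff w 0;
     (gs, _) \<leftarrow> powers g (q - 1);
     (ks, _) \<leftarrow> powers (gs ! (q - 2 * h)) (q - 1);
     (ts, _) \<leftarrow> chirps g (2 * q - 3);
     tinv \<leftarrow> mapT finv (take (q - 1) ts);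
     let T = \<lparr> support = \<zero> # gs, xk = \<zero> [^] (q - 2 * h) # ks, qinv = [],
               chirp = ts, chirp_inv = tinv \<rparr>;
     Qs \<leftarrow> eval_support c T Q;
     qi \<leftarrow> mapT finv Qs;
     ret (T\<lparr>qinv := qi\<rparr>)
   }"

definition received_word :: "'a tables \<Rightarrow> 'a list \<Rightarrow> 'a list timed" where
  "received_word T fs =
     mapT (\<lambda>(fa, qa, ka). do { s \<leftarrow> fmul fa qa; s' \<leftarrow> fneg s; fsub s' ka })
       (zip fs (zip (qinv T) (xk T)))"

definition make_monic :: "'a list \<Rightarrow> 'a list timed" where
  "make_monic v = do { l \<leftarrow> finv (lead_coeff v); mapT (fmul l) v }"

definition find_roots :: "op_counts \<Rightarrow> 'a tables \<Rightarrow> 'a list \<Rightarrow> 'a list timed" where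
  "find_roots c T v = do {
     vs \<leftarrow> eval_support c T v;
     zs \<leftarrow> mapT fzero vs;
     ret (map fst (filter snd (zip (support T) zs)))
   }"

text \<open>
  Steps 1 to 3 for one choice of \<open>u\<close>; \<open>None\<close> is a decoding failure. Since the set $A$ is
  required to have $q - h$ elements, $v$ must have degree exactly $h$. The divisibility of
  $G = X^q - X$ by $v$ is tested by computing $X^q$ modulo $v$.
\<close>

definition trial :: "op_counts \<Rightarrow> 'a list \<Rightarrow> 'a tables \<Rightarrow> nat \<Rightarrow> (nat \<times> 'a list) option timed" where
  "trial c Q T u = do {
     let q = order R;
     let h = degree Q;
     let Xk = monom \<one> (q - 2 * h);
     let G = monom \<one> q \<ominus>\<^bsub>poly_ring R\<^esub> X;
     f \<leftarrow> powmod c Q X u;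
     fs \<leftarrow> eval_support c T f;
     y \<leftarrow> received_word T fs;
     I \<leftarrow> interpolate c T y;
     v \<leftarrow> partial_xgcd c (G pdiv Xk) (I pdiv Xk) h;
     if degree v \<noteq> h then ret None
     else do {
       v \<leftarrow> make_monic v;
       w \<leftarrow> powmod c v X q;
       b \<leftarrow> peq w X;
       if b then do { rs \<leftarrow> find_roots c T v; ret (Some (u, rs)) }
       else ret None
     }
   }"

text \<open>
  \<open>search c Q T tape i\<close> is the list of relations after $i$ rounds, the $j$-th round using the
  random exponent \<open>tape j\<close>. Once there are $q$ relations, it no longer does anything.
\<close>

primrec search ::
  "op_counts \<Rightarrow> 'a list \<Rightarrow> 'a tables \<Rightarrow> (nat \<Rightarrow> nat) \<Rightarrow> nat \<Rightarrow> (nat \<times> 'a list) list timed"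
  where
  "search c Q T tape 0 = ret []"
| "search c Q T tape (Suc i) = do {
     rels \<leftarrow> search c Q T tape i;
     if length rels < order R then do {
       t \<leftarrow> trial c Q T (tape i);
       ret (case t of None \<Rightarrow> rels | Some r \<Rightarrow> rels @ [r])
     }
     else ret rels
   }"

subsection \<open>The whole algorithm, its running time and its storage\<close>

text \<open>\<open>None\<close> means that the search for relations does not terminate on this random tape.\<close>

definition RSDL_FQ :: "op_counts \<Rightarrow> 'a list \<Rightarrow> (nat \<Rightarrow> nat) \<Rightarrow> ('a \<Rightarrow> nat) timed option" where
  "RSDL_FQ c Q tape =
     (let done = (\<lambda>i. length (result (search c Q (result (precompute c Q)) tape i)) = order R)
      in if \<exists>i. done i
         then Some (do {
           T \<leftarrow> precompute c Q;
           rels \<leftarrow> search c Q T tape (LEAST i. done i);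
           solve_logs c (degree Q) rels
         })
         else None)"

definition running_time :: "op_counts \<Rightarrow> 'a list \<Rightarrow> (nat \<Rightarrow> nat) \<Rightarrow> ennreal" where
  "running_time c Q tape =
     (case RSDL_FQ c Q tape of None \<Rightarrow> \<infinity> | Some m \<Rightarrow> of_nat (ops m))"

text \<open>The exponents $u$ are independent and uniform modulo $q^h - 1$.\<close>

definition random_tapes :: "nat \<Rightarrow> (nat \<Rightarrow> nat) measure" where
  "random_tapes h =
     (\<Pi>\<^sub>M i\<in>UNIV. measure_pmf (pmf_of_set {..<order R ^ h - 1}))"

definition expected_time :: "op_counts \<Rightarrow> 'a list \<Rightarrow> ennreal" where
  "expected_time c Q = (\<integral>\<^sup>+ tape. running_time c Q tape \<partial>random_tapes (degree Q))"

text \<open>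
  The sizes in bits of the objects in memory after $i$ rounds: the coefficients of $Q$ and the
  precomputed tables, whose entries are elements of $\mathbb{F}_q$, and the relations, each of
  which is one object consisting of the number $u$ and the roots of $v$.
\<close>

definition elem_bits :: int where
  "elem_bits = bitlen (int (order R) - 1)"

definition storage :: "op_counts \<Rightarrow> 'a list \<Rightarrow> (nat \<Rightarrow> nat) \<Rightarrow> nat \<Rightarrow> int list" where
  "storage c Q tape i =
     (let T = result (precompute c Q) in
      map (\<lambda>_. elem_bits) (Q @ support T @ xk T @ qinv T @ chirp T @ chirp_inv T) @
      map (\<lambda>(u, rs). bitlen (int u) + int (length rs) * elem_bits)
        (result (search c Q T tape i)))"

end

end

theory Submission
  imports Defs
begin

text \<open>
  \<^bold>\<open>Probability of success.\<close> Write $q$ for the order of the field and, for a set $B$ of $h$ field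
  elements, $v_B$ for the product of the $X - b$ with $b \in B$ and $p_B$ for the product of the
  $X - a$ with $a \notin B$, so that $v_B p_B = G$. A round succeeds with the exponent $u$ as soon
  as $X^u \equiv p_B$ modulo $Q$ for some $B$ (\<open>decoding\<close>, \<open>trial_success\<close>). Each $p_B$ is
  a nonzero class, hence a power of the class of $X$. Different sets give different classes: if
  $p_B \equiv p_{B'}$, then $v_B \equiv v_{B'}$ because both products with these classes are $G$,
  and two monic polynomials of degree $h$ that agree modulo $Q$ are equal. So at least
  $q \choose h$ of the $q^h - 1$ exponents succeed (\<open>card_successes\<close>), a proportion of at least
  $1 / (2 h!)$ once $q \ge 2h^2$ (\<open>power_le_choose\<close>).

  \<^bold>\<open>Number of rounds.\<close> Whether a round still has to be carried out depends on the earlier exponents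
  only, so it is independent of the success of that round. The expected number of rounds times the
  probability of success is therefore the expected number of successes, which is at most $q$
  (Wald's identity, \<open>expected_rounds\<close>). On average there are at most $2 h! q$ rounds.

  \<^bold>\<open>Cost of a round.\<close> Evaluation and interpolation on the whole field are discrete Fourier
  transforms of length $q - 1$, each made from one product of polynomials of degree below $2q$,
  and $M(2q) \le 4 M(q)$. Everything else takes $O(q)$ operations, or is a power modulo a
  polynomial of degree $h$ or a Euclidean algorithm in degree $2h$; for fixed $h$ these cost
  at most $O(\log q)$ and are below $q$ when $q$ is large. The constant in $O(M(q))$ is thus independent
  of $h$ (\<open>ops_trial\<close>), and the search takes $O(h! \cdot q M(q))$ operations. The linear system
  costs $O(h q^2 M(h))$; since $M(n)/n$ is nondecreasing this is $O(h^2 q M(q))$, and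
  $h^2 \le 2 h!$ (\<open>total_cost_le\<close>).

  \<^bold>\<open>Storage.\<close> The tables hold $O(q)$ field elements, and there are at most $q$ relations. A
  relation has at most $h$ roots because they are roots of a nonzero polynomial of degree $h$
  (\<open>trial_relation\<close>).

  That the Fourier transforms compute values and interpolation polynomials rests on the
  precomputed element being a generator of the multiplicative group of the base field: it is the
  norm of a generator of the group of the extension (\<open>gen_facts\<close>).
\<close>

section \<open>Polynomials over a field\<close>

context field
begin

abbreviation P where "P \<equiv> poly_ring R"

interpretation P: domain P
  by (rule univ_poly_is_domain[OF carrier_is_subring])

lemma poly_set: "p \<in> carrier P \<Longrightarrow> set p \<subseteq> carrier R"
  using polynomial_in_carrier[OF carrier_is_subring] by (simp add: univ_poly_carrier)

lemma poly_lead_nonzero: "p \<in> carrier P \<Longrightarrow> p \<noteq> [] \<Longrightarrow> lead_coeff p \<noteq> \<zero>"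
  by (auto simp: univ_poly_carrier[symmetric] polynomial_def)

lemma polyI: "set p \<subseteq> carrier R \<Longrightarrow> p = [] \<or> lead_coeff p \<noteq> \<zero> \<Longrightarrow> p \<in> carrier P"
  by (auto simp: univ_poly_carrier[symmetric] polynomial_def)

lemma normalize_poly: "set p \<subseteq> carrier R \<Longrightarrow> normalize p \<in> carrier P"
  using normalize_gives_polynomial univ_poly_carrier by blast

lemma poly_coeff_closed: "p \<in> carrier P \<Longrightarrow> coeff p i \<in> carrier R"
  using poly_set by auto

lemma coeff_poly_add:
  "p \<in> carrier P \<Longrightarrow> r \<in> carrier P
    \<Longrightarrow> coeff (p \<oplus>\<^bsub>P\<^esub> r) i = coeff p i \<oplus> coeff r i"
  by (simp add: univ_poly_add poly_add_coeff poly_set del: poly_add.simps)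

lemma coeff_poly_uminus:
  assumes p: "p \<in> carrier P"
  shows "coeff (\<ominus>\<^bsub>P\<^esub> p) i = \<ominus> coeff p i"
proof -
  have "coeff (p \<oplus>\<^bsub>P\<^esub> \<ominus>\<^bsub>P\<^esub> p) i = \<zero>"
    using p by (simp add: P.r_neg univ_poly_zero)
  hence "coeff p i \<oplus> coeff (\<ominus>\<^bsub>P\<^esub> p) i = \<zero>"
    using p by (simp add: coeff_poly_add)
  thus ?thesis
    using p by (metis P.a_inv_closed local.add.inv_equality local.add.m_comm poly_coeff_closed)
qed

lemma coeff_poly_minus:
  "p \<in> carrier P \<Longrightarrow> r \<in> carrier P
    \<Longrightarrow> coeff (p \<ominus>\<^bsub>P\<^esub> r) i = coeff p i \<ominus> coeff r i"
  by (simp add: a_minus_def coeff_poly_add coeff_poly_uminus)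

lemma length_le_iff:
  assumes p: "p \<in> carrier P"
  shows "length p \<le> n \<longleftrightarrow> (\<forall>i\<ge>n. coeff p i = \<zero>)"
proof
  assume "\<forall>i\<ge>n. coeff p i = \<zero>"
  show "length p \<le> n"
  proof (rule ccontr)
    assume "\<not> length p \<le> n"
    hence "p \<noteq> []" "degree p \<ge> n" by auto
    thus False
      using \<open>\<forall>i\<ge>n. coeff p i = \<zero>\<close> p poly_lead_nonzero lead_coeff_simp by metis
  qed
qed (use coeff_length in auto)

lemma length_add_le:
  assumes "p \<in> carrier P" "r \<in> carrier P" "length p \<le> n" "length r \<le> n"
  shows "length (p \<oplus>\<^bsub>P\<^esub> r) \<le> n"
  using assms by (simp add: length_le_iff coeff_poly_add)

lemma length_uminus [simp]:
  "p \<in> carrier P \<Longrightarrow> length (\<ominus>\<^bsub>P\<^esub> p) = length p"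
  by (rule univ_poly_a_inv_length[OF carrier_is_subring])

lemma length_minus_le:
  assumes "p \<in> carrier P" "r \<in> carrier P" "length p \<le> n" "length r \<le> n"
  shows "length (p \<ominus>\<^bsub>P\<^esub> r) \<le> n"
  using assms by (simp add: a_minus_def length_add_le)

lemma length_mult:
  assumes "p \<in> carrier P" "r \<in> carrier P" "p \<noteq> []" "r \<noteq> []"
  shows "length (p \<otimes>\<^bsub>P\<^esub> r) = length p + length r - 1"
proof -
  have "p \<otimes>\<^bsub>P\<^esub> r \<noteq> []"
    using assms P.integral[of p r] by (auto simp: univ_poly_zero)
  moreover have "degree (p \<otimes>\<^bsub>P\<^esub> r) = degree p + degree r"
    using poly_mult_degree_eq[OF carrier_is_subring, of p r] assms
    by (simp add: univ_poly_mult univ_poly_carrier)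
  ultimately show ?thesis
    using assms(3,4) by (cases p; cases r; cases "p \<otimes>\<^bsub>P\<^esub> r") auto
qed

lemma length_mult_le:
  assumes "p \<in> carrier P" "r \<in> carrier P" "length p + length r \<le> n + 1"
  shows "length (p \<otimes>\<^bsub>P\<^esub> r) \<le> n"
proof (cases "p = [] \<or> r = []")
  case True
  hence "p \<otimes>\<^bsub>P\<^esub> r = []"
    using assms(1,2) P.l_null[of r] P.r_null[of p] by (auto simp: univ_poly_zero)
  thus ?thesis by simp
qed (use assms length_mult in auto)

lemma eval_hom:
  assumes "a \<in> carrier R"
  shows "ring_hom_cring P R (\<lambda>p. eval p a)"
  using eval_cring_hom[OF carrier_is_subring assms] .

lemma eval_closed: "p \<in> carrier P \<Longrightarrow> a \<in> carrier R \<Longrightarrow> eval p a \<in> carrier R"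
  using eval_in_carrier poly_set by blast

lemma eval_add:
  "p \<in> carrier P \<Longrightarrow> r \<in> carrier P \<Longrightarrow> a \<in> carrier R
    \<Longrightarrow> eval (p \<oplus>\<^bsub>P\<^esub> r) a = eval p a \<oplus> eval r a"
  by (rule ring_hom_add[OF eval_is_hom[OF carrier_is_subring]])

lemma eval_mult:
  "p \<in> carrier P \<Longrightarrow> r \<in> carrier P \<Longrightarrow> a \<in> carrier R
    \<Longrightarrow> eval (p \<otimes>\<^bsub>P\<^esub> r) a = eval p a \<otimes> eval r a"
  by (rule ring_hom_mult[OF eval_is_hom[OF carrier_is_subring]])

lemma eval_minus:
  assumes "p \<in> carrier P" "r \<in> carrier P" "a \<in> carrier R"
  shows "eval (p \<ominus>\<^bsub>P\<^esub> r) a = eval p a \<ominus> eval r a"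
  using ring_hom_cring.hom_sub[OF eval_hom] assms by simp

lemma eval_monom_one: "a \<in> carrier R \<Longrightarrow> eval (monom \<one> n) a = a [^] n"
  by (simp add: eval_monom)

lemma eval_eq_finsum:
  assumes "set p \<subseteq> carrier R" "a \<in> carrier R" "length p \<le> n"
  shows "eval p a = (\<Oplus>i\<in>{..<n}. coeff p i \<otimes> a [^] i)"
  using assms
proof (induction p arbitrary: n)
  case Nil
  have "(\<Oplus>i\<in>{..<n}. coeff [] i \<otimes> a [^] i) = \<zero>"
    using Nil by (intro local.add.finprod_one_eqI) auto
  then show ?case by simp
next
  case (Cons x p)
  let ?m = "length p"
  have cl: "\<And>i. coeff (x # p) i \<in> carrier R" "\<And>i. coeff p i \<in> carrier R"
    using Cons.prems coeff_in_carrier[of "x # p"] coeff_in_carrier[of p] by auto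
  have split: "{..<n} = insert ?m ({..<n} - {?m})" using Cons.prems by auto
  have "(\<Oplus>i\<in>{..<n}. coeff (x # p) i \<otimes> a [^] i)
      = coeff (x # p) ?m \<otimes> a [^] ?m \<oplus> (\<Oplus>i\<in>{..<n} - {?m}. coeff (x # p) i \<otimes> a [^] i)"
    using Cons.prems cl by (subst split, subst finsum_insert) auto
  also have "(\<Oplus>i\<in>{..<n} - {?m}. coeff (x # p) i \<otimes> a [^] i) = (\<Oplus>i\<in>{..<n} - {?m}. coeff p i \<otimes> a [^] i)"
    using Cons.prems cl by (intro finsum_cong') auto
  also have "\<dots> = (\<Oplus>i\<in>{..<n}. coeff p i \<otimes> a [^] i)"
  proof -
    have "(\<Oplus>i\<in>{..<n}. coeff p i \<otimes> a [^] i)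
      = coeff p ?m \<otimes> a [^] ?m \<oplus> (\<Oplus>i\<in>{..<n} - {?m}. coeff p i \<otimes> a [^] i)"
      using Cons.prems cl by (subst split, subst finsum_insert) auto
    moreover have "coeff p ?m = \<zero>" by (simp add: coeff_length)
    ultimately show ?thesis using Cons.prems cl by (simp add: finsum_closed)
  qed
  also have "\<dots> = eval p a" using Cons.IH[of n] Cons.prems by simp
  finally show ?case by simp
qed

text \<open>
  The identities between polynomials in the analysis of the decoder are obtained by comparing
  values at sufficiently many points. A bound on the length instead of the degree covers the zero
  polynomial, the empty list, without a case distinction.
\<close>

lemma zero_poly_if_many_roots:
  assumes p: "p \<in> carrier P" and S: "finite S" "S \<subseteq> carrier R"
    and z: "\<And>a. a \<in> S \<Longrightarrow> eval p a = \<zero>" and len: "length p \<le> card S"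
  shows "p = []"
proof (rule ccontr)
  assume ne: "p \<noteq> []"
  have "mset_set S \<subseteq># roots p"
  proof (rule mset_subset_eqI)
    fix a
    show "count (mset_set S) a \<le> count (roots p) a"
    proof (cases "a \<in> S")
      case True
      hence "is_root p a" using z S ne by (auto simp: is_root_def)
      hence "a \<in># roots p" using roots_mem_iff_is_root[OF p] by simp
      hence "count (roots p) a > 0" by simp
      thus ?thesis using True S by simp
    qed simp
  qed
  hence "card S \<le> size (roots p)" using size_mset_mono[of "mset_set S" "roots p"] by simp
  also have "\<dots> \<le> degree p" by (rule size_roots_le_degree[OF p])
  finally show False using len ne by (cases p) auto
qed

lemma pdiv_pmod_id:
  assumes "p \<in> carrier P" "d \<in> carrier P"
  shows "p = (d \<otimes>\<^bsub>P\<^esub> (p pdiv d)) \<oplus>\<^bsub>P\<^esub> (p pmod d)"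
    "p pdiv d \<in> carrier P" "p pmod d \<in> carrier P"
  using pdiv_pmod[OF carrier_is_subfield assms] long_division_closed[OF carrier_is_subfield assms]
  by auto

lemma length_pmod:
  assumes "p \<in> carrier P" "d \<in> carrier P" "length d \<ge> 2"
  shows "length (p pmod d) < length d"
proof -
  have "p pmod d = [] \<or> degree (p pmod d) < degree d"
    using pmod_degree[OF carrier_is_subfield assms(1,2)] assms(3) by force
  thus ?thesis using assms(3) by auto
qed

lemma pmod_unique:
  assumes "p \<in> carrier P" "d \<in> carrier P" "d \<noteq> []"
    "b \<in> carrier P" "r \<in> carrier P"
    "p = (d \<otimes>\<^bsub>P\<^esub> b) \<oplus>\<^bsub>P\<^esub> r" "length r < length d"
  shows "p pdiv d = b" "p pmod d = r"
proof -
  have "r = [] \<or> degree r < degree d" using assms(7) by (cases r) auto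
  hence "long_divides p d (b, r)" by (intro long_dividesI assms)
  from long_divisionI[OF carrier_is_subfield assms(1-3) this]
  show "p pdiv d = b" "p pmod d = r" by auto
qed

lemma length_pdiv:
  assumes "p \<in> carrier P" "d \<in> carrier P" "length d \<ge> 1"
    "length p \<ge> length d"
  shows "length (p pdiv d) = length p - length d + 1"
proof -
  note 1 = pdiv_pmod_id[OF assms(1,2)]
  have m: "p pmod d = [] \<or> degree (p pmod d) < degree d"
    using pmod_degree[OF carrier_is_subfield assms(1,2)] assms(3) by force
  have dne: "d \<noteq> []" using assms(3) by auto
  hence mlt: "length (p pmod d) < length d" using m assms(3) by auto
  have qne: "p pdiv d \<noteq> []"
  proof
    assume "p pdiv d = []"
    hence "p = p pmod d" using 1 assms(2) by (metis P.l_zero P.r_null univ_poly_zero)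
    thus False using mlt assms(4) by simp
  qed
  have l: "length (d \<otimes>\<^bsub>P\<^esub> (p pdiv d)) = length d + length (p pdiv d) - 1"
    using 1 assms dne qne by (intro length_mult) auto
  have "length (p pdiv d) \<ge> 1" using qne by (simp add: Suc_le_eq)
  hence "length (d \<otimes>\<^bsub>P\<^esub> (p pdiv d)) > length (p pmod d)" using l mlt by simp
  hence "length p = max (length (d \<otimes>\<^bsub>P\<^esub> (p pdiv d))) (length (p pmod d))"
    using 1 assms l mlt qne
    by (subst 1(1), subst univ_poly_add, subst poly_add_length_eq[OF carrier_is_subring])
       (auto simp: univ_poly_carrier Suc_le_eq)
  thus ?thesis using l mlt qne by (cases "p pdiv d") auto
qed

end

section \<open>Results and costs of timed computations\<close>

lemma result_ret [simp]: "result (ret x) = x" and ops_ret [simp]: "ops (ret x) = 0"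
  by (simp_all add: ret_def)

lemma result_bind [simp]: "result (bind_timed m f) = result (f (result m))"
  and ops_bind [simp]: "ops (bind_timed m f) = ops m + ops (f (result m))"
  by (simp_all add: bind_timed_def)

lemma result_mapT: "result (mapT f xs) = map (\<lambda>x. result (f x)) xs"
  by (induction xs) auto

lemma ops_mapT: "ops (mapT f xs) = (\<Sum>x\<leftarrow>xs. ops (f x))"
  by (induction xs) auto

lemma ops_mapT_const: "(\<And>x. ops (f x) = k) \<Longrightarrow> ops (mapT f xs) = k * length xs"
  by (simp add: ops_mapT sum_list_triv)

section \<open>Evaluation and interpolation on the whole field\<close>

context field
begin

lemma ops_prim [simp]:
  "ops (fmul a b) = 1" "ops (fsub a b) = 1" "ops (fneg a) = 1" "ops (finv a) = 1" "ops (fzero a) = 1"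
  by (simp_all add: fmul_def fsub_def fneg_def finv_def fzero_def)

lemma result_prim [simp]:
  "result (fmul a b) = a \<otimes> b" "result (fsub a b) = a \<ominus> b" "result (fneg a) = \<ominus> a"
  "result (finv a) = inv a" "result (fzero a) = (a = \<zero>)"
  by (simp_all add: fmul_def fsub_def fneg_def finv_def fzero_def)

lemma ops_powers: "ops (powers g n) = n"
  by (induction n) (auto split: prod.splits)

lemma ops_chirps: "ops (chirps g n) = 2 * n"
  by (induction n) (auto split: prod.splits)

lemma length_powers: "length (fst (result (powers g n))) = n"
  by (induction n) (auto split: prod.splits)

lemma length_chirps: "length (fst (result (chirps g n))) = n"
  by (induction n) (auto split: prod.splits)

lemma result_powers:
  "g \<in> carrier R \<Longrightarrow> result (powers g n) = (map (\<lambda>i. g [^] i) [0..<n], g [^] n)"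
  by (induction n) auto

lemma result_chirps:
  "g \<in> carrier R \<Longrightarrow>
    result (chirps g n) = (map (\<lambda>i. g [^] (i choose 2)) [0..<n], g [^] (n choose 2), g [^] n)"
  by (induction n) (auto simp: nat_pow_mult numeral_2_eq_2 add.commute)

lemma choose_add_two: "(i + j) choose 2 = (i choose 2) + (j choose 2) + i * j" for i j :: nat
  by (induction j) (auto simp: numeral_2_eq_2)

lemma pow_Units: "g \<in> carrier R \<Longrightarrow> g \<noteq> \<zero> \<Longrightarrow> g [^] (n::nat) \<in> Units R"
  by (rule Units_pow_closed) (simp add: field_Units)

text \<open>
  Bluestein's trick: after multiplication by inverse chirps, the Fourier kernel $g^{ij}$ depends on
  $i + j$ only, which turns the transform into a convolution.
\<close>

lemma chirp_identity:
  assumes g: "g \<in> carrier R" "g \<noteq> \<zero>"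
  shows "inv (g [^] (i choose 2)) \<otimes> g [^] ((i + j) choose 2) \<otimes> inv (g [^] (j choose 2)) = g [^] (i * j)"
proof -
  have nz: "\<And>n::nat. g [^] n \<in> Units R"
    using g by (rule pow_Units)
  have c: "\<And>n::nat. g [^] n \<in> carrier R" using g by simp
  have "g [^] ((i + j) choose 2) = g [^] (i choose 2) \<otimes> (g [^] (i * j) \<otimes> g [^] (j choose 2))"
    using g by (simp add: nat_pow_mult choose_add_two ac_simps)
  thus ?thesis
    using nz c by (simp add: m_assoc[symmetric]) (simp add: m_assoc)
qed

definition chirp_tables :: "'a \<Rightarrow> 'a tables \<Rightarrow> bool" where
  "chirp_tables g T \<longleftrightarrow>
     chirp T = map (\<lambda>i. g [^] (i choose 2)) [0..<2 * order R - 3] \<and>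
     chirp_inv T = map (\<lambda>i. inv (g [^] (i choose 2))) [0..<order R - 1]"

text \<open>
  The product of the two polynomials has the convolution as its coefficients. The input is
  multiplied in reversed order, \<open>s ! i\<close> being the coefficient at \<open>N - 1 - i\<close>, so the \<open>j\<close>-th sum
  is found at \<open>N - 1 + j\<close>. All indices \<open>i + j\<close> that occur are below \<open>2 * N - 1\<close>, the number of
  chirps, so that no sum wraps around.
\<close>

lemma result_dft:
  assumes g: "g \<in> carrier R" "g \<noteq> \<zero>" and T: "chirp_tables g T"
    and p: "set p \<subseteq> carrier R" "length p = order R - 1" and q: "order R \<ge> 2"
  shows "result (dft c T p)
    = map (\<lambda>j. \<Oplus>i\<in>{..<order R - 1}. p ! i \<otimes> g [^] (i * j)) [0..<order R - 1]"
proof -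
  define N where "N = order R - 1"
  have N: "N \<ge> 1" "order R - 2 = N - 1" "2 * order R - 3 = 2 * N - 1" using q by (auto simp: N_def)
  define s where "s = map (\<lambda>(x, t). x \<otimes> t) (zip p (chirp_inv T))"
  define t where "t = rev (chirp T)"
  have unit: "\<And>n::nat. g [^] n \<in> Units R" and cl: "\<And>n::nat. g [^] n \<in> carrier R"
    using g by (simp_all add: pow_Units)
  have invcl: "\<And>n::nat. inv (g [^] n) \<in> carrier R" using unit by simp
  have pcl: "\<And>i. i < N \<Longrightarrow> p ! i \<in> carrier R" using p by (auto simp: N_def)
  have ls: "length s = N" and lt: "length t = 2 * N - 1"
    using T p N by (simp_all add: s_def t_def chirp_tables_def N_def)
  have s_nth: "s ! i = p ! i \<otimes> inv (g [^] (i choose 2))" if "i < N" for i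
    using that T p by (simp add: s_def chirp_tables_def N_def)
  have s_set: "set s \<subseteq> carrier R"
    using s_nth pcl invcl ls by (auto simp: in_set_conv_nth)
  have t_set: "set t \<subseteq> carrier R" using T cl by (auto simp: t_def chirp_tables_def)
  have coeff_t: "coeff t m = g [^] (m choose 2)" if "m < 2 * N - 1" for m
  proof -
    have "2 * N - Suc (Suc (2 * N - Suc (Suc m))) = m" using that by arith
    thus ?thesis using that lt T N by (subst coeff_nth) (auto simp: t_def rev_nth chirp_tables_def)
  qed
  have coeff_s: "coeff s k = (if k < N then s ! (N - 1 - k) else \<zero>)" for k
    using ls coeff_nth[of k s] coeff_length[of s k] by auto
  have main: "coeff (normalize s \<otimes>\<^bsub>P\<^esub> normalize t) (N - 1 + j) \<otimes> inv (g [^] (j choose 2))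
      = (\<Oplus>i\<in>{..<N}. p ! i \<otimes> g [^] (i * j))" if j: "j < N" for j
  proof -
    have "coeff (normalize s \<otimes>\<^bsub>P\<^esub> normalize t) (N - 1 + j)
       = (\<Oplus>k\<in>{..N - 1 + j}. coeff s k \<otimes> coeff t (N - 1 + j - k))"
      using s_set t_set
      by (simp add: univ_poly_mult poly_mult_coeff normalize_in_carrier normalize_coeff[symmetric])
    also have "\<dots> = (\<Oplus>k\<in>{..<N}. coeff s k \<otimes> coeff t (N - 1 + j - k))"
      using s_set t_set N ls
      by (intro local.add.finprod_mono_neutral_cong_right) (auto simp: coeff_length)
    also have "\<dots> = (\<Oplus>k\<in>(\<lambda>i. N - 1 - i) ` {..<N}. coeff s k \<otimes> coeff t (N - 1 + j - k))"
    proof -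
      have "(\<lambda>i. N - 1 - i) ` {..<N} = {..<N}"
      proof (intro equalityI subsetI)
        fix k assume "k \<in> {..<N}"
        hence "k = N - 1 - (N - 1 - k)" "N - 1 - k \<in> {..<N}" by auto
        thus "k \<in> (\<lambda>i. N - 1 - i) ` {..<N}" by blast
      qed (use N in auto)
      thus ?thesis by simp
    qed
    also have "\<dots> = (\<Oplus>i\<in>{..<N}. coeff s (N - 1 - i) \<otimes> coeff t (N - 1 + j - (N - 1 - i)))"
      using s_set t_set by (intro finsum_reindex) (auto simp: inj_on_def)
    also have "\<dots> = (\<Oplus>i\<in>{..<N}. p ! i \<otimes> inv (g [^] (i choose 2)) \<otimes> g [^] ((i + j) choose 2))"
    proof (intro finsum_cong')
      fix i assume i: "i \<in> {..<N}"
      have idx: "N - 1 + j - (N - 1 - i) = i + j" using i by auto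
      have "i + j < 2 * N - 1" using i j by auto
      thus "coeff s (N - 1 - i) \<otimes> coeff t (N - 1 + j - (N - 1 - i))
          = p ! i \<otimes> inv (g [^] (i choose 2)) \<otimes> g [^] ((i + j) choose 2)"
        unfolding idx using i by (simp add: coeff_s coeff_t s_nth)
    qed (use pcl invcl cl in auto)
    finally have "coeff (normalize s \<otimes>\<^bsub>P\<^esub> normalize t) (N - 1 + j) \<otimes> inv (g [^] (j choose 2))
       = (\<Oplus>i\<in>{..<N}. (p ! i \<otimes> inv (g [^] (i choose 2)) \<otimes> g [^] ((i + j) choose 2)) \<otimes> inv (g [^] (j choose 2)))"
      using pcl invcl cl by (simp add: finsum_ldistr)
    also have "\<dots> = (\<Oplus>i\<in>{..<N}. p ! i \<otimes> g [^] (i * j))"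
    proof (intro finsum_cong')
      fix i assume i: "i \<in> {..<N}"
      show "p ! i \<otimes> inv (g [^] (i choose 2)) \<otimes> g [^] ((i + j) choose 2) \<otimes> inv (g [^] (j choose 2))
        = p ! i \<otimes> g [^] (i * j)"
        using i pcl invcl cl chirp_identity[OF g, of i j] by (simp add: m_assoc)
    qed (use pcl cl in auto)
    finally show ?thesis .
  qed
  have "result (dft c T p) = map (\<lambda>(j, u). coeff (normalize s \<otimes>\<^bsub>P\<^esub> normalize t) (N - 1 + j) \<otimes> u)
       (zip [0..<N] (chirp_inv T))"
    by (simp add: dft_def result_mapT s_def t_def N_def pmul_def case_prod_unfold
        numeral_2_eq_2)
  also have "\<dots> = map (\<lambda>j. \<Oplus>i\<in>{..<N}. p ! i \<otimes> g [^] (i * j)) [0..<N]"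
    using T main by (intro nth_equalityI) (auto simp: chirp_tables_def N_def)
  finally show ?thesis by (simp add: N_def)
qed

end

context field
begin

lemma finsum_lessThan_Suc:
  "f \<in> {..<Suc n} \<rightarrow> carrier R \<Longrightarrow> (\<Oplus>i\<in>{..<Suc n}. f i) = f n \<oplus> (\<Oplus>i\<in>{..<n}. f i)"
  unfolding lessThan_Suc by (rule finsum_insert) auto

lemma finsum_swap:
  assumes "finite A" "finite B" "\<And>i j. i \<in> A \<Longrightarrow> j \<in> B \<Longrightarrow> f i j \<in> carrier R"
  shows "(\<Oplus>i\<in>A. \<Oplus>j\<in>B. f i j) = (\<Oplus>j\<in>B. \<Oplus>i\<in>A. f i j)"
  using assms(1,3)
proof (induction A rule: finite_induct)
  case empty
  then show ?case using finsum_zero by simp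
next
  case (insert x A)
  have "(\<Oplus>i\<in>insert x A. \<Oplus>j\<in>B. f i j) = (\<Oplus>j\<in>B. f x j) \<oplus> (\<Oplus>i\<in>A. \<Oplus>j\<in>B. f i j)"
    using insert assms(2) by (intro finsum_insert) (auto intro!: finsum_closed)
  also have "\<dots> = (\<Oplus>j\<in>B. f x j) \<oplus> (\<Oplus>j\<in>B. \<Oplus>i\<in>A. f i j)" using insert by simp
  also have "\<dots> = (\<Oplus>j\<in>B. f x j \<oplus> (\<Oplus>i\<in>A. f i j))"
    using insert by (intro finsum_addf[symmetric]) (auto intro!: finsum_closed)
  also have "\<dots> = (\<Oplus>j\<in>B. \<Oplus>i\<in>insert x A. f i j)"
    using insert by (intro finsum_cong') (auto intro!: finsum_closed)
  finally show ?case .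
qed

lemma telescope_identities:
  assumes "x \<in> carrier R" "y \<in> carrier R" "s \<in> carrier R" "p \<in> carrier R" "r \<in> carrier R"
  shows "(x \<ominus> y) \<otimes> (p \<otimes> y \<oplus> s \<otimes> y) = ((x \<ominus> y) \<otimes> s) \<otimes> y \<oplus> (x \<ominus> y) \<otimes> p \<otimes> y"
    "y \<otimes> (p \<ominus> r) \<otimes> y \<oplus> (x \<ominus> y) \<otimes> p \<otimes> y = y \<otimes> (p \<otimes> x \<ominus> r \<otimes> y)"
    "\<ominus> x \<ominus> y \<oplus> (y \<oplus> s) = \<ominus> x \<oplus> s"
  using assms by algebra+

text \<open>
  For distinct \<open>a\<close> and \<open>b\<close> of order dividing \<open>n\<close> the right side vanishes and so does the sum: this is
  the orthogonality relation on which the inversion of the Fourier transform rests.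
\<close>

lemma geometric_telescope:
  fixes n :: nat
  assumes a: "a \<in> carrier R" and b: "b \<in> carrier R"
  shows "(a \<ominus> b) \<otimes> (\<Oplus>j\<in>{..<n}. a [^] j \<otimes> b [^] (n - j)) = b \<otimes> (a [^] n \<ominus> b [^] n)"
proof (induction n)
  case 0
  show ?case using a b by (simp add: r_neg a_minus_def)
next
  case (Suc n)
  let ?T = "\<lambda>n. (\<Oplus>j\<in>{..<n}. a [^] j \<otimes> b [^] (n - j))"
  have cl: "?T n \<in> carrier R" "a [^] n \<in> carrier R" "b [^] n \<in> carrier R"
    using a b by (auto intro!: finsum_closed)
  have "?T (Suc n) = a [^] n \<otimes> b \<oplus> (\<Oplus>j\<in>{..<n}. a [^] j \<otimes> b [^] (Suc n - j))"
    using a b by (subst finsum_lessThan_Suc) auto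
  also have "(\<Oplus>j\<in>{..<n}. a [^] j \<otimes> b [^] (Suc n - j)) = (\<Oplus>j\<in>{..<n}. (a [^] j \<otimes> b [^] (n - j)) \<otimes> b)"
    using a b by (intro finsum_cong') (auto simp: Suc_diff_le m_assoc)
  also have "\<dots> = ?T n \<otimes> b" using a b by (intro finsum_ldistr[symmetric]) auto
  finally have "(a \<ominus> b) \<otimes> ?T (Suc n) = (a \<ominus> b) \<otimes> (a [^] n \<otimes> b \<oplus> ?T n \<otimes> b)" by simp
  also have "\<dots> = ((a \<ominus> b) \<otimes> ?T n) \<otimes> b \<oplus> (a \<ominus> b) \<otimes> a [^] n \<otimes> b"
    using telescope_identities(1)[OF a b cl] by simp
  also have "\<dots> = b \<otimes> (a [^] n \<ominus> b [^] n) \<otimes> b \<oplus> (a \<ominus> b) \<otimes> a [^] n \<otimes> b" using Suc by simp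
  also have "\<dots> = b \<otimes> (a [^] n \<otimes> a \<ominus> b [^] n \<otimes> b)"
    using telescope_identities(2)[OF a b cl] by simp
  finally show ?case by simp
qed

text \<open>
  There are $q - 1$ summands, and $q$ is zero in a field with $q$ elements. This is why
  interpolation needs a sign but no division by the length of the transform.
\<close>

lemma sum_one_lessThan:
  assumes fin: "finite (carrier R)"
  shows "(\<Oplus>j\<in>{..<order R - 1}. \<one>) = \<ominus> \<one>"
proof -
  have pos: "order R > 0" using fin by (auto simp: order_def card_gt_0_iff)
  have "add_pow R (order R) \<one> = \<zero>"
    using local.add.pow_order_eq_1[of \<one>] by (simp add: order_def)
  hence "add_pow R ((order R - 1) + 1) \<one> = \<zero>" using pos by simp
  hence "add_pow R (order R - 1) \<one> \<oplus> \<one> = \<zero>" by (simp add: local.add.nat_pow_Suc)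
  hence "add_pow R (order R - 1) \<one> = \<ominus> \<one>"
    using local.add.inv_equality[of "add_pow R (order R - 1) \<one>" \<one>] by simp
  moreover have "(\<Oplus>j\<in>{..<order R - 1}. \<one>) = add_pow R (order R - 1) \<one>"
    using local.add.finprod_const[of \<one> "{..<order R - 1}"] by simp
  ultimately show ?thesis by simp
qed

definition field_tables :: "'a \<Rightarrow> 'a tables \<Rightarrow> bool" where
  "field_tables g T \<longleftrightarrow> chirp_tables g T \<and>
     support T = \<zero> # map (\<lambda>i. g [^] i) [0..<order R - 1]"

lemma eval_at_zero:
  assumes "set p \<subseteq> carrier R"
  shows "eval p \<zero> = coeff p 0"
proof (cases p rule: rev_cases)
  case (snoc p' x)
  have "eval p \<zero> = eval p' \<zero> \<otimes> \<zero> \<oplus> x"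
    using snoc assms by (simp add: eval_append_aux)
  also have "\<dots> = x" using assms snoc by (simp add: eval_in_carrier)
  finally show ?thesis using snoc by (simp add: append_coeff)
qed simp

lemma result_eval_support:
  assumes g: "g \<in> carrier R" "g \<noteq> \<zero>" and T: "field_tables g T" and q: "order R \<ge> 2"
    and p: "set p \<subseteq> carrier R" "length p \<le> order R - 1"
  shows "result (eval_support c T p) = map (eval p) (support T)"
proof -
  have "result (dft c T (map (coeff p) [0..<order R - 1]))
    = map (\<lambda>j. \<Oplus>i\<in>{..<order R - 1}. map (coeff p) [0..<order R - 1] ! i \<otimes> g [^] (i * j)) [0..<order R - 1]"
    using T p by (intro result_dft g q) (auto simp: field_tables_def)
  also have "\<dots> = map (\<lambda>j. eval p (g [^] j)) [0..<order R - 1]"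
  proof (intro map_cong refl)
    fix j
    show "(\<Oplus>i\<in>{..<order R - 1}. map (coeff p) [0..<order R - 1] ! i \<otimes> g [^] (i * j)) = eval p (g [^] j)"
      using p g by (subst eval_eq_finsum[OF p(1) _ p(2)])
        (auto intro!: finsum_cong' simp: nat_pow_pow mult.commute)
  qed
  finally show ?thesis
    using T p by (simp add: eval_support_def field_tables_def eval_at_zero)
qed

text \<open>
  There are $q - 1$ nonzero elements, so the distinct powers exhaust them.
\<close>

lemma generator_facts:
  assumes fin: "finite (carrier R)" and g: "g \<in> carrier R" "g \<noteq> \<zero>"
    and inj: "inj_on (\<lambda>i. g [^] i) {..<order R - 1}"
  shows "g [^] (order R - 1) = \<one>" "(\<lambda>i. g [^] i) ` {..<order R - 1} = carrier R - {\<zero>}"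
proof -
  interpret M: group "Multiplicative_Group.mult_of R" by (rule field_mult_group)
  show "g [^] (order R - 1) = \<one>"
    using M.pow_order_eq_1[of g] g order_mult_of[OF fin] by (simp add: Multiplicative_Group.nat_pow_mult_of)
  have sub: "(\<lambda>i. g [^] i) ` {..<order R - 1} \<subseteq> carrier R - {\<zero>}"
    using pow_Units[OF g] by (auto simp: field_Units)
  moreover have "card ((\<lambda>i. g [^] i) ` {..<order R - 1}) = card (carrier R - {\<zero>})"
    unfolding card_image[OF inj] using fin by (simp add: order_def card_Diff_singleton)
  ultimately show "(\<lambda>i. g [^] i) ` {..<order R - 1} = carrier R - {\<zero>}"
    using fin by (intro card_subset_eq) auto
qed

lemma distinct_support:
  assumes fin: "finite (carrier R)" and g: "g \<in> carrier R" "g \<noteq> \<zero>"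
    and inj: "inj_on (\<lambda>i. g [^] i) {..<order R - 1}" and T: "field_tables g T"
  shows "distinct (support T)" "set (support T) = carrier R" "length (support T) = order R"
proof -
  have *: "set (map (\<lambda>i. g [^] i) [0..<order R - 1]) = carrier R - {\<zero>}"
    using generator_facts(2)[OF fin g inj] by (simp add: atLeast0LessThan)
  moreover have "distinct (map (\<lambda>i. g [^] i) [0..<order R - 1])"
    using inj by (simp add: distinct_map atLeast0LessThan)
  moreover have "order R > 0" using fin by (auto simp: order_def card_gt_0_iff)
  ultimately show "distinct (support T)" "set (support T) = carrier R" "length (support T) = order R"
    using T by (auto simp: field_tables_def)
qed

text \<open>
  The coefficients come from the expansion of the sum of the $y_a (1 - (X-a)^{q-1})$; correctness is
  checked by evaluating. At a power of \<open>g\<close> a double sum arises, in which only the index of that power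
  survives by orthogonality.
\<close>

lemma result_interpolate:
  fixes c :: op_counts and y :: "'a list"
  assumes fin: "finite (carrier R)" and g: "g \<in> carrier R" "g \<noteq> \<zero>"
    and inj: "inj_on (\<lambda>i. g [^] i) {..<order R - 1}"
    and T: "field_tables g T" and q: "order R \<ge> 2"
    and y: "set y \<subseteq> carrier R" "length y = order R"
  defines "I \<equiv> result (interpolate c T y)"
  shows "I \<in> carrier P" "length I \<le> order R"
    "\<And>k. k < order R \<Longrightarrow> eval I (support T ! k) = y ! k"
proof -
  define N where "N = order R - 1"
  have N: "order R = Suc N" "N \<ge> 1" using q by (auto simp: N_def)
  have gN: "g [^] N = \<one>" using generator_facts(1)[OF fin g inj] by (simp add: N_def)
  define D where "D = (\<lambda>j. \<Oplus>i\<in>{..<N}. y ! Suc i \<otimes> g [^] (i * j))"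
  have ycl: "y ! i \<in> carrier R" if "i \<le> N" for i using y that N by auto
  have Dcl: "D j \<in> carrier R" for j unfolding D_def using ycl g by (intro finsum_closed) auto
  have tly: "tl y ! i = y ! Suc i" if "i < N" for i using y that N by (simp add: nth_tl)
  have "result (dft c T (tl y))
      = map (\<lambda>j. \<Oplus>i\<in>{..<order R - 1}. tl y ! i \<otimes> g [^] (i * j)) [0..<order R - 1]"
    using y T N set_mono_suffix[OF suffix_tl, of y]
    by (intro result_dft g q) (auto simp: field_tables_def)
  also have "\<dots> = map D [0..<N]"
  proof (intro map_cong)
    fix j
    show "(\<Oplus>i\<in>{..<order R - 1}. tl y ! i \<otimes> g [^] (i * j)) = D j"
      unfolding D_def N_def[symmetric] using tly ycl g by (intro finsum_cong') auto
  qed (simp add: N_def)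
  finally have dft: "result (dft c T (tl y)) = map D [0..<N]" .
  have hdy: "hd y = y ! 0" using y N by (intro hd_conv_nth) auto
  define L where "L = (\<ominus> D 0 \<ominus> y ! 0) # map (\<lambda>j. \<ominus> D (Suc j)) [0..<N - 1] @ [y ! 0]"
  have upt: "[0..<N] = 0 # map Suc [0..<N - 1]" using N by (metis Suc_pred' less_eq_Suc_le map_Suc_upt upt_conv_Cons zero_less_one One_nat_def)
  have I: "I = normalize L"
    by (simp add: I_def interpolate_def dft result_mapT upt hdy L_def comp_def)
  have Lset: "set L \<subseteq> carrier R" using Dcl ycl by (auto simp: L_def)
  have Llen: "length L = Suc N" using N by (simp add: L_def)
  show "I \<in> carrier P" using I Lset normalize_poly by simp
  show "length I \<le> order R" using I Llen N normalize_length_le[of L] by simp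
  have c0: "coeff L 0 = y ! 0" using Llen coeff_nth[of 0 L] N by (simp add: L_def nth_append)
  have cm: "coeff L m = \<ominus> D (N - m)" if "1 \<le> m" "m < N" for m
  proof -
    have "N - m = Suc (N - m - 1)" "N - m - 1 < N - 1" using that by auto
    thus ?thesis using Llen coeff_nth[of m L] that by (auto simp: L_def nth_append)
  qed
  have cN: "coeff L N = \<ominus> D 0 \<ominus> y ! 0" using Llen coeff_nth[of N L] by (simp add: L_def)
  fix k assume k: "k < order R"
  have evI: "eval I x = eval L x" if "x \<in> carrier R" for x
    using I eval_normalize[OF Lset that] by simp
  show "eval I (support T ! k) = y ! k"
  proof (cases k)
    case 0
    thus ?thesis using T evI Lset c0 by (simp add: field_tables_def eval_at_zero)
  next
    case (Suc l)
    hence l: "l < N" using k N by simp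
    let ?x = "g [^] l"
    have sup: "support T ! k = ?x" using T Suc l N by (simp add: field_tables_def)
    have xcl: "?x \<in> carrier R" using g by simp
    have xN: "?x [^] N = \<one>"
      using g gN by (metis mult.commute nat_pow_one nat_pow_pow)
    have Lcl: "coeff L m \<in> carrier R" for m using Lset by simp
    \<comment> \<open>the contributions of \<open>y ! 0\<close> to the constant and to the leading term cancel since \<open>?x [^] N = \<one>\<close>\<close>
    have "eval L ?x = (\<Oplus>m\<in>{..<Suc N}. coeff L m \<otimes> ?x [^] m)"
      using Lset xcl Llen by (intro eval_eq_finsum) auto
    also have "\<dots> = coeff L N \<oplus> (\<Oplus>m\<in>{..<N}. coeff L m \<otimes> ?x [^] m)"
      using Lcl xcl xN by (subst finsum_lessThan_Suc) auto
    also have "(\<Oplus>m\<in>{..<N}. coeff L m \<otimes> ?x [^] m) = y ! 0 \<oplus> (\<Oplus>m\<in>{1..<N}. coeff L m \<otimes> ?x [^] m)"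
    proof -
      have "{..<N} = insert 0 {1..<N}" using N by auto
      moreover have "(\<Oplus>m\<in>insert 0 {1..<N}. coeff L m \<otimes> ?x [^] m)
        = coeff L 0 \<otimes> ?x [^] (0::nat) \<oplus> (\<Oplus>m\<in>{1..<N}. coeff L m \<otimes> ?x [^] m)"
        using Lcl xcl by (intro finsum_insert) auto
      ultimately show ?thesis using c0 ycl[of 0] by simp
    qed
    also have "(\<Oplus>m\<in>{1..<N}. coeff L m \<otimes> ?x [^] m) = (\<Oplus>m\<in>{1..<N}. \<ominus> D (N - m) \<otimes> ?x [^] m)"
      using Dcl xcl by (intro finsum_cong') (auto simp: cm)
    also have "coeff L N \<oplus> (y ! 0 \<oplus> (\<Oplus>m\<in>{1..<N}. \<ominus> D (N - m) \<otimes> ?x [^] m))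
        = \<ominus> D 0 \<oplus> (\<Oplus>m\<in>{1..<N}. \<ominus> D (N - m) \<otimes> ?x [^] m)"
    proof -
      have "(\<Oplus>m\<in>{1..<N}. \<ominus> D (N - m) \<otimes> ?x [^] m) \<in> carrier R"
        using Dcl xcl by (intro finsum_closed) auto
      thus ?thesis unfolding cN using Dcl[of 0] ycl[of 0] telescope_identities(3) by simp
    qed
    also have "\<dots> = (\<Oplus>m\<in>{1..N}. \<ominus> D (N - m) \<otimes> ?x [^] m)"
    proof -
      have "{1..N} = insert N {1..<N}" using N by auto
      moreover have "(\<Oplus>m\<in>insert N {1..<N}. \<ominus> D (N - m) \<otimes> ?x [^] m)
        = \<ominus> D (N - N) \<otimes> ?x [^] N \<oplus> (\<Oplus>m\<in>{1..<N}. \<ominus> D (N - m) \<otimes> ?x [^] m)"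
        using Dcl xcl by (intro finsum_insert) auto
      ultimately show ?thesis using xN Dcl by simp
    qed
    also have "{1..N} = (\<lambda>j. N - j) ` {..<N}"
    proof (intro equalityI subsetI)
      fix m assume "m \<in> {1..N}"
      hence "m = N - (N - m)" "N - m \<in> {..<N}" by auto
      thus "m \<in> (\<lambda>j. N - j) ` {..<N}" by blast
    qed auto
    also have "(\<Oplus>m\<in>(\<lambda>j. N - j) ` {..<N}. \<ominus> D (N - m) \<otimes> ?x [^] m)
        = (\<Oplus>j\<in>{..<N}. \<ominus> D (N - (N - j)) \<otimes> ?x [^] (N - j))"
      using Dcl xcl by (intro finsum_reindex) (auto simp: inj_on_def)
    also have "\<dots> = (\<Oplus>j\<in>{..<N}. \<ominus> \<one> \<otimes> (\<Oplus>i\<in>{..<N}. y ! Suc i \<otimes> (g [^] (i * j) \<otimes> ?x [^] (N - j))))"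
    proof (intro finsum_cong' refl)
      fix j assume j: "j \<in> {..<N}"
      have "\<ominus> D (N - (N - j)) \<otimes> ?x [^] (N - j) = \<ominus> \<one> \<otimes> (D j \<otimes> ?x [^] (N - j))"
        using Dcl xcl j by (simp add: l_minus)
      also have "D j \<otimes> ?x [^] (N - j) = (\<Oplus>i\<in>{..<N}. y ! Suc i \<otimes> g [^] (i * j) \<otimes> ?x [^] (N - j))"
        unfolding D_def using ycl g xcl by (intro finsum_ldistr) auto
      also have "\<dots> = (\<Oplus>i\<in>{..<N}. y ! Suc i \<otimes> (g [^] (i * j) \<otimes> ?x [^] (N - j)))"
        using ycl g xcl by (intro finsum_cong') (auto simp: m_assoc)
      finally show "\<ominus> D (N - (N - j)) \<otimes> ?x [^] (N - j)
        = \<ominus> \<one> \<otimes> (\<Oplus>i\<in>{..<N}. y ! Suc i \<otimes> (g [^] (i * j) \<otimes> ?x [^] (N - j)))" .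
    qed (use ycl g xcl in \<open>auto intro!: finsum_closed\<close>)
    also have "\<dots> = \<ominus> \<one> \<otimes> (\<Oplus>j\<in>{..<N}. \<Oplus>i\<in>{..<N}. y ! Suc i \<otimes> (g [^] (i * j) \<otimes> ?x [^] (N - j)))"
      using ycl g xcl by (intro finsum_rdistr[symmetric]) (auto intro!: finsum_closed)
    also have "(\<Oplus>j\<in>{..<N}. \<Oplus>i\<in>{..<N}. y ! Suc i \<otimes> (g [^] (i * j) \<otimes> ?x [^] (N - j)))
       = (\<Oplus>i\<in>{..<N}. \<Oplus>j\<in>{..<N}. y ! Suc i \<otimes> (g [^] (i * j) \<otimes> ?x [^] (N - j)))"
      using ycl g xcl by (intro finsum_swap) auto
    also have "\<dots> = (\<Oplus>i\<in>{..<N}. if l = i then \<ominus> y ! Suc i else \<zero>)"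
    proof (intro finsum_cong' refl)
      fix i assume i: "i \<in> {..<N}"
      let ?a = "g [^] i"
      have acl: "?a \<in> carrier R" using g by simp
      have aN: "?a [^] N = \<one>"
        using g gN by (metis mult.commute nat_pow_one nat_pow_pow)
      let ?S = "\<Oplus>j\<in>{..<N}. ?a [^] j \<otimes> ?x [^] (N - j)"
      have "(\<Oplus>j\<in>{..<N}. y ! Suc i \<otimes> (g [^] (i * j) \<otimes> ?x [^] (N - j))) = y ! Suc i \<otimes> ?S"
        using ycl i g xcl by (subst finsum_rdistr) (auto simp: nat_pow_pow)
      also have "\<dots> = (if l = i then \<ominus> y ! Suc i else \<zero>)"
      proof (cases "l = i")
        case True
        have "?S = (\<Oplus>j\<in>{..<N}. \<one>)"
        proof (intro finsum_cong' refl)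
          fix j assume "j \<in> {..<N}"
          hence "?a [^] j \<otimes> ?x [^] (N - j) = ?x [^] N"
            using True xcl by (simp add: nat_pow_mult)
          thus "?a [^] j \<otimes> ?x [^] (N - j) = \<one>" using xN by simp
        qed simp
        also have "\<dots> = \<ominus> \<one>" using sum_one_lessThan[OF fin] by (simp add: N_def)
        finally show ?thesis using True ycl[of "Suc i"] i by (simp add: r_minus)
      next
        case False
        have "?a \<noteq> ?x" using inj_onD[OF inj, of i l] False i l by (auto simp: N_def)
        moreover have "?S \<in> carrier R" using acl xcl by (intro finsum_closed) auto
        moreover have "(?a \<ominus> ?x) \<otimes> ?S = \<zero>"
          using geometric_telescope[OF acl xcl, of N] aN xN xcl by (simp add: r_neg a_minus_def)
        ultimately have "?S = \<zero>"
          using integral[of "?a \<ominus> ?x" ?S] acl xcl by auto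
        thus ?thesis using False ycl[of "Suc i"] i by simp
      qed
      finally show "(\<Oplus>j\<in>{..<N}. y ! Suc i \<otimes> (g [^] (i * j) \<otimes> ?x [^] (N - j)))
        = (if l = i then \<ominus> y ! Suc i else \<zero>)" .
    qed (use ycl in auto)
    also have "\<dots> = \<ominus> y ! Suc l"
      using ycl l local.add.finprod_singleton[of l "{..<N}" "\<lambda>i. \<ominus> y ! Suc i"] by simp
    also have "\<ominus> \<one> \<otimes> \<ominus> y ! Suc l = y ! Suc l"
      using ycl[of "Suc l"] l by (simp add: l_minus r_minus)
    finally show ?thesis using evI xcl sup Suc by simp
  qed
qed

end

section \<open>The extended Euclidean algorithm\<close>

text \<open>
  The determinant of two consecutive rows of the algorithm only changes its sign.
\<close>

lemma (in cring) euclid_step_identities: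
  assumes "r \<in> carrier R" "r' \<in> carrier R" "v \<in> carrier R" "v' \<in> carrier R" "k \<in> carrier R" "s \<in> carrier R"
    "r = (r' \<otimes> k) \<oplus> s"
  shows "r' \<otimes> (v \<ominus> k \<otimes> v') \<ominus> s \<otimes> v' = \<ominus> (r \<otimes> v' \<ominus> r' \<otimes> v)"
  unfolding assms(7) using assms(1-6) by algebra

lemma (in cring) bezout_step:
  assumes "v \<in> carrier R" "v' \<in> carrier R" "u \<in> carrier R" "u' \<in> carrier R" "k \<in> carrier R" "s \<in> carrier R"
    "a \<in> carrier R" "b \<in> carrier R" 
    "v \<otimes> a \<oplus> u \<otimes> b = (v' \<otimes> a \<oplus> u' \<otimes> b) \<otimes> k \<oplus> s"
  shows "s = (v \<ominus> k \<otimes> v') \<otimes> a \<oplus> (u \<ominus> k \<otimes> u') \<otimes> b"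
proof -
  have "s = ((v' \<otimes> a \<oplus> u' \<otimes> b) \<otimes> k \<oplus> s) \<ominus> (v' \<otimes> a \<oplus> u' \<otimes> b) \<otimes> k"
    using assms(1-8) by algebra
  also have "\<dots> = (v \<otimes> a \<oplus> u \<otimes> b) \<ominus> (v' \<otimes> a \<oplus> u' \<otimes> b) \<otimes> k"
    using assms(9) by simp
  also have "\<dots> = (v \<ominus> k \<otimes> v') \<otimes> a \<oplus> (u \<ominus> k \<otimes> u') \<otimes> b"
    using assms(1-8) by algebra
  finally show ?thesis .
qed

text \<open>
  Two linear combinations of \<open>a\<close> and \<open>b\<close>, multiplied crosswise by each other's coefficient of \<open>a\<close>,
  differ by a multiple of \<open>b\<close>.
\<close>

lemma (in cring) bezout_cross:
  assumes "v \<in> carrier R" "v' \<in> carrier R" "u \<in> carrier R" "u' \<in> carrier R"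
    "a \<in> carrier R" "b \<in> carrier R" 
  shows "v' \<otimes> (v \<otimes> a \<oplus> u \<otimes> b) \<ominus> (v' \<otimes> a \<oplus> u' \<otimes> b) \<otimes> v = b \<otimes> (v' \<otimes> u \<ominus> u' \<otimes> v)"
  using assms by algebra

lemma (in cring) determinant_rearrange:
  assumes "v \<in> carrier R" "w \<in> carrier R" "r \<in> carrier R" "s \<in> carrier R" "r0 \<in> carrier R" "v0 \<in> carrier R"
    and "w \<otimes> r = s \<otimes> v"
  shows "w \<otimes> (r0 \<otimes> v \<ominus> r \<otimes> v0) = v \<otimes> (w \<otimes> r0 \<ominus> s \<otimes> v0)"
proof -
  have "w \<otimes> (r0 \<otimes> v \<ominus> r \<otimes> v0) = v \<otimes> (w \<otimes> r0) \<ominus> (w \<otimes> r) \<otimes> v0"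
    using assms(1-6) by algebra
  also have "\<dots> = v \<otimes> (w \<otimes> r0) \<ominus> (s \<otimes> v) \<otimes> v0" using assms(7) by simp
  also have "\<dots> = v \<otimes> (w \<otimes> r0 \<ominus> s \<otimes> v0)"
    using assms(1-6) by algebra
  finally show ?thesis .
qed

context field
begin

interpretation P: domain P
  by (rule univ_poly_is_domain[OF carrier_is_subring])

definition is_cofactor :: "'a list \<Rightarrow> 'a list \<Rightarrow> 'a list \<Rightarrow> 'a list \<Rightarrow> bool" where
  "is_cofactor g0 g1 v r \<longleftrightarrow> (\<exists>u\<in>carrier P. r = v \<otimes>\<^bsub>P\<^esub> g1 \<oplus>\<^bsub>P\<^esub> u \<otimes>\<^bsub>P\<^esub> g0)"

text \<open>
  The two last conditions are kept as upper bounds, also in place of the exact degrees of the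
  cofactors: they survive a step without knowing that no leading terms cancel.
\<close>

definition eea_invariant :: "'a list \<Rightarrow> 'a list \<Rightarrow> ('a list \<times> 'a list) \<times> ('a list \<times> 'a list) \<Rightarrow> bool" where
  "eea_invariant g0 g1 = (\<lambda>((r, r'), (v, v')).
     r \<in> carrier P \<and> r' \<in> carrier P \<and>
     v \<in> carrier P \<and> v' \<in> carrier P \<and>
     is_cofactor g0 g1 v r \<and> is_cofactor g0 g1 v' r' \<and>
     r \<otimes>\<^bsub>P\<^esub> v' \<ominus>\<^bsub>P\<^esub> r' \<otimes>\<^bsub>P\<^esub> v \<in> {g0, \<ominus>\<^bsub>P\<^esub> g0} \<and>
     length r' < length r \<and>
     length v + length r \<le> length g0 + 1 \<and> length v' + length r \<le> length g0 + 1)"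

lemma eea_invariant_start:
  assumes "g0 \<in> carrier P" "g1 \<in> carrier P" "length g1 < length g0"
  shows "eea_invariant g0 g1 (eea g0 g1 0)"
proof -
  have "g0 = \<zero>\<^bsub>P\<^esub> \<otimes>\<^bsub>P\<^esub> g1 \<oplus>\<^bsub>P\<^esub> \<one>\<^bsub>P\<^esub> \<otimes>\<^bsub>P\<^esub> g0" "g1 = \<one>\<^bsub>P\<^esub> \<otimes>\<^bsub>P\<^esub> g1 \<oplus>\<^bsub>P\<^esub> \<zero>\<^bsub>P\<^esub> \<otimes>\<^bsub>P\<^esub> g0"
    using assms by simp_all
  hence "is_cofactor g0 g1 \<zero>\<^bsub>P\<^esub> g0" "is_cofactor g0 g1 \<one>\<^bsub>P\<^esub> g1"
    unfolding is_cofactor_def by blast+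
  moreover have "g0 \<otimes>\<^bsub>P\<^esub> \<one>\<^bsub>P\<^esub> \<ominus>\<^bsub>P\<^esub> g1 \<otimes>\<^bsub>P\<^esub> \<zero>\<^bsub>P\<^esub> = g0"
    using assms by (simp add: P.minus_eq)
  moreover have "length \<zero>\<^bsub>P\<^esub> + length g0 \<le> length g0 + 1" "length \<one>\<^bsub>P\<^esub> + length g0 \<le> length g0 + 1"
    by (simp_all add: univ_poly_zero univ_poly_one)
  ultimately show ?thesis
    unfolding eea_invariant_def eea.simps prod.case
    using assms P.zero_closed P.one_closed by blast
qed

text \<open>
  The next remainder is required to be nonconstant because the degree does not tell a nonzero constant
  from the zero polynomial, by which one cannot divide.
\<close>

lemma eea_invariant_step:
  assumes g: "g0 \<in> carrier P" "g1 \<in> carrier P"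
    and inv: "eea_invariant g0 g1 (eea g0 g1 i)" and d: "degree (snd (fst (eea g0 g1 i))) \<ge> 1"
  shows "eea_invariant g0 g1 (eea g0 g1 (Suc i))"
proof -
  obtain r r' v v' where e: "eea g0 g1 i = ((r, r'), (v, v'))" by (metis prod.exhaust)
  from inv obtain u u' where I:
    "r \<in> carrier P" "r' \<in> carrier P" "v \<in> carrier P"
    "v' \<in> carrier P" "u \<in> carrier P" "u' \<in> carrier P"
    "r = v \<otimes>\<^bsub>P\<^esub> g1 \<oplus>\<^bsub>P\<^esub> u \<otimes>\<^bsub>P\<^esub> g0"
    "r' = v' \<otimes>\<^bsub>P\<^esub> g1 \<oplus>\<^bsub>P\<^esub> u' \<otimes>\<^bsub>P\<^esub> g0"
    "r \<otimes>\<^bsub>P\<^esub> v' \<ominus>\<^bsub>P\<^esub> r' \<otimes>\<^bsub>P\<^esub> v \<in> {g0, \<ominus>\<^bsub>P\<^esub> g0}"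
    "length r' < length r"
    "length v + length r \<le> length g0 + 1" "length v' + length r \<le> length g0 + 1"
    unfolding eea_invariant_def e prod.case is_cofactor_def by blast
  have lr': "length r' \<ge> 2" using d e by simp
  define k where "k = r pdiv r'"
  define s where "s = r pmod r'"
  have ks: "r = (r' \<otimes>\<^bsub>P\<^esub> k) \<oplus>\<^bsub>P\<^esub> s" "k \<in> carrier P" "s \<in> carrier P"
    unfolding k_def s_def using pdiv_pmod_id[OF I(1,2)] by auto
  have ls: "length s < length r'" unfolding s_def using I lr' by (intro length_pmod) auto
  have lk: "length k = length r - length r' + 1" unfolding k_def using I lr' by (intro length_pdiv) auto
  let ?w = "v \<ominus>\<^bsub>P\<^esub> k \<otimes>\<^bsub>P\<^esub> v'"
  have w: "?w \<in> carrier P" using I ks by simp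
  have "length ?w \<le> length g0 + 1 - length r'"
    using I ks lk by (intro length_minus_le length_mult_le) auto
  hence lw: "length ?w + length r' \<le> length g0 + 1" using I by linarith
  have "s = ?w \<otimes>\<^bsub>P\<^esub> g1 \<oplus>\<^bsub>P\<^esub> (u \<ominus>\<^bsub>P\<^esub> k \<otimes>\<^bsub>P\<^esub> u') \<otimes>\<^bsub>P\<^esub> g0"
    using ks(1) I(7,8) by (intro P.bezout_step) (use I ks g in auto)
  hence "is_cofactor g0 g1 ?w s"
    unfolding is_cofactor_def using I ks by (intro bexI[of _ "u \<ominus>\<^bsub>P\<^esub> k \<otimes>\<^bsub>P\<^esub> u'"]) auto
  moreover have "is_cofactor g0 g1 v' r'"
    unfolding is_cofactor_def using I(6,8) by (intro bexI[of _ u'])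
  moreover have "r' \<otimes>\<^bsub>P\<^esub> ?w \<ominus>\<^bsub>P\<^esub> s \<otimes>\<^bsub>P\<^esub> v' \<in> {g0, \<ominus>\<^bsub>P\<^esub> g0}"
    using P.euclid_step_identities[OF I(1-4) ks(2,3,1)] I(9) g by auto
  moreover have "length v' + length r' \<le> length g0 + 1" using I by simp
  ultimately show ?thesis
    unfolding eea_invariant_def eea.simps e k_def[symmetric] s_def[symmetric] prod.case
    using I(2,4) ks(3) w ls lw by blast
qed

lemma fst_eea_Suc: "fst (fst (eea g0 g1 (Suc i))) = snd (fst (eea g0 g1 i))"
  "fst (snd (eea g0 g1 (Suc i))) = snd (snd (eea g0 g1 i))"
  by (auto split: prod.splits)

lemma eea_invariant:
  assumes g: "g0 \<in> carrier P" "g1 \<in> carrier P" "length g1 < length g0"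
    and d: "\<And>j. j \<le> i \<Longrightarrow> degree (fst (fst (eea g0 g1 j))) \<ge> 1"
  shows "eea_invariant g0 g1 (eea g0 g1 i)"
  using d
proof (induction i)
  case 0
  show ?case using eea_invariant_start[OF g] .
next
  case (Suc i)
  have "degree (snd (fst (eea g0 g1 i))) \<ge> 1"
    using Suc.prems[of "Suc i"] fst_eea_Suc(1)[of g0 g1 i] by simp
  moreover have "eea_invariant g0 g1 (eea g0 g1 i)" using Suc by simp
  ultimately show ?case using eea_invariant_step g by blast
qed

text \<open>
  The row before the last one, marked with 0, still has a remainder of degree at least \<open>h\<close>;
  this is what bounds the degree of the last cofactor. Both rows are needed below because their
  determinant is $\pm g_0$.
\<close>

lemma partial_xgcd_spec:
  fixes c :: op_counts and g0 :: "'a list"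
  assumes g: "g0 \<in> carrier P" "g1 \<in> carrier P" "length g1 < length g0"
    and h: "1 \<le> h" "h \<le> degree g0"
  defines "v \<equiv> result (partial_xgcd c g0 g1 h)"
  obtains r u r0 v0 u0 where
    "v \<in> carrier P" "u \<in> carrier P"
    "v0 \<in> carrier P" "u0 \<in> carrier P"
    "r = v \<otimes>\<^bsub>P\<^esub> g1 \<oplus>\<^bsub>P\<^esub> u \<otimes>\<^bsub>P\<^esub> g0"
    "r0 = v0 \<otimes>\<^bsub>P\<^esub> g1 \<oplus>\<^bsub>P\<^esub> u0 \<otimes>\<^bsub>P\<^esub> g0"
    "r0 \<otimes>\<^bsub>P\<^esub> v \<ominus>\<^bsub>P\<^esub> r \<otimes>\<^bsub>P\<^esub> v0 \<in> {g0, \<ominus>\<^bsub>P\<^esub> g0}"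
    "length r \<le> h" "length v + h \<le> length g0"
proof -
  let ?r = "\<lambda>i. fst (fst (eea g0 g1 i))"
  define L where "L = (LEAST i. degree (?r i) < h)"
  have "\<exists>i. degree (?r i) < h"
  proof (rule ccontr)
    assume "\<nexists>i. degree (?r i) < h"
    hence ge: "degree (?r i) \<ge> h" for i by (simp add: not_less)
    have "length (?r i) + i \<le> length g0" for i
    proof (induction i)
      case (Suc i)
      have "1 \<le> degree (?r j)" for j using ge[of j] h(1) by linarith
      hence "eea_invariant g0 g1 (eea g0 g1 i)"
        by (intro eea_invariant g)
      hence "length (snd (fst (eea g0 g1 i))) < length (?r i)"
        by (auto simp: eea_invariant_def split: prod.splits)
      thus ?case using Suc fst_eea_Suc(1)[of g0 g1 i] by simp
    qed simp
    from this[of "length g0"] have "length (?r (length g0)) = 0" by simp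
    thus False using ge[of "length g0"] h by simp
  qed
  hence L: "degree (?r L) < h" unfolding L_def by (rule LeastI_ex)
  have less: "degree (?r i) \<ge> h" if "i < L" for i
    using not_less_Least[of i "\<lambda>i. degree (?r i) < h"] that by (simp add: L_def)
  have "L \<noteq> 0" using L h by (intro notI) simp
  then obtain m where m: "L = Suc m" using not0_implies_Suc by blast
  have inv: "eea_invariant g0 g1 (eea g0 g1 m)"
  proof (rule eea_invariant[OF g])
    show "1 \<le> degree (?r j)" if "j \<le> m" for j using less[of j] that m h(1) by linarith
  qed
  obtain r0 r v0 v' where e: "eea g0 g1 m = ((r0, r), (v0, v'))" by (metis prod.exhaust)
  have v: "v = v'"
    unfolding v_def partial_xgcd_def Let_def timed.sel L_def[symmetric] m fst_eea_Suc(2) e by simp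
  have "length r \<le> h" using L e m fst_eea_Suc(1)[of g0 g1 m] by simp
  moreover have "length r0 \<ge> h + 1" using less[of m] e m h by simp
  ultimately show ?thesis
    using inv that[of _ v0 _ r r0] unfolding e v eea_invariant_def is_cofactor_def prod.case by force
qed

text \<open>
  A small combination $s = w g_1 + e g_0$ is a multiple of the row at which the algorithm stops.
  Crosswise multiplication of this row with \<open>s\<close> gives a multiple of \<open>g0\<close> of smaller length than
  \<open>g0\<close>, hence zero. Crosswise multiplication with the previous row gives a multiple $g_0 \beta$.
  Expanding $w$ times the determinant of the two rows yields $\pm w g_0 = v g_0 \beta$, and $g_0$
  can be cancelled.
\<close>

lemma rational_reconstruction:
  fixes c :: op_counts and g0 :: "'a list"
  assumes g: "g0 \<in> carrier P" "g1 \<in> carrier P" "length g1 < length g0"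
    and h: "1 \<le> h" "length g0 = 2 * h + 1"
    and w: "w \<in> carrier P" "e \<in> carrier P" "w \<noteq> []" "length w \<le> h + 1"
    and small: "length (w \<otimes>\<^bsub>P\<^esub> g1 \<oplus>\<^bsub>P\<^esub> e \<otimes>\<^bsub>P\<^esub> g0) \<le> h"
  defines "v \<equiv> result (partial_xgcd c g0 g1 h)"
  shows "v \<in> carrier P" "length v \<le> h + 1"
    "\<exists>\<alpha>\<in>carrier P. \<exists>u\<in>carrier P.
       w = v \<otimes>\<^bsub>P\<^esub> \<alpha> \<and> e = u \<otimes>\<^bsub>P\<^esub> \<alpha>"
proof -
  have h2: "h \<le> degree g0" using h by simp
  obtain r u r0 v0 u0 where S:
    "v \<in> carrier P" "u \<in> carrier P"
    "v0 \<in> carrier P" "u0 \<in> carrier P"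
    "r = v \<otimes>\<^bsub>P\<^esub> g1 \<oplus>\<^bsub>P\<^esub> u \<otimes>\<^bsub>P\<^esub> g0"
    "r0 = v0 \<otimes>\<^bsub>P\<^esub> g1 \<oplus>\<^bsub>P\<^esub> u0 \<otimes>\<^bsub>P\<^esub> g0"
    "r0 \<otimes>\<^bsub>P\<^esub> v \<ominus>\<^bsub>P\<^esub> r \<otimes>\<^bsub>P\<^esub> v0 \<in> {g0, \<ominus>\<^bsub>P\<^esub> g0}"
    "length r \<le> h" "length v + h \<le> length g0"
    unfolding v_def by (rule partial_xgcd_spec[OF g h(1) h2])
  show v: "v \<in> carrier P" using S by simp
  show lv: "length v \<le> h + 1" using S h by simp
  define s where "s = w \<otimes>\<^bsub>P\<^esub> g1 \<oplus>\<^bsub>P\<^esub> e \<otimes>\<^bsub>P\<^esub> g0"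
  have s: "s \<in> carrier P" "length s \<le> h" using w g small by (auto simp: s_def)
  have r: "r \<in> carrier P" "r0 \<in> carrier P" using S(5,6) S(1-4) g by auto
  have g0ne: "g0 \<noteq> []" using h by auto
  have X: "w \<otimes>\<^bsub>P\<^esub> r \<ominus>\<^bsub>P\<^esub> s \<otimes>\<^bsub>P\<^esub> v
     = g0 \<otimes>\<^bsub>P\<^esub> (w \<otimes>\<^bsub>P\<^esub> u \<ominus>\<^bsub>P\<^esub> e \<otimes>\<^bsub>P\<^esub> v)"
    unfolding S(5) s_def using S w g by (intro P.bezout_cross) auto
  have "length (w \<otimes>\<^bsub>P\<^esub> r \<ominus>\<^bsub>P\<^esub> s \<otimes>\<^bsub>P\<^esub> v) \<le> 2 * h"
    using r s w S lv by (intro length_minus_le length_mult_le) auto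
  hence X0: "w \<otimes>\<^bsub>P\<^esub> u \<ominus>\<^bsub>P\<^esub> e \<otimes>\<^bsub>P\<^esub> v = []"
  proof (rule contrapos_pp)
    assume ne: "w \<otimes>\<^bsub>P\<^esub> u \<ominus>\<^bsub>P\<^esub> e \<otimes>\<^bsub>P\<^esub> v \<noteq> []"
    hence "length (w \<otimes>\<^bsub>P\<^esub> u \<ominus>\<^bsub>P\<^esub> e \<otimes>\<^bsub>P\<^esub> v) \<ge> 1" by (simp add: Suc_le_eq)
    thus "\<not> length (w \<otimes>\<^bsub>P\<^esub> r \<ominus>\<^bsub>P\<^esub> s \<otimes>\<^bsub>P\<^esub> v) \<le> 2 * h"
      unfolding X using ne g0ne g w S h by (subst length_mult) auto
  qed
  have wu: "w \<otimes>\<^bsub>P\<^esub> u = e \<otimes>\<^bsub>P\<^esub> v"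
    using X0 w S P.r_right_minus_eq[of "w \<otimes>\<^bsub>P\<^esub> u" "e \<otimes>\<^bsub>P\<^esub> v"]
    by (simp add: univ_poly_zero)
  have wr: "w \<otimes>\<^bsub>P\<^esub> r = s \<otimes>\<^bsub>P\<^esub> v"
    using X X0 w S r s g P.r_right_minus_eq[of "w \<otimes>\<^bsub>P\<^esub> r" "s \<otimes>\<^bsub>P\<^esub> v"] P.r_null[of g0]
    by (simp add: univ_poly_zero)
  define \<beta> where "\<beta> = w \<otimes>\<^bsub>P\<^esub> u0 \<ominus>\<^bsub>P\<^esub> e \<otimes>\<^bsub>P\<^esub> v0"
  have \<beta>: "\<beta> \<in> carrier P" using w S by (simp add: \<beta>_def)
  have "w \<otimes>\<^bsub>P\<^esub> (r0 \<otimes>\<^bsub>P\<^esub> v \<ominus>\<^bsub>P\<^esub> r \<otimes>\<^bsub>P\<^esub> v0)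
      = v \<otimes>\<^bsub>P\<^esub> (w \<otimes>\<^bsub>P\<^esub> r0 \<ominus>\<^bsub>P\<^esub> s \<otimes>\<^bsub>P\<^esub> v0)"
    by (rule P.determinant_rearrange) (use w r s S wr in auto)
  also have "w \<otimes>\<^bsub>P\<^esub> r0 \<ominus>\<^bsub>P\<^esub> s \<otimes>\<^bsub>P\<^esub> v0 = g0 \<otimes>\<^bsub>P\<^esub> \<beta>"
    unfolding S(6) s_def \<beta>_def using S w g by (intro P.bezout_cross) auto
  finally have "g0 \<otimes>\<^bsub>P\<^esub> w = g0 \<otimes>\<^bsub>P\<^esub> (v \<otimes>\<^bsub>P\<^esub> \<beta>) \<or>
    g0 \<otimes>\<^bsub>P\<^esub> w = g0 \<otimes>\<^bsub>P\<^esub> (v \<otimes>\<^bsub>P\<^esub> (\<ominus>\<^bsub>P\<^esub> \<beta>))"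
  proof -
    assume *: "w \<otimes>\<^bsub>P\<^esub> (r0 \<otimes>\<^bsub>P\<^esub> v \<ominus>\<^bsub>P\<^esub> r \<otimes>\<^bsub>P\<^esub> v0)
      = v \<otimes>\<^bsub>P\<^esub> (g0 \<otimes>\<^bsub>P\<^esub> \<beta>)"
    have sw: "v \<otimes>\<^bsub>P\<^esub> (g0 \<otimes>\<^bsub>P\<^esub> \<beta>) = g0 \<otimes>\<^bsub>P\<^esub> (v \<otimes>\<^bsub>P\<^esub> \<beta>)"
      using S g \<beta> by (intro P.m_lcomm) auto
    from S(7) consider "r0 \<otimes>\<^bsub>P\<^esub> v \<ominus>\<^bsub>P\<^esub> r \<otimes>\<^bsub>P\<^esub> v0 = g0"
      | "r0 \<otimes>\<^bsub>P\<^esub> v \<ominus>\<^bsub>P\<^esub> r \<otimes>\<^bsub>P\<^esub> v0 = \<ominus>\<^bsub>P\<^esub> g0" by auto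
    thus ?thesis
    proof cases
      case 1
      thus ?thesis using * sw w g P.m_comm[of w g0] by simp
    next
      case 2
      have "g0 \<otimes>\<^bsub>P\<^esub> w = \<ominus>\<^bsub>P\<^esub> (w \<otimes>\<^bsub>P\<^esub> \<ominus>\<^bsub>P\<^esub> g0)"
        using w g P.m_comm[of w g0] by (simp add: P.r_minus)
      also have "\<dots> = g0 \<otimes>\<^bsub>P\<^esub> (v \<otimes>\<^bsub>P\<^esub> (\<ominus>\<^bsub>P\<^esub> \<beta>))"
        using * sw 2 S g \<beta> by (simp add: P.r_minus)
      finally show ?thesis by simp
    qed
  qed
  hence "w = v \<otimes>\<^bsub>P\<^esub> \<beta> \<or> w = v \<otimes>\<^bsub>P\<^esub> (\<ominus>\<^bsub>P\<^esub> \<beta>)"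
    using P.m_lcancel[of g0] g0ne g w S \<beta> by (auto simp: univ_poly_zero)
  then obtain \<alpha> where \<alpha>: "\<alpha> \<in> carrier P" "w = v \<otimes>\<^bsub>P\<^esub> \<alpha>"
    using \<beta> P.a_inv_closed by metis
  have vne: "v \<noteq> []"
  proof
    assume "v = []"
    hence "w = []" using \<alpha> P.l_null[OF \<alpha>(1)] by (simp add: univ_poly_zero)
    thus False using w by simp
  qed
  have "v \<otimes>\<^bsub>P\<^esub> e = v \<otimes>\<^bsub>P\<^esub> (u \<otimes>\<^bsub>P\<^esub> \<alpha>)"
  proof -
    have "v \<otimes>\<^bsub>P\<^esub> e = w \<otimes>\<^bsub>P\<^esub> u" using wu P.m_comm[of v e] w S by simp
    also have "\<dots> = v \<otimes>\<^bsub>P\<^esub> (u \<otimes>\<^bsub>P\<^esub> \<alpha>)"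
      using \<alpha> S P.m_comm[of u \<alpha>] by (simp add: P.m_assoc)
    finally show ?thesis .
  qed
  hence "e = u \<otimes>\<^bsub>P\<^esub> \<alpha>"
    using P.m_lcancel[of v] vne S w \<alpha> by (auto simp: univ_poly_zero)
  thus "\<exists>\<alpha>\<in>carrier P. \<exists>u\<in>carrier P.
       w = v \<otimes>\<^bsub>P\<^esub> \<alpha> \<and> e = u \<otimes>\<^bsub>P\<^esub> \<alpha>"
    using \<alpha> S by blast
qed

text \<open>
  The factor $\alpha$ by which the sought pair exceeds the computed row must be constant: at each of the
  \<open>h\<close> points of \<open>B\<close> the cofactor \<open>e\<close>, and with it $\alpha$, is nonzero, so the computed \<open>v\<close> vanishes on
  \<open>B\<close> and already has degree \<open>h\<close>. Normalizing \<open>v\<close> then gives exactly \<open>w\<close>.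
\<close>

lemma partial_xgcd_error_locator:
  fixes c :: op_counts and g0 :: "'a list"
  assumes g: "g0 \<in> carrier P" "g1 \<in> carrier P" "length g1 < length g0"
    and h: "1 \<le> h" "length g0 = 2 * h + 1"
    and w: "w \<in> carrier P" "e \<in> carrier P" "length w = h + 1" "lead_coeff w = \<one>"
    and small: "length (w \<otimes>\<^bsub>P\<^esub> g1 \<oplus>\<^bsub>P\<^esub> e \<otimes>\<^bsub>P\<^esub> g0) \<le> h"
    and B: "finite B" "B \<subseteq> carrier R" "card B = h"
    and roots: "\<And>b. b \<in> B \<Longrightarrow> eval w b = \<zero>" "\<And>b. b \<in> B \<Longrightarrow> eval e b \<noteq> \<zero>"
  defines "v \<equiv> result (partial_xgcd c g0 g1 h)"
  shows "length v = h + 1" "result (make_monic v) = w"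
proof -
  have wne: "w \<noteq> []" using w by auto
  have lw: "length w \<le> h + 1" using w by simp
  note rr = rational_reconstruction[OF g h w(1,2) wne lw small, of c, folded v_def]
  from rr(3) obtain \<alpha> u where \<alpha>: "\<alpha> \<in> carrier P" "u \<in> carrier P"
    "w = v \<otimes>\<^bsub>P\<^esub> \<alpha>" "e = u \<otimes>\<^bsub>P\<^esub> \<alpha>" by auto
  have vne: "v \<noteq> []"
  proof
    assume "v = []"
    hence "w = []" using \<alpha> P.l_null[OF \<alpha>(1)] by (simp add: univ_poly_zero)
    thus False using wne by simp
  qed
  have \<alpha>ne: "\<alpha> \<noteq> []"
  proof
    assume "\<alpha> = []"
    hence "w = []" using \<alpha> P.r_null[OF rr(1)] by (simp add: univ_poly_zero)
    thus False using wne by simp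
  qed
  have vz: "eval v b = \<zero>" if b: "b \<in> B" for b
  proof -
    have bc: "b \<in> carrier R" using B b by auto
    have "eval \<alpha> b \<noteq> \<zero>"
      using roots(2)[OF b] \<alpha> bc eval_mult[of u \<alpha> b] eval_closed[of u b] by auto
    moreover have "eval v b \<otimes> eval \<alpha> b = \<zero>"
      using roots(1)[OF b] \<alpha>(1,3) rr(1) bc eval_mult[of v \<alpha> b] by simp
    ultimately show ?thesis
      using integral[of "eval v b" "eval \<alpha> b"] bc \<alpha> rr(1) eval_closed by auto
  qed
  have "\<not> length v \<le> h"
    using zero_poly_if_many_roots[OF rr(1) B(1,2) vz] vne B(3) by auto
  thus lv: "length v = h + 1" using rr(2) by simp
  have "length w = length v + length \<alpha> - 1" unfolding \<alpha>(3) using \<alpha> rr(1) vne \<alpha>ne by (intro length_mult)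
  hence "length \<alpha> = 1" using lv w \<alpha>ne by simp
  then obtain k where k: "\<alpha> = [k]" by (cases \<alpha>) auto
  have kc: "k \<in> carrier R - {\<zero>}" using poly_set[OF \<alpha>(1)] poly_lead_nonzero[OF \<alpha>(1)] k by auto
  have wk: "w = map (\<lambda>b. k \<otimes> b) v"
    using \<alpha>(3) k kc poly_mult_const(2)[OF carrier_is_subring _ kc, of v] rr(1)
    by (simp add: univ_poly_mult univ_poly_carrier)
  have lc: "lead_coeff v \<in> carrier R" "lead_coeff v \<noteq> \<zero>"
    using poly_lead_nonzero[OF rr(1) vne] poly_set[OF rr(1)] vne by auto
  have "k \<otimes> lead_coeff v = \<one>" using w(4) wk vne by (simp add: hd_map)
  hence "inv (lead_coeff v) = k"
    using kc lc comm_inv_char[of "lead_coeff v" k] by (simp add: m_comm)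
  thus "result (make_monic v) = w"
    using wk by (simp add: make_monic_def result_mapT)
qed

end

section \<open>Powers modulo a polynomial\<close>

lemma (in cring) product_of_divisions:
  assumes "d \<in> carrier R" "a1 \<in> carrier R" "a0 \<in> carrier R" "b1 \<in> carrier R" "b0 \<in> carrier R"
    "t \<in> carrier R" "s \<in> carrier R" "a0 \<otimes> b0 = d \<otimes> t \<oplus> s"
  shows "(d \<otimes> a1 \<oplus> a0) \<otimes> (d \<otimes> b1 \<oplus> b0) = d \<otimes> (a1 \<otimes> (d \<otimes> b1 \<oplus> b0) \<oplus> a0 \<otimes> b1 \<oplus> t) \<oplus> s"
proof -
  have "(d \<otimes> a1 \<oplus> a0) \<otimes> (d \<otimes> b1 \<oplus> b0) = d \<otimes> (a1 \<otimes> (d \<otimes> b1 \<oplus> b0) \<oplus> a0 \<otimes> b1) \<oplus> a0 \<otimes> b0"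
    using assms(1-7) by algebra
  also have "\<dots> = d \<otimes> (a1 \<otimes> (d \<otimes> b1 \<oplus> b0) \<oplus> a0 \<otimes> b1) \<oplus> (d \<otimes> t \<oplus> s)"
    using assms(8) by simp
  also have "\<dots> = d \<otimes> (a1 \<otimes> (d \<otimes> b1 \<oplus> b0) \<oplus> a0 \<otimes> b1 \<oplus> t) \<oplus> s"
    using assms(1-7) by algebra
  finally show ?thesis .
qed

context field
begin

interpretation P: domain P
  by (rule univ_poly_is_domain[OF carrier_is_subring])

lemma pmod_mult_pmod:
  assumes a: "a \<in> carrier P" and b: "b \<in> carrier P"
    and d: "d \<in> carrier P" "length d \<ge> 2"
  shows "((a pmod d) \<otimes>\<^bsub>P\<^esub> (b pmod d)) pmod d = (a \<otimes>\<^bsub>P\<^esub> b) pmod d"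
proof -
  note A = pdiv_pmod_id[OF a d(1)]
  note B = pdiv_pmod_id[OF b d(1)]
  let ?p = "(a pmod d) \<otimes>\<^bsub>P\<^esub> (b pmod d)"
  have p: "?p \<in> carrier P" using A B by simp
  note C = pdiv_pmod_id[OF p d(1)]
  have "a \<otimes>\<^bsub>P\<^esub> b = (d \<otimes>\<^bsub>P\<^esub> (a pdiv d) \<oplus>\<^bsub>P\<^esub> (a pmod d))
      \<otimes>\<^bsub>P\<^esub> (d \<otimes>\<^bsub>P\<^esub> (b pdiv d) \<oplus>\<^bsub>P\<^esub> (b pmod d))"
    using A(1) B(1) by simp
  also have "\<dots> = d \<otimes>\<^bsub>P\<^esub> ((a pdiv d) \<otimes>\<^bsub>P\<^esub> (d \<otimes>\<^bsub>P\<^esub> (b pdiv d) \<oplus>\<^bsub>P\<^esub> (b pmod d))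
      \<oplus>\<^bsub>P\<^esub> (a pmod d) \<otimes>\<^bsub>P\<^esub> (b pdiv d) \<oplus>\<^bsub>P\<^esub> (?p pdiv d)) \<oplus>\<^bsub>P\<^esub> (?p pmod d)"
    using A(2,3) B(2,3) C d by (intro P.product_of_divisions) auto
  finally show ?thesis
    using A(2,3) B(2,3) C d a b length_pmod[OF p d]
    by (intro pmod_unique(2)[symmetric]) auto
qed

lemma result_powmod:
  assumes d: "d \<in> carrier P" "length d \<ge> 2" and p: "p \<in> carrier P"
  shows "result (powmod c d p e) = (p [^]\<^bsub>P\<^esub> e) pmod d"
proof (induction e rule: less_induct)
  case (less e)
  show ?case
  proof (cases "e = 0")
    case True
    thus ?thesis by (simp add: powmod.simps[of c d p 0])
  next
    case False
    let ?y = "p [^]\<^bsub>P\<^esub> (e div 2)"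
    have y: "?y \<in> carrier P" using p by simp
    have IH: "result (powmod c d p (e div 2)) = ?y pmod d" using less[of "e div 2"] False by simp
    have sq: "((?y pmod d) \<otimes>\<^bsub>P\<^esub> (?y pmod d)) pmod d
        = (p [^]\<^bsub>P\<^esub> (2 * (e div 2))) pmod d"
      using pmod_mult_pmod[OF y y d] p by (simp add: P.nat_pow_mult mult_2)
    show ?thesis
    proof (cases "even e")
      case True
      thus ?thesis using False IH sq by (simp add: powmod.simps[of c d p e] pmulmod_def)
    next
      case odd: False
      let ?z = "p [^]\<^bsub>P\<^esub> (2 * (e div 2))"
      have z: "?z \<in> carrier P" using p by simp
      have "((?z pmod d) \<otimes>\<^bsub>P\<^esub> p) pmod d = (?z \<otimes>\<^bsub>P\<^esub> p) pmod d"
      proof -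
        have zd: "?z pmod d \<in> carrier P" using pdiv_pmod_id[OF z d(1)] by simp
        have "(?z pmod d) pmod d = ?z pmod d"
          using pmod_const(2)[OF carrier_is_subfield zd d(1)] length_pmod[OF z d] d by simp
        thus ?thesis
          using pmod_mult_pmod[OF zd p d] pmod_mult_pmod[OF z p d] by simp
      qed
      moreover have "?z \<otimes>\<^bsub>P\<^esub> p = p [^]\<^bsub>P\<^esub> e"
        using odd P.nat_pow_Suc[of p "2 * (e div 2)"] by (simp add: odd_two_times_div_two_succ)
      ultimately show ?thesis using odd False IH sq
        by (simp add: powmod.simps[of c d p e] pmulmod_def)
    qed
  qed
qed

text \<open>
  Padding with leading zeros makes these polynomials correspond to all lists of \<open>n\<close> elements.
\<close>

lemma card_short_polys:
  assumes fin: "finite (carrier R)"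
  shows "card {p \<in> carrier P. length p \<le> n} = order R ^ n"
proof -
  let ?L = "{xs. set xs \<subseteq> carrier R \<and> length xs = n}"
  have "bij_betw normalize ?L {p \<in> carrier P. length p \<le> n}"
  proof (rule bij_betwI')
    fix x y assume "x \<in> ?L" "y \<in> ?L"
    thus "(normalize x = normalize y) = (x = y)"
      using coeff_iff_length_cond[of x y] normalize_coeff[of x] normalize_coeff[of y] by auto
  next
    fix x assume "x \<in> ?L"
    thus "normalize x \<in> {p \<in> carrier P. length p \<le> n}"
      using normalize_poly normalize_length_le[of x] by auto
  next
    fix p assume p: "p \<in> {p \<in> carrier P. length p \<le> n}"
    have "normalize p = p" using p normalize_polynomial univ_poly_carrier by blast
    hence "p = normalize (replicate (n - length p) \<zero> @ p)"
      by (simp add: normalize_replicate_zero)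
    moreover have "replicate (n - length p) \<zero> @ p \<in> ?L" using p poly_set[of p] by auto
    ultimately show "\<exists>x\<in>?L. p = normalize x" by blast
  qed
  hence "card {p \<in> carrier P. length p \<le> n} = card ?L"
    by (simp add: bij_betw_same_card)
  thus ?thesis using card_lists_length_eq[OF fin, of n] by (simp add: order_def)
qed

end

lemma mult_of_eq: "Ring_Divisibility.mult_of K = Multiplicative_Group.mult_of K"
  by (simp add: Ring_Divisibility.mult_of_def Multiplicative_Group.mult_of_def)

section \<open>The field generated by a primitive polynomial\<close>

locale primitive_modulus = field +
  fixes Q :: "'a list" and h :: nat
  assumes fin: "finite (carrier R)" and prim: "primitive_poly R Q"
    and degQ: "degree Q = h" and h2: "h \<ge> 2"
begin

interpretation P: domain P
  by (rule univ_poly_is_domain[OF carrier_is_subring])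

abbreviation "K \<equiv> Rupt (carrier R) Q"
abbreviation "\<pi> \<equiv> rupture_surj (carrier R) Q"

lemma Q_poly: "Q \<in> carrier P" and Q_monic: "lead_coeff Q = \<one>"
  and Q_irreducible: "pirreducible (carrier R) Q" and Q_length: "length Q = h + 1"
  using prim degQ h2 by (auto simp: primitive_poly_def)

lemma Q_length_ge: "length Q \<ge> 2" using Q_length h2 by simp

lemma K_field: "field K"
  using rupture_is_field_iff_pirreducible[OF carrier_is_subfield Q_poly] Q_irreducible by simp

interpretation K: field K by (rule K_field)

lemma \<pi>_hom: "ring_hom_ring P K \<pi>"
  using rupture_surj_hom(2)[OF carrier_is_subring Q_poly] .

lemma \<pi>_hom': "\<pi> \<in> ring_hom P K"
  using rupture_surj_hom(1)[OF carrier_is_subring Q_poly] .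

lemma \<pi>_closed: "p \<in> carrier P \<Longrightarrow> \<pi> p \<in> carrier K"
  using ring_hom_closed[OF \<pi>_hom'] by auto

lemma \<pi>_mult: "p \<in> carrier P \<Longrightarrow> r \<in> carrier P
    \<Longrightarrow> \<pi> (p \<otimes>\<^bsub>P\<^esub> r) = \<pi> p \<otimes>\<^bsub>K\<^esub> \<pi> r"
  using ring_hom_mult[OF \<pi>_hom'] by auto

lemma \<pi>_one: "\<pi> \<one>\<^bsub>P\<^esub> = \<one>\<^bsub>K\<^esub>"
  using ring_hom_one[OF \<pi>_hom'] by auto

lemma \<pi>_pow: "p \<in> carrier P \<Longrightarrow> \<pi> (p [^]\<^bsub>P\<^esub> (n::nat)) = \<pi> p [^]\<^bsub>K\<^esub> n"
  by (induction n) (auto simp: \<pi>_mult \<pi>_one)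

lemma \<pi>_eq_iff:
  assumes "p \<in> carrier P" "r \<in> carrier P"
  shows "\<pi> p = \<pi> r \<longleftrightarrow> p pmod Q = r pmod Q"
proof
  assume "\<pi> p = \<pi> r"
  hence "\<pi> (p pmod Q) = \<pi> (r pmod Q)"
    using rupture_surj_composed_with_pmod[OF carrier_is_subfield Q_poly] assms by simp
  thus "p pmod Q = r pmod Q"
    using inj_onD[OF rupture_surj_inj_on[OF carrier_is_subfield Q_poly]] assms by blast
next
  assume "p pmod Q = r pmod Q"
  thus "\<pi> p = \<pi> r"
    using rupture_surj_composed_with_pmod[OF carrier_is_subfield Q_poly] assms by metis
qed

lemma pmod_Q_short:
  assumes "p \<in> carrier P" "length p \<le> h"
  shows "p pmod Q = p"
  using pmod_const(2)[OF carrier_is_subfield assms(1) Q_poly] assms(2) Q_length h2 by simp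

lemma \<pi>_inj_short:
  assumes "p \<in> carrier P" "r \<in> carrier P" "length p \<le> h" "length r \<le> h"
    "\<pi> p = \<pi> r"
  shows "p = r"
  using assms \<pi>_eq_iff pmod_Q_short by auto

lemma \<pi>_zero: "\<pi> [] = \<zero>\<^bsub>K\<^esub>"
proof -
  interpret H: ring_hom_ring P K \<pi> by (rule \<pi>_hom)
  show ?thesis using H.hom_zero by (simp add: univ_poly_zero)
qed

text \<open>
  Residues modulo \<open>Q\<close> are represented uniquely by the polynomials of degree less than \<open>h\<close>.
\<close>

lemma card_K: "order K = order R ^ h" and finite_K: "finite (carrier K)"
proof -
  let ?S = "{p \<in> carrier P. length p \<le> h}"
  have "carrier K = \<pi> ` ((\<lambda>p. p pmod Q) ` carrier P)"
    using rupture_carrier_as_pmod_image[OF carrier_is_subfield Q_poly] by simp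
  also have "(\<lambda>p. p pmod Q) ` carrier P = ?S"
  proof -
    have "Q \<noteq> []" using Q_length by auto
    thus ?thesis
      using pmod_image_characterization[OF carrier_is_subfield Q_poly] Q_length by simp
  qed
  finally have K: "carrier K = \<pi> ` ?S" .
  have inj: "inj_on \<pi> ?S" using \<pi>_inj_short by (auto intro!: inj_onI)
  show "order K = order R ^ h"
    unfolding order_def[of K] K card_image[OF inj] using card_short_polys[OF fin] .
  have "order R > 0" using fin by (auto simp: order_def card_gt_0_iff)
  hence "card ?S > 0" using card_short_polys[OF fin, of h] by simp
  hence "finite ?S" by (rule card_ge_0_finite)
  thus "finite (carrier K)" unfolding K by simp
qed

abbreviation "\<omega> \<equiv> \<pi> X"

lemma X_poly: "X \<in> carrier P" and X_length: "length X = 2"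
  using var_closed(1)[OF carrier_is_subring] by (simp_all add: var_def)

interpretation M: group "Multiplicative_Group.mult_of K" by (rule K.field_mult_group)

lemma order_q: "order R \<ge> 2"
proof -
  have "card {\<zero>, \<one>} \<le> card (carrier R)" using fin by (intro card_mono) auto
  thus ?thesis by (simp add: order_def)
qed

lemma omega_nonzero: "\<omega> \<in> carrier K - {\<zero>\<^bsub>K\<^esub>}"
proof -
  have "\<omega> \<noteq> \<zero>\<^bsub>K\<^esub>"
  proof
    assume "\<omega> = \<zero>\<^bsub>K\<^esub>"
    hence "\<pi> X = \<pi> []" by (simp add: \<pi>_zero)
    hence "X = []" using X_poly X_length h2 by (intro \<pi>_inj_short) auto
    thus False by (simp add: var_def)
  qed
  thus ?thesis using \<pi>_closed[OF X_poly] by simp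
qed

lemma omega_ord: "M.ord \<omega> = order R ^ h - 1"
proof -
  have "generate (Multiplicative_Group.mult_of K) {\<omega>} = carrier (Multiplicative_Group.mult_of K)"
    using prim by (simp add: primitive_poly_def mult_of_eq)
  hence "M.ord \<omega> = card (carrier K - {\<zero>\<^bsub>K\<^esub>})"
    using M.generate_pow_card[of \<omega>] omega_nonzero by simp
  thus ?thesis using finite_K card_K by (simp add: order_def card_Diff_singleton)
qed

lemma omega_powers:
  assumes "y \<in> carrier K" "y \<noteq> \<zero>\<^bsub>K\<^esub>"
  obtains u where "u < order R ^ h - 1" "\<omega> [^]\<^bsub>K\<^esub> u = y"
proof -
  have pos: "order R ^ h - 1 > 0"
    using order_q h2 by (metis One_nat_def Suc_le_eq le_trans numeral_2_eq_2 one_less_power zero_less_diff zero_less_numeral)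
  have finM: "finite (carrier (Multiplicative_Group.mult_of K))" using finite_K by simp
  have xM: "\<omega> \<in> carrier (Multiplicative_Group.mult_of K)" using omega_nonzero by simp
  have "generate (Multiplicative_Group.mult_of K) {\<omega>} = carrier (Multiplicative_Group.mult_of K)"
    using prim by (simp add: primitive_poly_def mult_of_eq)
  hence "y \<in> {\<omega> [^]\<^bsub>Multiplicative_Group.mult_of K\<^esub> k |k. k \<in> (UNIV :: nat set)}"
    using M.generate_pow_on_finite_carrier[OF finM xM] assms by simp
  also have "\<dots> = {\<omega> [^]\<^bsub>Multiplicative_Group.mult_of K\<^esub> k |k. k \<in> {0..M.ord \<omega> - 1}}"
    by (rule M.ord_elems[OF finM xM])
  finally obtain k where "k \<le> order R ^ h - 1 - 1" "y = \<omega> [^]\<^bsub>K\<^esub> k"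
    by (auto simp: omega_ord Multiplicative_Group.nat_pow_mult_of)
  thus ?thesis using that[of k] pos by simp
qed

lemma omega_pow_inj:
  assumes "i < order R ^ h - 1" "j < order R ^ h - 1" "\<omega> [^]\<^bsub>K\<^esub> i = \<omega> [^]\<^bsub>K\<^esub> j"
  shows "i = j"
proof -
  have "inj_on (\<lambda>k. \<omega> [^]\<^bsub>Multiplicative_Group.mult_of K\<^esub> k) {0..M.ord \<omega> - 1}"
    using omega_nonzero by (intro M.ord_inj) simp
  thus ?thesis
    using assms inj_onD[of "\<lambda>k. \<omega> [^]\<^bsub>K\<^esub> k" "{0..M.ord \<omega> - 1}" i j]
    by (simp add: omega_ord Multiplicative_Group.nat_pow_mult_of)
qed

text \<open>
  $(q^h - 1)/(q - 1)$ is the exponent of the norm map to the base field.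
\<close>

definition norm_exponent :: nat where "norm_exponent = (order R ^ h - 1) div (order R - 1)"

lemma norm_exponent: "norm_exponent * (order R - 1) = order R ^ h - 1"
proof -
  have "order R ^ n - 1 = (order R - 1) * (\<Sum>i<n. order R ^ i)" for n
  proof (induction n)
    case (Suc n)
    obtain p where p: "order R = Suc p" using order_q by (cases "order R") auto
    have "Suc p ^ n - 1 = p * (\<Sum>i<n. Suc p ^ i)" using Suc p by simp
    moreover have "Suc p ^ n > 0" by simp
    ultimately have "Suc p ^ n = Suc (p * (\<Sum>i<n. Suc p ^ i))" by linarith
    thus ?case using p by (simp add: algebra_simps)
  qed simp
  hence "(order R - 1) dvd (order R ^ h - 1)" by simp
  thus ?thesis by (simp add: norm_exponent_def)
qed

lemma const_poly: "a \<in> carrier R - {\<zero>} \<Longrightarrow> [a] \<in> carrier P"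
  by (intro polyI) auto

lemma const_pow:
  assumes "a \<in> carrier R - {\<zero>}"
  shows "[a] [^]\<^bsub>P\<^esub> (n::nat) = [a [^] n]"
proof (induction n)
  case (Suc n)
  have u: "a [^] n \<in> carrier R" using assms by simp
  have ne: "a [^] n \<otimes> a \<noteq> \<zero>"
    using pow_Units[of a "Suc n"] assms by (auto simp: field_Units)
  have "poly_mult [a [^] n] [a] = normalize [a [^] n \<otimes> a]"
    using poly_mult_const'(1)[of "[a]" "a [^] n"] assms u by simp
  thus ?case using Suc ne by (simp add: univ_poly_mult)
qed (simp add: univ_poly_one)

text \<open>
  The norm of $\omega$ is a root of $Y^{q-1} - 1$. The $q - 1$ nonzero constants are roots as well, and in
  a field there are no others.
\<close>

lemma norm_is_const:
  obtains a where "a \<in> carrier R - {\<zero>}" "\<omega> [^]\<^bsub>K\<^esub> norm_exponent = \<pi> [a]"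
proof -
  let ?q = "order R - 1"
  let ?S = "{y \<in> carrier K. y [^]\<^bsub>K\<^esub> ?q = \<one>\<^bsub>K\<^esub>}"
  have q: "?q \<noteq> 0" using order_q by simp
  have finS: "finite ?S" using finite_K by simp
  have S: "card ?S \<le> ?q" using K.num_roots_le_deg[OF finite_K q] .
  let ?C = "(\<lambda>a. \<pi> [a]) ` (carrier R - {\<zero>})"
  have inj: "inj_on (\<lambda>a. \<pi> [a]) (carrier R - {\<zero>})"
  proof (rule inj_onI)
    fix a b assume "a \<in> carrier R - {\<zero>}" "b \<in> carrier R - {\<zero>}" "\<pi> [a] = \<pi> [b]"
    hence "[a] = [b]" using h2 const_poly by (intro \<pi>_inj_short) auto
    thus "a = b" by simp
  qed
  have sub: "?C \<subseteq> ?S"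
  proof
    fix y assume "y \<in> ?C"
    then obtain a where a: "a \<in> carrier R - {\<zero>}" "y = \<pi> [a]" by auto
    interpret MR: group "Multiplicative_Group.mult_of R" by (rule field_mult_group)
    have "a [^] ?q = \<one>"
      using MR.pow_order_eq_1[of a] a order_mult_of[OF fin] by (simp add: Multiplicative_Group.nat_pow_mult_of)
    hence "[a] [^]\<^bsub>P\<^esub> ?q = \<one>\<^bsub>P\<^esub>"
      unfolding const_pow[OF a(1)] univ_poly_one by (rule arg_cong)
    hence "y [^]\<^bsub>K\<^esub> ?q = \<one>\<^bsub>K\<^esub>"
      unfolding a(2) \<pi>_pow[OF const_poly[OF a(1)], symmetric] using \<pi>_one by (rule ssubst)
    thus "y \<in> ?S" using a \<pi>_closed const_poly by simp
  qed
  have "card ?C = ?q"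
    using card_image[OF inj] fin by (simp add: order_def card_Diff_singleton)
  hence "?C = ?S" using S by (intro card_seteq[OF finS sub]) simp
  moreover have "\<omega> [^]\<^bsub>K\<^esub> norm_exponent \<in> ?S"
  proof -
    have "(\<omega> [^]\<^bsub>K\<^esub> norm_exponent) [^]\<^bsub>K\<^esub> ?q = \<omega> [^]\<^bsub>K\<^esub> M.ord \<omega>"
      unfolding omega_ord norm_exponent[symmetric] using omega_nonzero by (intro K.nat_pow_pow) simp
    also have "\<dots> = \<one>\<^bsub>K\<^esub>"
      using M.pow_ord_eq_1[of \<omega>] omega_nonzero by (simp add: Multiplicative_Group.nat_pow_mult_of)
    finally show ?thesis using omega_nonzero by simp
  qed
  ultimately show ?thesis using that by auto
qed

definition gen :: "'a" where
  "gen = coeff ((X [^]\<^bsub>P\<^esub> norm_exponent) pmod Q) 0"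

text \<open>
  If two powers of the norm of $\omega$ with exponents below $q - 1$ were equal, so would be two powers of
  $\omega$ with exponents below $q^h - 1$, the order of $\omega$.
\<close>

lemma gen_facts: "gen \<in> carrier R" "gen \<noteq> \<zero>" "inj_on (\<lambda>i. gen [^] i) {..<order R - 1}"
proof -
  obtain a where a: "a \<in> carrier R - {\<zero>}" "\<omega> [^]\<^bsub>K\<^esub> norm_exponent = \<pi> [a]"
    by (rule norm_is_const)
  have "\<pi> (X [^]\<^bsub>P\<^esub> norm_exponent) = \<pi> [a]" using a \<pi>_pow[OF X_poly] by simp
  hence "(X [^]\<^bsub>P\<^esub> norm_exponent) pmod Q = [a] pmod Q"
    using X_poly const_poly a by (subst \<pi>_eq_iff[symmetric]) auto
  also have "\<dots> = [a]" using a const_poly h2 by (intro pmod_Q_short) auto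
  finally have gen: "gen = a" by (simp add: gen_def)
  thus "gen \<in> carrier R" "gen \<noteq> \<zero>" using a by auto
  show "inj_on (\<lambda>i. gen [^] i) {..<order R - 1}"
  proof (rule inj_onI)
    fix i j assume ij: "i \<in> {..<order R - 1}" "j \<in> {..<order R - 1}" "gen [^] i = gen [^] j"
    have *: "\<omega> [^]\<^bsub>K\<^esub> (norm_exponent * k) = \<pi> [gen [^] k]" for k
      using a(2) gen const_pow[OF a(1), of k] \<pi>_pow[OF const_poly[OF a(1)], of k] omega_nonzero
      by (metis DiffD1 K.nat_pow_pow)
    have ne: "norm_exponent > 0"
    proof (rule ccontr)
      assume "\<not> 0 < norm_exponent"
      hence "order R ^ h - 1 = 0" using norm_exponent by simp
      thus False using order_q h2 one_less_power[of "order R" h] by simp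
    qed
    have "norm_exponent * k < order R ^ h - 1" if "k < order R - 1" for k
      unfolding norm_exponent[symmetric] using mult_strict_left_mono[OF that ne] by simp
    hence "norm_exponent * i = norm_exponent * j"
      using ij * by (intro omega_pow_inj) auto
    thus "i = j" using ne by simp
  qed
qed

end

section \<open>Products of linear factors\<close>

text \<open>
  With $t = X^k$, this compares the Euclidean algorithm on $G$ and $I$ with the one on their quotients
  by $X^k$: the lower parts $g_0$ and $i_0$ only contribute terms of small degree.
\<close>

lemma (in cring) locator_identity:
  assumes "v \<in> carrier R" "i1 \<in> carrier R" "i0 \<in> carrier R" "e \<in> carrier R" "g1 \<in> carrier R"
    "g0 \<in> carrier R" "w \<in> carrier R" "t \<in> carrier R" "p \<in> carrier R"
    "t \<otimes> i1 \<oplus> i0 = w \<oplus> p \<otimes> e" "p \<otimes> v = t \<otimes> g1 \<oplus> g0"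
  shows "t \<otimes> (v \<otimes> i1 \<oplus> (\<ominus> e) \<otimes> g1) = (v \<otimes> w \<ominus> v \<otimes> i0) \<oplus> e \<otimes> g0"
proof -
  have "t \<otimes> (v \<otimes> i1 \<oplus> (\<ominus> e) \<otimes> g1) = v \<otimes> (t \<otimes> i1 \<oplus> i0) \<ominus> v \<otimes> i0 \<ominus> e \<otimes> (t \<otimes> g1 \<oplus> g0) \<oplus> e \<otimes> g0"
    using assms(1-9) by algebra
  also have "\<dots> = v \<otimes> (w \<oplus> p \<otimes> e) \<ominus> v \<otimes> i0 \<ominus> e \<otimes> (p \<otimes> v) \<oplus> e \<otimes> g0"
    using assms(10,11) by simp
  also have "\<dots> = (v \<otimes> w \<ominus> v \<otimes> i0) \<oplus> e \<otimes> g0"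
    using assms(1-9) by algebra
  finally show ?thesis .
qed

context field
begin

interpretation P: domain P
  by (rule univ_poly_is_domain[OF carrier_is_subring])

definition linear_product :: "'a set \<Rightarrow> 'a list" where
  "linear_product S = finprod P (\<lambda>a. [\<one>, \<ominus> a]) S"

lemma linear_poly: "a \<in> carrier R \<Longrightarrow> [\<one>, \<ominus> a] \<in> carrier P"
  by (intro polyI) auto

lemma linear_product_facts:
  assumes "finite S" "S \<subseteq> carrier R"
  shows "linear_product S \<in> carrier P" "length (linear_product S) = card S + 1"
    "lead_coeff (linear_product S) = \<one>"
    "\<And>b. b \<in> carrier R \<Longrightarrow> eval (linear_product S) b = \<zero> \<longleftrightarrow> b \<in> S"
  using assms
proof (induction S rule: finite_induct)
  case empty
  { case 1 show ?case by (simp add: linear_product_def)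
  next case 2 show ?case by (simp add: linear_product_def univ_poly_one)
  next case 3 show ?case by (simp add: linear_product_def univ_poly_one)
  next case 4 thus ?case by (simp add: linear_product_def univ_poly_one) }
next
  case (insert a S)
  have eq: "linear_product (insert a S) = [\<one>, \<ominus> a] \<otimes>\<^bsub>P\<^esub> linear_product S"
    if "insert a S \<subseteq> carrier R"
    unfolding linear_product_def using insert.hyps that linear_poly
    by (intro P.finprod_insert) auto
  have ne: "linear_product S \<noteq> []" if "insert a S \<subseteq> carrier R" using insert.IH(2) that by auto
  { case 1 thus ?case using eq insert.IH(1) linear_poly by simp
  next case 2 thus ?case using eq insert.IH(1,2) insert.hyps linear_poly ne by (simp add: length_mult)
  next case 3
    thus ?case using eq insert.IH(1,3) linear_poly ne
        poly_mult_lead_coeff[OF carrier_is_subring, of "[\<one>, \<ominus> a]" "linear_product S"]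
      by (simp add: univ_poly_mult univ_poly_carrier[symmetric])
  next case (4 b)
    have "eval [\<one>, \<ominus> a] b = b \<ominus> a" using 4 by (simp add: a_minus_def)
    hence "eval (linear_product (insert a S)) b = (b \<ominus> a) \<otimes> eval (linear_product S) b"
      using 4 eq eval_mult[of "[\<one>, \<ominus> a]" "linear_product S" b] insert.IH(1) linear_poly by simp
    moreover have "(b \<ominus> a = \<zero>) = (b = a)" using 4 by auto
    ultimately show ?case
      using 4 insert.IH(1,4) integral_iff[of "b \<ominus> a" "eval (linear_product S) b"] eval_closed by auto }
qed

lemma linear_product_disjoint:
  assumes "finite A" "finite B" "A \<inter> B = {}" "A \<union> B \<subseteq> carrier R"
  shows "linear_product (A \<union> B) = linear_product A \<otimes>\<^bsub>P\<^esub> linear_product B"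
  unfolding linear_product_def using assms linear_poly by (intro P.finprod_Un_disjoint) auto

lemma length_minus_monic:
  assumes "p \<in> carrier P" "r \<in> carrier P" "length p = Suc n" "length r = Suc n"
    "lead_coeff p = lead_coeff r"
  shows "length (p \<ominus>\<^bsub>P\<^esub> r) \<le> n"
proof -
  have "p \<noteq> []" "r \<noteq> []" using assms by auto
  hence "coeff p n = coeff r n"
    using assms lead_coeff_simp[of p] lead_coeff_simp[of r] by simp
  hence z: "coeff p i \<ominus> coeff r i = \<zero>" if "i \<ge> n" for i
    using that assms poly_coeff_closed[of p i] poly_coeff_closed[of r i]
      coeff_length[of p i] coeff_length[of r i] by (cases "i = n") auto
  have "p \<ominus>\<^bsub>P\<^esub> r \<in> carrier P" using assms by simp
  thus ?thesis
    using z assms by (simp add: length_le_iff coeff_poly_minus)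
qed

lemma monom_poly: "monom \<one> n \<in> carrier P" "length (monom \<one> n) = Suc n"
proof -
  show "monom \<one> n \<in> carrier P"
    unfolding unitary_monom_eq_var_pow[OF carrier_is_subring] by (rule var_pow_closed[OF carrier_is_subring])
  show "length (monom \<one> n) = Suc n" by (simp add: monom_def)
qed

text \<open>
  Both polynomials are monic of degree $q$ and vanish on the whole field, so their difference has
  smaller degree and $q$ roots.
\<close>

lemma field_poly_facts:
  assumes fin: "finite (carrier R)"
  defines "G \<equiv> monom \<one> (order R) \<ominus>\<^bsub>P\<^esub> X"
  shows "G \<in> carrier P" "G = linear_product (carrier R)"
proof -
  have X: "X \<in> carrier P" "length X = 2"
    using var_closed(1)[OF carrier_is_subring] by (simp_all add: var_def)
  have q: "order R \<ge> 2"
  proof -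
    have "card {\<zero>, \<one>} \<le> card (carrier R)" using fin by (intro card_mono) auto
    thus ?thesis by (simp add: order_def)
  qed
  show G: "G \<in> carrier P" using X monom_poly by (simp add: G_def)
  let ?L = "linear_product (carrier R)"
  have L: "?L \<in> carrier P" "length ?L = order R + 1" "lead_coeff ?L = \<one>"
    "\<And>b. b \<in> carrier R \<Longrightarrow> eval ?L b = \<zero>"
    using linear_product_facts[of "carrier R"] fin by (auto simp: order_def)
  have pw: "a [^] order R = a" if a: "a \<in> carrier R" for a
  proof (cases "a = \<zero>")
    case True
    thus ?thesis using q by (simp add: nat_pow_zero)
  next
    case False
    interpret MR: group "Multiplicative_Group.mult_of R" by (rule field_mult_group)
    have "a [^] (order R - 1) = \<one>"
      using MR.pow_order_eq_1[of a] a False order_mult_of[OF fin]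
      by (simp add: Multiplicative_Group.nat_pow_mult_of)
    hence "a [^] Suc (order R - 1) = a" using a by simp
    thus ?thesis using q by simp
  qed
  have "(monom \<one> (order R) \<ominus>\<^bsub>P\<^esub> ?L) \<ominus>\<^bsub>P\<^esub> X = []"
  proof (rule zero_poly_if_many_roots[of _ "carrier R"])
    have "length (monom \<one> (order R) \<ominus>\<^bsub>P\<^esub> ?L) \<le> order R"
      using L monom_poly by (intro length_minus_monic) (auto simp: monom_def)
    thus "length ((monom \<one> (order R) \<ominus>\<^bsub>P\<^esub> ?L) \<ominus>\<^bsub>P\<^esub> X) \<le> card (carrier R)"
      unfolding order_def[symmetric] using L(1) monom_poly X q by (intro length_minus_le[OF P.minus_closed]) simp_all
    fix a assume a: "a \<in> carrier R"
    show "eval ((monom \<one> (order R) \<ominus>\<^bsub>P\<^esub> ?L) \<ominus>\<^bsub>P\<^esub> X) a = \<zero>"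
    proof -
      have "eval ((monom \<one> (order R) \<ominus>\<^bsub>P\<^esub> ?L) \<ominus>\<^bsub>P\<^esub> X) a = a \<ominus> \<zero> \<ominus> a"
        using a L monom_poly X by (simp add: eval_minus eval_monom_one eval_var pw)
      thus ?thesis using a by (simp add: minus_eq r_neg)
    qed
  qed (use fin L monom_poly X in auto)
  moreover have "(monom \<one> (order R) \<ominus>\<^bsub>P\<^esub> ?L) \<ominus>\<^bsub>P\<^esub> X = G \<ominus>\<^bsub>P\<^esub> ?L"
    unfolding G_def using L monom_poly X by (simp add: P.minus_eq P.a_ac)
  ultimately show "G = ?L"
    using P.r_right_minus_eq[OF G L(1)] by (simp add: univ_poly_zero)
qed

end

context primitive_modulus
begin

interpretation P: domain P
  by (rule univ_poly_is_domain[OF carrier_is_subring])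

text \<open>
  An irreducible polynomial of degree at least 2 has no roots. Hence the received word, which
  involves division by the values of \<open>Q\<close>, makes sense at every point.
\<close>

lemma eval_Q_nonzero:
  assumes "a \<in> carrier R"
  shows "eval Q a \<noteq> \<zero>"
proof
  assume "eval Q a = \<zero>"
  hence "a \<in># roots Q" using assms Q_poly Q_length roots_mem_iff_is_root[OF Q_poly] by (auto simp: is_root_def)
  moreover have "roots Q = {#}"
    using pirreducible_roots[OF Q_poly Q_irreducible] degQ h2 by simp
  ultimately show False by simp
qed

section \<open>The precomputed tables\<close>

lemma precompute_tables:
  fixes c :: op_counts
  assumes big: "order R \<ge> 4 * h"
  defines "T \<equiv> result (precompute c Q)"
  shows "field_tables gen T"
    "xk T = map (\<lambda>a. a [^] (order R - 2 * h)) (support T)"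
    "qinv T = map (\<lambda>a. inv (eval Q a)) (support T)"
proof -
  let ?q = "order R" let ?k = "order R - 2 * h"
  define gs where "gs = map (\<lambda>i. gen [^] i) [0..<?q - 1]"
  define ts where "ts = map (\<lambda>i. gen [^] (i choose 2)) [0..<2 * ?q - 3]"
  have kq: "?k < ?q - 1" using h2 big by linarith
  have w: "coeff (result (powmod c Q X ((?q ^ h - 1) div (?q - 1)))) 0 = gen"
    using result_powmod[OF Q_poly Q_length_ge X_poly] by (simp add: gen_def norm_exponent_def)
  have gk: "gs ! ?k = gen [^] ?k" using kq by (simp add: gs_def)
  have gs: "fst (result (powers gen (?q - 1))) = gs"
    using gen_facts by (simp add: result_powers gs_def)
  have ts: "fst (result (chirps gen (2 * ?q - 3))) = ts"
    using gen_facts by (simp add: result_chirps ts_def)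
  have ks: "fst (result (powers (gs ! ?k) (?q - 1))) = map (\<lambda>a. a [^] ?k) gs"
    using gen_facts unfolding gk by (simp add: result_powers gs_def nat_pow_pow mult.commute)
  have tinv: "result (mapT finv (take (?q - 1) ts)) = map (\<lambda>i. inv (gen [^] (i choose 2))) [0..<?q - 1]"
    using order_q by (simp add: result_mapT ts_def take_map)
  define T0 where "T0 = \<lparr> support = \<zero> # gs, xk = \<zero> [^] ?k # map (\<lambda>a. a [^] ?k) gs, qinv = [],
               chirp = ts, chirp_inv = map (\<lambda>i. inv (gen [^] (i choose 2))) [0..<?q - 1] \<rparr>"
  have T0: "field_tables gen T0"
    by (simp add: field_tables_def chirp_tables_def T0_def gs_def ts_def)
  have T: "T = T0\<lparr>qinv := result (mapT finv (result (eval_support c T0 Q)))\<rparr>"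
    unfolding T_def precompute_def Let_def degQ result_bind result_ret case_prod_beta w gs ks ts tinv
    by (simp add: T0_def)
  have "result (eval_support c T0 Q) = map (eval Q) (support T0)"
    using gen_facts T0 order_q Q_poly Q_length big h2
    by (intro result_eval_support poly_set) auto
  hence qi: "qinv T = map (\<lambda>a. inv (eval Q a)) (support T0)"
    unfolding T by (simp add: result_mapT)
  show "field_tables gen T" using T0 unfolding T by (simp add: field_tables_def chirp_tables_def)
  show "xk T = map (\<lambda>a. a [^] ?k) (support T)" unfolding T by (simp add: T0_def)
  show "qinv T = map (\<lambda>a. inv (eval Q a)) (support T)" unfolding qi by (simp add: T)
qed

section \<open>One round of the relation search\<close>

lemma support_facts:
  assumes "order R \<ge> 4 * h"
  shows "distinct (support (result (precompute c Q)))"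
    "set (support (result (precompute c Q))) = carrier R"
    "length (support (result (precompute c Q))) = order R"
  using distinct_support[OF fin gen_facts precompute_tables(1)[OF assms]] by auto

lemma eval_support_correct:
  assumes "order R \<ge> 4 * h" "set p \<subseteq> carrier R" "length p \<le> order R - 1"
  shows "result (eval_support c (result (precompute c Q)) p)
    = map (eval p) (support (result (precompute c Q)))"
  using assms gen_facts precompute_tables(1)[OF assms(1)] order_q
  by (intro result_eval_support) auto

definition word_at :: "'a list \<Rightarrow> 'a \<Rightarrow> 'a" where
  "word_at f a = \<ominus> (eval f a \<otimes> inv (eval Q a)) \<ominus> a [^] (order R - 2 * h)"

lemma inv_eval_Q: "a \<in> carrier R \<Longrightarrow> inv (eval Q a) \<in> carrier R"
  "a \<in> carrier R \<Longrightarrow> eval Q a \<otimes> inv (eval Q a) = \<one>"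
  using eval_Q_nonzero eval_closed[OF Q_poly] by (auto simp: field_Units)

lemma word_at_closed: "f \<in> carrier P \<Longrightarrow> a \<in> carrier R \<Longrightarrow> word_at f a \<in> carrier R"
  using inv_eval_Q eval_closed by (auto simp: word_at_def)

lemma received_word_correct:
  fixes c :: op_counts
  assumes "order R \<ge> 4 * h"
  defines "T \<equiv> result (precompute c Q)"
  shows "result (received_word T (map (eval f) (support T))) = map (word_at f) (support T)"
proof -
  note T = precompute_tables[OF assms(1), where c=c, folded T_def]
  have z: "zip (map (eval f) (support T)) (zip (qinv T) (xk T))
    = map (\<lambda>a. (eval f a, inv (eval Q a), a [^] (order R - 2 * h))) (support T)"
    unfolding T(2,3) by (induction "support T") (auto simp: zip_map_map zip_same_conv_map)
  show ?thesis
    unfolding received_word_def z by (simp add: result_mapT word_at_def comp_def)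
qed

text \<open>
  The interpolation polynomial of the received word that belongs to the residue \<open>f\<close>.
\<close>

definition word_poly :: "op_counts \<Rightarrow> 'a list \<Rightarrow> 'a list" where
  "word_poly c f = result (interpolate c (result (precompute c Q)) (map (word_at f) (support (result (precompute c Q)))))"

lemma word_poly_facts:
  assumes big: "order R \<ge> 4 * h" and f: "f \<in> carrier P"
  shows "word_poly c f \<in> carrier P" "length (word_poly c f) \<le> order R"
    "\<And>a. a \<in> carrier R \<Longrightarrow> eval (word_poly c f) a = word_at f a"
proof -
  let ?T = "result (precompute c Q)"
  note S = support_facts[OF big, where c=c]
  have y: "set (map (word_at f) (support ?T)) \<subseteq> carrier R" "length (map (word_at f) (support ?T)) = order R"
    using S word_at_closed[OF f] by auto
  note I = result_interpolate[OF fin gen_facts precompute_tables(1)[OF big, where c=c] order_q y, where c=c, folded word_poly_def]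
  show "word_poly c f \<in> carrier P" "length (word_poly c f) \<le> order R"
    using I by auto
  fix a assume "a \<in> carrier R"
  then obtain k where "k < order R" "support ?T ! k = a"
    using S by (metis in_set_conv_nth)
  thus "eval (word_poly c f) a = word_at f a" using I(3)[of k] S by simp
qed

definition locator :: "op_counts \<Rightarrow> 'a list \<Rightarrow> 'a list" where
  "locator c f = (let Xk = monom \<one> (order R - 2 * h);
       G = monom \<one> (order R) \<ominus>\<^bsub>P\<^esub> X
     in result (partial_xgcd c (G pdiv Xk) (word_poly c f pdiv Xk) h))"

lemma locator_input:
  assumes big: "order R \<ge> 4 * h" and f: "f \<in> carrier P"
  defines "Xk \<equiv> monom \<one> (order R - 2 * h)" and "G \<equiv> monom \<one> (order R) \<ominus>\<^bsub>P\<^esub> X"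
  shows "Xk \<in> carrier P" "length Xk = order R - 2 * h + 1" "G \<in> carrier P"
    "G pdiv Xk \<in> carrier P" "word_poly c f pdiv Xk \<in> carrier P"
    "length (G pdiv Xk) = 2 * h + 1" "length (word_poly c f pdiv Xk) < length (G pdiv Xk)"
proof -
  show X: "Xk \<in> carrier P" "length Xk = order R - 2 * h + 1"
    using monom_poly by (auto simp: Xk_def)
  note Gf = field_poly_facts[OF fin, folded G_def]
  have lG: "length G = order R + 1"
    using Gf linear_product_facts(2)[OF fin subset_refl] by (simp add: order_def)
  note I = word_poly_facts(1,2)[OF big f, where c=c]
  show "G \<in> carrier P" "G pdiv Xk \<in> carrier P"
    "word_poly c f pdiv Xk \<in> carrier P"
    using pdiv_pmod_id(2)[OF _ X(1)] Gf I by auto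
  show lg: "length (G pdiv Xk) = 2 * h + 1"
    using length_pdiv[OF Gf(1) X(1)] lG X big by simp
  have "length (word_poly c f pdiv Xk) \<le> 2 * h"
  proof (cases "length (word_poly c f) \<ge> length Xk")
    case True
    thus ?thesis using length_pdiv[OF I(1) X(1)] I(2) X big by simp
  next
    case False
    hence "degree Xk > degree (word_poly c f) \<or> word_poly c f = []"
      using X h2 big by (cases "word_poly c f") auto
    thus ?thesis
    proof
      assume "degree Xk > degree (word_poly c f)"
      thus ?thesis using pmod_const(1)[OF carrier_is_subfield I(1) X(1)] by simp
    next
      assume "word_poly c f = []"
      thus ?thesis using long_division_zero(1)[OF carrier_is_subfield X(1)] by simp
    qed
  qed
  thus "length (word_poly c f pdiv Xk) < length (G pdiv Xk)" using lg by simp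
qed

lemma locator_poly:
  assumes big: "order R \<ge> 4 * h" and f: "f \<in> carrier P"
  shows "locator c f \<in> carrier P"
proof -
  note L = locator_input(1-4)[OF big f] locator_input(5)[OF big f, where c=c]
    locator_input(6)[OF big f] locator_input(7)[OF big f, where c=c]
  have h: "1 \<le> h" "h \<le> degree ((monom \<one> (order R) \<ominus>\<^bsub>P\<^esub> X) pdiv (monom \<one> (order R - 2 * h)))"
    using L(6) h2 by auto
  show ?thesis unfolding locator_def Let_def
    by (rule partial_xgcd_spec[OF L(4,5,7) h, where c=c])
qed

text \<open>
  Let $p$ be the product over the complement of $B$ and $v$ the one over $B$. As $p$ and $X^k Q$ are
  monic of the same degree and $p \equiv f$, one can write $p - X^k Q - f = Q w$ with $\deg w < k$. At the
  zeros of $p$ the received word has the value of $w$; so $w$ is the transmitted codeword and the errors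
  are confined to $B$. Hence the interpolation polynomial is $I = w + p e$ with $\deg e < h$, and
  $v I = v w + G e$. At a point $b$ of $B$ the error is $-p(b)/Q(b) \ne 0$, so $e(b) \ne 0$ there.
  Division by $X^k$ turns the equation into a combination of the quotients of $I$ and $G$ of degree
  less than $h$, from which the Euclidean algorithm recovers $v$.
\<close>

lemma decoding:
  assumes big: "order R \<ge> 4 * h" and f: "f \<in> carrier P" "length f \<le> h"
    and B: "B \<subseteq> carrier R" "card B = h"
    and cong: "\<pi> f = \<pi> (linear_product (carrier R - B))"
  shows "length (locator c f) = h + 1" "result (make_monic (locator c f)) = linear_product B"
proof -
  let ?q = "order R" let ?k = "order R - 2 * h"
  define A where "A = carrier R - B"
  define p where "p = linear_product A"
  define v where "v = linear_product B"
  define Xk where "Xk = monom \<one> ?k"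
  define G where "G = monom \<one> ?q \<ominus>\<^bsub>P\<^esub> X"
  define I where "I = word_poly c f"
  have finB: "finite B" and finA: "finite A" using fin B finite_subset by (auto simp: A_def)
  have cA: "card A = ?q - h" using B finB by (simp add: A_def card_Diff_subset order_def)
  have Asub: "A \<subseteq> carrier R" by (auto simp: A_def)
  note pf = linear_product_facts[OF finA Asub, folded p_def]
  note vf = linear_product_facts[OF finB B(1), folded v_def]
  note L = locator_input(1-4)[OF big f(1), folded Xk_def G_def]
    locator_input(5)[OF big f(1), where c=c, folded Xk_def G_def I_def]
    locator_input(6)[OF big f(1), folded Xk_def G_def]
    locator_input(7)[OF big f(1), where c=c, folded Xk_def G_def I_def]
  note If = word_poly_facts[OF big f(1), where c=c, folded I_def]
  have Gpv: "G = p \<otimes>\<^bsub>P\<^esub> v"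
  proof -
    have "A \<union> B = carrier R" "A \<inter> B = {}" using B by (auto simp: A_def)
    thus ?thesis
      using linear_product_disjoint[of A B] finA finB field_poly_facts(2)[OF fin]
      by (simp add: p_def v_def G_def)
  qed
  \<comment> \<open>the leading terms of \<open>p\<close> and \<open>Xk \<otimes> Q\<close> cancel, which makes \<open>D\<close> short enough for a codeword\<close>
  have XQ: "Xk \<otimes>\<^bsub>P\<^esub> Q \<in> carrier P" using L Q_poly by simp
  have lXQ: "length (Xk \<otimes>\<^bsub>P\<^esub> Q) = Suc (?q - h)"
    using L Q_poly Q_length big by (subst length_mult) auto
  have Xkne: "Xk \<noteq> []" and Qne: "Q \<noteq> []" using L(2) Q_length by auto
  have leadXQ: "lead_coeff (Xk \<otimes>\<^bsub>P\<^esub> Q) = \<one>"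
    using poly_mult_lead_coeff[OF carrier_is_subring, of Xk Q] L(1) Q_poly Q_monic Xkne Qne
    by (simp add: univ_poly_mult univ_poly_carrier Xk_def monom_def)
  define D where "D = (p \<ominus>\<^bsub>P\<^esub> Xk \<otimes>\<^bsub>P\<^esub> Q) \<ominus>\<^bsub>P\<^esub> f"
  have D: "D \<in> carrier P" using pf XQ f by (simp add: D_def)
  have lD: "length D \<le> ?q - h"
  proof -
    have "length (p \<ominus>\<^bsub>P\<^esub> Xk \<otimes>\<^bsub>P\<^esub> Q) \<le> ?q - h"
      using pf XQ lXQ leadXQ cA by (intro length_minus_monic) auto
    thus ?thesis unfolding D_def using pf XQ f big by (intro length_minus_le[OF P.minus_closed]) auto
  qed
  have "Q pdivides D"
  proof -
    have "f pmod Q = p pmod Q"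
      using cong f pf by (subst \<pi>_eq_iff[symmetric]) (auto simp: p_def A_def)
    hence "Q pdivides (p \<ominus>\<^bsub>P\<^esub> f)"
      using same_pmod_iff_pdivides[OF carrier_is_subfield pf(1) f(1) Q_poly] by simp
    then obtain t where t: "t \<in> carrier P" "p \<ominus>\<^bsub>P\<^esub> f = Q \<otimes>\<^bsub>P\<^esub> t"
      by (auto simp: pdivides_def factor_def)
    have "D = (p \<ominus>\<^bsub>P\<^esub> f) \<ominus>\<^bsub>P\<^esub> Xk \<otimes>\<^bsub>P\<^esub> Q"
      unfolding D_def using pf XQ f by (simp add: P.minus_eq P.a_ac)
    also have "\<dots> = Q \<otimes>\<^bsub>P\<^esub> (t \<ominus>\<^bsub>P\<^esub> Xk)"
      using t L(1) Q_poly by (simp add: P.minus_eq P.r_distr P.r_minus P.m_comm[of Xk Q])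
    finally show ?thesis
      unfolding pdivides_def factor_def using t L(1) by blast
  qed
  then obtain w where w: "w \<in> carrier P" "D = Q \<otimes>\<^bsub>P\<^esub> w"
    by (auto simp: pdivides_def factor_def)
  have lw: "length w \<le> ?k"
  proof (cases "w = []")
    case False
    thus ?thesis using length_mult[OF Q_poly w(1) Qne] lD w Q_length by simp
  qed simp
  have Qw: "eval Q a \<otimes> eval w a = eval p a \<ominus> a [^] ?k \<otimes> eval Q a \<ominus> eval f a" if a: "a \<in> carrier R" for a
  proof -
    have "eval Q a \<otimes> eval w a = eval D a" using w a Q_poly by (simp add: eval_mult)
    also have "\<dots> = eval p a \<ominus> a [^] ?k \<otimes> eval Q a \<ominus> eval f a"
      unfolding D_def using a pf(1) XQ f L(1) Q_poly
      by (simp add: eval_minus eval_mult Xk_def eval_monom_one)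
    finally show ?thesis .
  qed
  have QI: "eval Q a \<otimes> eval I a = \<ominus> eval f a \<ominus> a [^] ?k \<otimes> eval Q a" if a: "a \<in> carrier R" for a
  proof -
    have fa: "eval f a \<in> carrier R" "eval Q a \<in> carrier R" "inv (eval Q a) \<in> carrier R"
      using f a Q_poly inv_eval_Q by (auto simp: eval_closed)
    have "eval Q a \<otimes> eval I a = eval Q a \<otimes> (\<ominus> (eval f a \<otimes> inv (eval Q a)) \<ominus> a [^] ?k)"
      using If(3)[OF a] by (simp add: word_at_def)
    also have "\<dots> = \<ominus> ((eval Q a \<otimes> inv (eval Q a)) \<otimes> eval f a) \<ominus> a [^] ?k \<otimes> eval Q a"
      using fa a by (simp add: minus_eq r_distr r_minus m_ac)
    finally show ?thesis using inv_eval_Q(2)[OF a] fa by simp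
  qed
  have diff: "eval Q a \<otimes> eval (I \<ominus>\<^bsub>P\<^esub> w) a = \<ominus> eval p a" if a: "a \<in> carrier R" for a
  proof -
    have cl: "eval f a \<in> carrier R" "eval Q a \<in> carrier R" "eval p a \<in> carrier R" "eval I a \<in> carrier R"
      "eval w a \<in> carrier R"
      using f a Q_poly pf(1) If(1) w(1) by (auto simp: eval_closed)
    have "eval Q a \<otimes> eval (I \<ominus>\<^bsub>P\<^esub> w) a = eval Q a \<otimes> eval I a \<ominus> eval Q a \<otimes> eval w a"
      using a If(1) w(1) cl by (simp add: eval_minus minus_eq r_distr r_minus)
    also have "\<dots> = (\<ominus> eval f a \<ominus> a [^] ?k \<otimes> eval Q a) \<ominus> (eval p a \<ominus> a [^] ?k \<otimes> eval Q a \<ominus> eval f a)"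
      using Qw QI a by simp
    also have "\<dots> = \<ominus> eval p a"
    proof -
      have *: "(\<ominus> y \<ominus> s) \<ominus> (z \<ominus> s \<ominus> y) = \<ominus> z" if "y \<in> carrier R" "s \<in> carrier R" "z \<in> carrier R" for y s z
        using that by algebra
      show ?thesis using cl a by (intro *) auto
    qed
    finally show ?thesis .
  qed
  \<comment> \<open>\<open>p\<close> divides \<open>I - w\<close> because the remainder has as many roots as \<open>p\<close>\<close>
  have Iw: "I \<ominus>\<^bsub>P\<^esub> w \<in> carrier P" "length (I \<ominus>\<^bsub>P\<^esub> w) \<le> ?q"
    using If w lw by (auto intro!: length_minus_le)
  define e where "e = (I \<ominus>\<^bsub>P\<^esub> w) pdiv p"
  have lp: "length p \<ge> 2" using pf cA big h2 by simp
  note dv = pdiv_pmod_id[OF Iw(1) pf(1), folded e_def]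
  have "(I \<ominus>\<^bsub>P\<^esub> w) pmod p = []"
  proof (rule zero_poly_if_many_roots[OF dv(3) finA Asub])
    fix a assume a: "a \<in> A"
    hence ac: "a \<in> carrier R" using Asub by auto
    have pz: "eval p a = \<zero>" using pf(4)[OF ac] a by simp
    hence "eval Q a \<otimes> eval (I \<ominus>\<^bsub>P\<^esub> w) a = \<zero>" using diff[OF ac] by simp
    hence "eval (I \<ominus>\<^bsub>P\<^esub> w) a = \<zero>"
      using integral[of "eval Q a" "eval (I \<ominus>\<^bsub>P\<^esub> w) a"] eval_Q_nonzero[OF ac] ac Q_poly Iw
      by (auto simp: eval_closed)
    moreover have "eval (I \<ominus>\<^bsub>P\<^esub> w) a
      = eval p a \<otimes> eval e a \<oplus> eval ((I \<ominus>\<^bsub>P\<^esub> w) pmod p) a"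
      using ac pf dv eval_add[of "p \<otimes>\<^bsub>P\<^esub> e" "(I \<ominus>\<^bsub>P\<^esub> w) pmod p" a] eval_mult[of p e a]
      by simp
    ultimately show "eval ((I \<ominus>\<^bsub>P\<^esub> w) pmod p) a = \<zero>"
      using pz ac dv by (simp add: eval_closed)
  next
    show "length ((I \<ominus>\<^bsub>P\<^esub> w) pmod p) \<le> card A"
      using length_pmod[OF Iw(1) pf(1) lp] pf(2) by simp
  qed
  hence Ie: "I \<ominus>\<^bsub>P\<^esub> w = p \<otimes>\<^bsub>P\<^esub> e"
    using dv pf P.r_zero[of "p \<otimes>\<^bsub>P\<^esub> e"] by (simp add: univ_poly_zero)
  have I_eq: "I = w \<oplus>\<^bsub>P\<^esub> p \<otimes>\<^bsub>P\<^esub> e"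
  proof -
    have "w \<oplus>\<^bsub>P\<^esub> (I \<ominus>\<^bsub>P\<^esub> w) = I"
      using If(1) w(1) by algebra
    thus ?thesis using Ie by simp
  qed
  have le: "length e \<le> h"
  proof (cases "e = []")
    case False
    have pne: "p \<noteq> []" using lp by auto
    show ?thesis using length_mult[OF pf(1) dv(2) pne False] Ie Iw(2) pf(2) cA big by simp
  qed simp
  have eB: "eval e b \<noteq> \<zero>" if b: "b \<in> B" for b
  proof
    assume z: "eval e b = \<zero>"
    have bc: "b \<in> carrier R" using b B by auto
    have "eval (I \<ominus>\<^bsub>P\<^esub> w) b = \<zero>"
      unfolding Ie using z bc pf(1) dv(2) by (simp add: eval_mult eval_closed)
    hence "\<ominus> eval p b = \<zero>" using diff[OF bc] bc Q_poly by (simp add: eval_closed)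
    hence "eval p b = \<zero>" using minus_minus[OF eval_closed[OF pf(1) bc]] minus_zero by simp
    thus False using pf(4)[OF bc] b by (simp add: A_def)
  qed
  \<comment> \<open>\<open>r\<close> is short because \<open>Xk \<otimes> r\<close> differs from \<open>v I - G e = v w\<close> by short terms only\<close>
  define r where "r = v \<otimes>\<^bsub>P\<^esub> (I pdiv Xk) \<oplus>\<^bsub>P\<^esub> (\<ominus>\<^bsub>P\<^esub> e) \<otimes>\<^bsub>P\<^esub> (G pdiv Xk)"
  have r: "r \<in> carrier P" using vf(1) L dv(2) by (simp add: r_def)
  note Id = pdiv_pmod_id[OF If(1) L(1)] and Gd = pdiv_pmod_id[OF L(3) L(1)]
  have lXk: "length Xk \<ge> 2" using L(2) big h2 by simp
  have l0: "length (I pmod Xk) \<le> ?k" "length (G pmod Xk) \<le> ?k"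
    using length_pmod[OF If(1) L(1) lXk] length_pmod[OF L(3) L(1) lXk] L(2) by auto
  have "Xk \<otimes>\<^bsub>P\<^esub> r
    = (v \<otimes>\<^bsub>P\<^esub> w \<ominus>\<^bsub>P\<^esub> v \<otimes>\<^bsub>P\<^esub> (I pmod Xk)) \<oplus>\<^bsub>P\<^esub> e \<otimes>\<^bsub>P\<^esub> (G pmod Xk)"
    unfolding r_def
    by (rule P.locator_identity[of _ _ _ _ _ _ _ _ p])
       (use vf(1) Id Gd dv(2) w(1) L(1) pf(1) I_eq Gpv in auto)
  moreover have "length \<dots> \<le> ?k + h"
    using vf w lw l0 le Id Gd dv(2) B
    by (intro length_add_le length_minus_le length_mult_le) auto
  ultimately have lr: "length r \<le> h"
  proof -
    assume *: "Xk \<otimes>\<^bsub>P\<^esub> r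
    = (v \<otimes>\<^bsub>P\<^esub> w \<ominus>\<^bsub>P\<^esub> v \<otimes>\<^bsub>P\<^esub> (I pmod Xk)) \<oplus>\<^bsub>P\<^esub> e \<otimes>\<^bsub>P\<^esub> (G pmod Xk)"
      "length ((v \<otimes>\<^bsub>P\<^esub> w \<ominus>\<^bsub>P\<^esub> v \<otimes>\<^bsub>P\<^esub> (I pmod Xk)) \<oplus>\<^bsub>P\<^esub> e \<otimes>\<^bsub>P\<^esub> (G pmod Xk)) \<le> ?k + h"
    show ?thesis
    proof (cases "r = []")
      case False
      show ?thesis using length_mult[OF L(1) r Xkne False] * L(2) by simp
    qed simp
  qed
  have h1: "1 \<le> h" using h2 by simp
  have lv: "length v = h + 1" using vf B by simp
  have eP: "\<ominus>\<^bsub>P\<^esub> e \<in> carrier P" using dv by simp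
  have ev: "eval v b = \<zero>" if "b \<in> B" for b using vf(4) that B by auto
  have ee: "eval (\<ominus>\<^bsub>P\<^esub> e) b \<noteq> \<zero>" if b: "b \<in> B" for b
  proof
    assume z: "eval (\<ominus>\<^bsub>P\<^esub> e) b = \<zero>"
    have bc: "b \<in> carrier R" using b B by auto
    have "eval e b \<oplus> eval (\<ominus>\<^bsub>P\<^esub> e) b = eval (e \<oplus>\<^bsub>P\<^esub> \<ominus>\<^bsub>P\<^esub> e) b"
      using bc dv(2) by (simp add: eval_add)
    also have "\<dots> = \<zero>" using dv(2) P.r_neg[OF dv(2)] by (simp add: univ_poly_zero)
    finally show False using z eB[OF b] bc dv(2) by (simp add: eval_closed)
  qed
  have loc: "locator c f = result (partial_xgcd c (G pdiv Xk) (I pdiv Xk) h)"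
    by (simp add: locator_def Let_def G_def Xk_def I_def)
  note main = partial_xgcd_error_locator[OF L(4,5,7) h1 L(6) vf(1) eP lv vf(3) lr[unfolded r_def]
      finB B ev ee, where c=c]
  show "length (locator c f) = h + 1" "result (make_monic (locator c f)) = linear_product B"
    unfolding loc v_def[symmetric] using main by auto
qed

end

context primitive_modulus
begin

interpretation P: domain P
  by (rule univ_poly_is_domain[OF carrier_is_subring])

interpretation K: field K by (rule K_field)

definition residue :: "nat \<Rightarrow> 'a list" where
  "residue u = (X [^]\<^bsub>P\<^esub> u) pmod Q"

lemma residue_facts: "residue u \<in> carrier P" "length (residue u) \<le> h"
  "\<pi> (residue u) = \<omega> [^]\<^bsub>K\<^esub> u"
proof -
  have X: "X [^]\<^bsub>P\<^esub> u \<in> carrier P" using X_poly by simp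
  show "residue u \<in> carrier P"
    using pdiv_pmod_id(3)[OF X Q_poly] by (simp add: residue_def)
  show "length (residue u) \<le> h"
    using length_pmod[OF X Q_poly Q_length_ge] Q_length by (simp add: residue_def)
  show "\<pi> (residue u) = \<omega> [^]\<^bsub>K\<^esub> u"
    using rupture_surj_composed_with_pmod[OF carrier_is_subfield Q_poly X] \<pi>_pow[OF X_poly, of u]
    by (simp add: residue_def)
qed

lemma trial_word:
  fixes c :: op_counts
  assumes big: "order R \<ge> 4 * h"
  defines "T \<equiv> result (precompute c Q)"
  shows "result (interpolate c T (result (received_word T (result (eval_support c T (residue u))))))
    = word_poly c (residue u)"
proof -
  have "length (residue u) \<le> order R - 1" using residue_facts(2)[of u] big h2 by linarith
  hence "result (eval_support c T (residue u)) = map (eval (residue u)) (support T)"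
    unfolding T_def using residue_facts(1)[of u] big by (intro eval_support_correct poly_set)
  thus ?thesis
    unfolding word_poly_def T_def using received_word_correct[OF big, where c=c] by simp
qed

lemma result_trial:
  fixes c :: op_counts and u :: nat
  assumes big: "order R \<ge> 4 * h"
  defines "T \<equiv> result (precompute c Q)"
  defines "v \<equiv> result (make_monic (locator c (residue u)))"
  shows "result (trial c Q T u) =
    (if length (locator c (residue u)) = h + 1 \<and> result (powmod c v X (order R)) = X
     then Some (u, result (find_roots c T v)) else None)"
proof -
  have f: "result (powmod c Q X u) = residue u"
    using result_powmod[OF Q_poly Q_length_ge X_poly] by (simp add: residue_def)
  have eq: "length (locator c (residue u)) - Suc 0 = h \<longleftrightarrow> length (locator c (residue u)) = Suc h"
    using h2 by auto
  have w: "result (interpolate c T (result (received_word T (result (eval_support c T (residue u))))))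
    = word_poly c (residue u)"
    unfolding T_def by (rule trial_word[OF big])
  have l: "result (partial_xgcd c ((monom \<one> (order R) \<ominus>\<^bsub>P\<^esub> X) pdiv monom \<one> (order R - 2 * h))
     (word_poly c (residue u) pdiv monom \<one> (order R - 2 * h)) h) = locator c (residue u)"
    by (simp add: locator_def Let_def)
  show ?thesis
    unfolding trial_def Let_def degQ result_bind f w l
    by (auto simp: eq peq_def v_def)
qed

lemma trial_success:
  assumes big: "order R \<ge> 4 * h" and B: "B \<subseteq> carrier R" "card B = h"
    and u: "\<omega> [^]\<^bsub>K\<^esub> u = \<pi> (linear_product (carrier R - B))"
  shows "result (trial c Q (result (precompute c Q)) u) \<noteq> None"
proof -
  have cong: "\<pi> (residue u) = \<pi> (linear_product (carrier R - B))"
    using u residue_facts(3)[of u] by simp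
  note d = decoding[OF big residue_facts(1,2) B cong, where c=c]
  let ?A = "carrier R - B"
  have finB: "finite B" and finA: "finite ?A" using fin B finite_subset by auto
  have un: "?A \<union> B = carrier R" "?A \<inter> B = {}" using B by auto
  note vf = linear_product_facts[OF finB B(1)]
  have p: "linear_product ?A \<in> carrier P" by (intro linear_product_facts(1) finA) auto
  have lv: "length (linear_product B) = h + 1" using vf(2) B by simp
  have vne: "linear_product B \<noteq> []" using lv by auto
  have M: "monom \<one> (order R) \<in> carrier P" by (rule monom_poly)
  have G: "monom \<one> (order R) \<ominus>\<^bsub>P\<^esub> X = linear_product B \<otimes>\<^bsub>P\<^esub> linear_product ?A"
    using linear_product_disjoint[of ?A B] finA finB un B(1) field_poly_facts(2)[OF fin]
      P.m_comm[OF p vf(1)] by simp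
  have "monom \<one> (order R) = linear_product B \<otimes>\<^bsub>P\<^esub> linear_product ?A \<oplus>\<^bsub>P\<^esub> X"
    unfolding G[symmetric] using M X_poly by algebra
  hence "monom \<one> (order R) pmod linear_product B = X"
    using M X_poly X_length vf(1) vne p lv h2 by (intro pmod_unique(2)) auto
  moreover have "result (powmod c (linear_product B) X (order R)) = monom \<one> (order R) pmod linear_product B"
    using lv h2 vf(1) X_poly unitary_monom_eq_var_pow[OF carrier_is_subring, of "order R"]
    by (subst result_powmod) auto
  ultimately show ?thesis
    using d by (simp add: result_trial[OF big])
qed

text \<open>
  Also when decoding fails, the candidate is a proper polynomial once it has the right degree; the
  bounds on cost and storage must hold for every exponent.
\<close>

lemma monic_locator_poly:
  fixes c :: op_counts and u :: nat
  assumes big: "order R \<ge> 4 * h" and len: "length (locator c (residue u)) = h + 1"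
  defines "v \<equiv> result (make_monic (locator c (residue u)))"
  shows "v \<in> carrier P" "length v = h + 1"
proof -
  let ?w = "locator c (residue u)"
  have w: "?w \<in> carrier P" by (rule locator_poly[OF big residue_facts(1)])
  have wne: "?w \<noteq> []" using len by auto
  have lc: "lead_coeff ?w \<in> carrier R" "lead_coeff ?w \<noteq> \<zero>"
    using poly_lead_nonzero[OF w wne] poly_set[OF w] wne by auto
  have l: "inv (lead_coeff ?w) \<in> carrier R" "inv (lead_coeff ?w) \<otimes> lead_coeff ?w = \<one>"
    using lc by (auto simp: field_Units)
  have v_eq: "v = map (\<lambda>y. inv (lead_coeff ?w) \<otimes> y) ?w"
    by (simp add: v_def make_monic_def result_mapT)
  show "length v = h + 1" using len by (simp add: v_eq)
  have "lead_coeff v = \<one>" using l wne by (simp add: v_eq hd_map)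
  moreover have "set v \<subseteq> carrier R" using l poly_set[OF w] by (auto simp: v_eq)
  ultimately show "v \<in> carrier P" by (intro polyI) auto
qed

text \<open>
  The number of roots bounds the size of a stored relation. Since the roots are read off from the
  table of values, this depends on the evaluation being correct.
\<close>

lemma trial_relation:
  assumes big: "order R \<ge> 4 * h" and s: "result (trial c Q (result (precompute c Q)) u) = Some (u', rs)"
  shows "u' = u" "length rs \<le> h"
proof -
  let ?T = "result (precompute c Q)"
  let ?w = "locator c (residue u)"
  define v where "v = result (make_monic ?w)"
  have len: "length ?w = h + 1" and u': "u' = u" and rs: "rs = result (find_roots c ?T v)"
    using s by (auto simp: result_trial[OF big] v_def split: if_splits)
  show "u' = u" by (rule u')
  have v: "v \<in> carrier P" and lv: "length v = h + 1"
    unfolding v_def by (rule monic_locator_poly[OF big len])+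
  have S: "distinct (support ?T)" "set (support ?T) = carrier R"
    using support_facts[OF big] by auto
  have "result (eval_support c ?T v) = map (eval v) (support ?T)"
    using lv big h2 by (intro eval_support_correct[OF big] poly_set v) linarith
  hence rs_eq: "rs = filter (\<lambda>a. eval v a = \<zero>) (support ?T)"
    unfolding rs find_roots_def
    by (simp add: result_mapT comp_def zip_map2 zip_same_conv_map filter_map)
  hence dr: "distinct rs" and sr: "set rs \<subseteq> carrier R" and zr: "\<And>a. a \<in> set rs \<Longrightarrow> eval v a = \<zero>"
    using S by auto
  show "length rs \<le> h"
  proof (rule ccontr)
    assume "\<not> length rs \<le> h"
    hence "length v \<le> card (set rs)" using lv distinct_card[OF dr] by simp
    hence "v = []" using zero_poly_if_many_roots[OF v finite_set sr zr] by simp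
    thus False using lv by simp
  qed
qed

lemma \<pi>_linear_product_nonzero:
  assumes "finite S" "S \<subseteq> carrier R"
  shows "\<pi> (linear_product S) \<noteq> \<zero>\<^bsub>K\<^esub>"
  using assms
proof (induction S rule: finite_induct)
  case empty
  have "\<pi> \<one>\<^bsub>P\<^esub> \<noteq> \<zero>\<^bsub>K\<^esub>" unfolding \<pi>_one by (rule K.one_not_zero)
  thus ?case by (simp add: linear_product_def)
next
  case (insert a S)
  have a: "[\<one>, \<ominus> a] \<in> carrier P" using insert linear_poly by simp
  have S: "linear_product S \<in> carrier P" using insert linear_product_facts by simp
  have "\<pi> [\<one>, \<ominus> a] \<noteq> \<zero>\<^bsub>K\<^esub>"
  proof
    assume "\<pi> [\<one>, \<ominus> a] = \<zero>\<^bsub>K\<^esub>"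
    hence "\<pi> [\<one>, \<ominus> a] = \<pi> []" unfolding \<pi>_zero .
    hence "[\<one>, \<ominus> a] = []" using a h2 by (intro \<pi>_inj_short) auto
    thus False by simp
  qed
  moreover have "linear_product (insert a S) = [\<one>, \<ominus> a] \<otimes>\<^bsub>P\<^esub> linear_product S"
    unfolding linear_product_def using insert linear_poly by (intro P.finprod_insert) auto
  moreover have "\<pi> (linear_product S) \<noteq> \<zero>\<^bsub>K\<^esub>" using insert by simp
  ultimately show ?case
    using \<pi>_mult[OF a S] K.integral_iff[OF \<pi>_closed[OF a] \<pi>_closed[OF S]] by simp
qed

text \<open>
  The products over $B$ and over its complement multiply to the same polynomial for all $B$, so equal
  classes for the complements give equal classes for $B$ and $B'$. The latter products are monic of degree
  \<open>h\<close>, the degree of \<open>Q\<close>, and their difference is too short to be a nonzero multiple of \<open>Q\<close>.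
\<close>

lemma complement_product_inj:
  assumes B: "B \<subseteq> carrier R" "card B = h" "B' \<subseteq> carrier R" "card B' = h"
    and eq: "\<pi> (linear_product (carrier R - B)) = \<pi> (linear_product (carrier R - B'))"
  shows "B = B'"
proof -
  have fB: "finite B" "finite B'" using fin B finite_subset by auto
  note b = linear_product_facts[OF fB(1) B(1)] and b' = linear_product_facts[OF fB(2) B(3)]
  have a: "linear_product (carrier R - B) \<in> carrier P"
    "linear_product (carrier R - B') \<in> carrier P"
    using fin by (auto intro!: linear_product_facts(1))
  have "carrier R - B \<union> B = carrier R" "carrier R - B' \<union> B' = carrier R" using B by auto
  hence "linear_product (carrier R - B) \<otimes>\<^bsub>P\<^esub> linear_product B
    = linear_product (carrier R - B') \<otimes>\<^bsub>P\<^esub> linear_product B'"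
    using linear_product_disjoint[of "carrier R - B" B] linear_product_disjoint[of "carrier R - B'" B'] fin fB
    by (simp add: Diff_disjoint inf_commute)
  hence "\<pi> (linear_product (carrier R - B)) \<otimes>\<^bsub>K\<^esub> \<pi> (linear_product B)
    = \<pi> (linear_product (carrier R - B)) \<otimes>\<^bsub>K\<^esub> \<pi> (linear_product B')"
    unfolding \<pi>_mult[OF a(1) b(1), symmetric]
    unfolding eq \<pi>_mult[OF a(2) b'(1), symmetric] by (rule arg_cong)
  moreover have "\<pi> (linear_product (carrier R - B)) \<noteq> \<zero>\<^bsub>K\<^esub>"
    using fin by (intro \<pi>_linear_product_nonzero) auto
  ultimately have "\<pi> (linear_product B) = \<pi> (linear_product B')"
    by (subst (asm) K.m_lcancel[OF _ \<pi>_closed[OF a(1)] \<pi>_closed[OF b(1)] \<pi>_closed[OF b'(1)]])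
  hence "linear_product B pmod Q = linear_product B' pmod Q"
    using \<pi>_eq_iff[OF b(1) b'(1)] by simp
  hence "Q pdivides (linear_product B \<ominus>\<^bsub>P\<^esub> linear_product B')"
    using same_pmod_iff_pdivides[OF carrier_is_subfield b(1) b'(1) Q_poly] by simp
  hence z: "(linear_product B \<ominus>\<^bsub>P\<^esub> linear_product B') pmod Q = []"
    using pmod_zero_iff_pdivides[OF carrier_is_subfield P.minus_closed[OF b(1) b'(1)] Q_poly] by simp
  have "length (linear_product B \<ominus>\<^bsub>P\<^esub> linear_product B') \<le> h"
    using b b' B by (intro length_minus_monic) auto
  hence "linear_product B \<ominus>\<^bsub>P\<^esub> linear_product B' = []"
    using pmod_Q_short[OF P.minus_closed[OF b(1) b'(1)]] z by simp
  hence "linear_product B = linear_product B'"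
    using P.r_right_minus_eq[OF b(1) b'(1)] by (simp add: univ_poly_zero)
  hence "a \<in> B \<longleftrightarrow> a \<in> B'" if "a \<in> carrier R" for a
    using b(4)[OF that] b'(4)[OF that] by simp
  thus "B = B'" using B by auto
qed

lemma card_successes:
  assumes big: "order R \<ge> 4 * h"
  shows "order R choose h \<le> card {u \<in> {..<order R ^ h - 1}. result (trial c Q (result (precompute c Q)) u) \<noteq> None}"
    (is "_ \<le> card ?S")
proof -
  let ?B = "{B. B \<subseteq> carrier R \<and> card B = h}"
  have "\<exists>u. u < order R ^ h - 1 \<and> \<omega> [^]\<^bsub>K\<^esub> u = \<pi> (linear_product (carrier R - B))" for B
  proof -
    have "linear_product (carrier R - B) \<in> carrier P"
      using fin by (intro linear_product_facts(1)) auto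
    moreover have "\<pi> (linear_product (carrier R - B)) \<noteq> \<zero>\<^bsub>K\<^esub>"
      using fin by (intro \<pi>_linear_product_nonzero) auto
    ultimately show ?thesis using omega_powers \<pi>_closed by metis
  qed
  then obtain U where U: "\<And>B. U B < order R ^ h - 1"
    "\<And>B. \<omega> [^]\<^bsub>K\<^esub> U B = \<pi> (linear_product (carrier R - B))" by metis
  have inj: "inj_on U ?B"
  proof (rule inj_onI)
    fix B B' assume B: "B \<in> ?B" "B' \<in> ?B" "U B = U B'"
    hence "\<pi> (linear_product (carrier R - B)) = \<pi> (linear_product (carrier R - B'))"
      using U(2)[of B] U(2)[of B'] by simp
    thus "B = B'" using B by (intro complement_product_inj) auto
  qed
  have "U ` ?B \<subseteq> ?S"
    using U trial_success[OF big, where c=c] by fastforce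
  hence "card (U ` ?B) \<le> card ?S" by (intro card_mono) auto
  thus ?thesis
    using card_image[OF inj] n_subsets[OF fin, of h] by (simp add: order_def)
qed

end

section \<open>Repeating a trial until enough of them succeed\<close>

text \<open>
  An abstract form of the search: the number of successes found in the first rounds of a run that stops
  counting at \<open>n\<close>.
\<close>

primrec successes :: "('b \<Rightarrow> bool) \<Rightarrow> nat \<Rightarrow> (nat \<Rightarrow> 'b) \<Rightarrow> nat \<Rightarrow> nat" where
  "successes s n \<omega> 0 = 0"
| "successes s n \<omega> (Suc i) =
     (if successes s n \<omega> i < n \<and> s (\<omega> i) then Suc (successes s n \<omega> i) else successes s n \<omega> i)"

lemma successes_le: "successes s n \<omega> i \<le> n"
  by (induction i) auto

lemma successes_cong:
  "(\<And>j. j < i \<Longrightarrow> \<omega> j = \<omega>' j) \<Longrightarrow> successes s n \<omega> i = successes s n \<omega>' i"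
  by (induction i) auto

lemma successes_eq_sum:
  "(\<Sum>j<i. if successes s n \<omega> j < n \<and> s (\<omega> j) then 1 else 0) = successes s n \<omega> i"
  by (induction i) auto

text \<open>
  The number of rounds that are carried out, as a sum of indicators; it is infinite if \<open>n\<close> successes
  never occur.
\<close>

definition rounds :: "('b \<Rightarrow> bool) \<Rightarrow> nat \<Rightarrow> (nat \<Rightarrow> 'b) \<Rightarrow> ennreal" where
  "rounds s n \<omega> = (\<Sum>i. if successes s n \<omega> i < n then 1 else 0)"

lemma rounds_eq_Least:
  assumes "successes s n \<omega> m = n"
  shows "rounds s n \<omega> = of_nat (LEAST i. successes s n \<omega> i = n)"
proof -
  let ?L = "LEAST i. successes s n \<omega> i = n"
  have L: "successes s n \<omega> ?L = n" by (rule LeastI[of "\<lambda>i. successes s n \<omega> i = n" m, OF assms])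
  have mono: "successes s n \<omega> i \<le> successes s n \<omega> j" if "i \<le> j" for i j
    using that by (induction j rule: dec_induct) auto
  have less: "successes s n \<omega> i < n \<longleftrightarrow> i < ?L" for i
  proof
    assume "successes s n \<omega> i < n"
    thus "i < ?L" using mono[of ?L i] L by (simp add: not_less[symmetric]) (metis leD not_less)
  next
    assume "i < ?L"
    hence "successes s n \<omega> i \<noteq> n" by (rule not_less_Least)
    thus "successes s n \<omega> i < n" using successes_le[of s n \<omega> i] by simp
  qed
  have "rounds s n \<omega> = (\<Sum>i\<in>{..<?L}. if successes s n \<omega> i < n then 1 else 0)"
    unfolding rounds_def by (rule suminf_finite) (auto simp: less)
  also have "\<dots> = (\<Sum>i\<in>{..<?L}. 1)" by (intro sum.cong) (auto simp: less)
  finally show ?thesis by simp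
qed

lemma rounds_infinite:
  assumes "\<And>i. successes s n \<omega> i \<noteq> n"
  shows "rounds s n \<omega> = \<infinity>"
proof -
  have "successes s n \<omega> i < n" for i using assms[of i] successes_le[of s n \<omega> i] by simp
  hence "rounds s n \<omega> = (\<Sum>i. (1::ennreal))" by (simp add: rounds_def)
  also have "\<dots> = \<infinity>"
  proof (rule ccontr)
    assume fin: "\<not> ?thesis"
    have b: "of_nat k \<le> (\<Sum>i. (1::ennreal))" for k
      using sum_le_suminf[of "\<lambda>_. 1::ennreal" "{..<k}"] by simp
    from fin obtain m :: nat where "(\<Sum>i. (1::ennreal)) < of_nat m"
      using ennreal_Ex_less_of_nat less_top infinity_ennreal_def by metis
    thus False using b[of m] by simp
  qed
  finally show ?thesis .
qed

text \<open>
  Wald's identity. The event $A_i$ that round $i$ is carried out depends on the earlier draws, the event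
  $B_i$ that draw $i$ is a success only on that draw. Summing $P(A_i \cap B_i) = P(A_i) \, p$ over $i$ gives
  $p$ times the expected number of rounds on one side and the expected number of counted successes on
  the other.
\<close>

lemma expected_rounds:
  fixes p :: "'b pmf" and n :: nat
  shows "emeasure (measure_pmf p) {u. s u} *
      (\<integral>\<^sup>+ \<omega>. rounds s n \<omega> \<partial>(\<Pi>\<^sub>M i\<in>UNIV. measure_pmf p)) \<le> of_nat n"
    and "rounds s n \<in> borel_measurable (\<Pi>\<^sub>M i\<in>(UNIV::nat set). measure_pmf p)"
proof -
  interpret sequence_space "measure_pmf p"
    by (intro sequence_space.intro product_prob_spaceI measure_pmf.prob_space_axioms)
  have spS: "space S = UNIV" by (simp add: space_PiM PiE_def extensional_def)
  have spSS: "space (S \<Otimes>\<^sub>M S) = UNIV" by (simp add: space_pair_measure spS)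
  have s_meas: "(\<lambda>\<omega>. s (\<omega> i)) \<in> measurable S (count_space UNIV)" for i
    by (rule measurable_compose[OF measurable_component_singleton]) auto
  have succ_meas: "(\<lambda>\<omega>. successes s n \<omega> i) \<in> measurable S (count_space UNIV)" for i
  proof (induction i)
    case (Suc i)
    note [measurable] = Suc s_meas[of i]
    show ?case by simp
  qed simp
  define A where "A i = {\<omega>. successes s n \<omega> i < n}" for i
  define B where "B i = {\<omega> :: nat \<Rightarrow> 'b. s (\<omega> i)}" for i
  have A: "A i \<in> sets S" for i
  proof -
    note [measurable] = succ_meas[of i]
    have "{\<omega> \<in> space S. successes s n \<omega> i < n} \<in> sets S" by measurable
    thus ?thesis by (simp add: A_def spS)
  qed
  have B: "B i \<in> sets S" for i
  proof -
    note [measurable] = s_meas[of i]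
    have "{\<omega> \<in> space S. s (\<omega> i)} \<in> sets S" by measurable
    thus ?thesis by (simp add: B_def spS)
  qed
  have r_ind: "rounds s n \<omega> = (\<Sum>i. indicator (A i) \<omega>)" for \<omega>
    unfolding rounds_def by (intro suminf_cong) (auto simp: A_def indicator_def)
  note [measurable] = A
  have "(\<lambda>\<omega>. \<Sum>i. indicator (A i) \<omega> :: ennreal) \<in> borel_measurable S" by measurable
  thus "rounds s n \<in> borel_measurable S" by (simp add: r_ind[abs_def] cong: measurable_cong)
  let ?p = "emeasure (measure_pmf p) {u. s u}"
  have B0: "emeasure S (B 0) = ?p"
    using emeasure_PiM_Collect_single[of 0 "{u. s u}"] by (simp add: B_def spS)
  have indep: "emeasure S (A i \<inter> B i) = emeasure S (A i) * ?p" for i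
  proof -
    let ?f = "\<lambda>(\<omega>, \<omega>'). comb_seq i \<omega> \<omega>'"
    \<comment> \<open>the sequence is cut at position \<open>i\<close>: its beginning decides \<open>A i\<close>, its rest decides \<open>B i\<close>\<close>
    have "emeasure S (A i \<inter> B i) = emeasure (distr (S \<Otimes>\<^sub>M S) S ?f) (A i \<inter> B i)"
      by (simp add: PiM_comb_seq)
    also have "\<dots> = emeasure (S \<Otimes>\<^sub>M S) (?f -` (A i \<inter> B i) \<inter> space (S \<Otimes>\<^sub>M S))"
      using A B by (intro emeasure_distr measurable_comb_seq) auto
    also have "?f -` (A i \<inter> B i) \<inter> space (S \<Otimes>\<^sub>M S) = A i \<times> B 0"
    proof -
      have "successes s n (comb_seq i \<omega> \<omega>') i = successes s n \<omega> i" for \<omega> \<omega>'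
        by (rule successes_cong) (simp add: comb_seq_def)
      thus ?thesis unfolding spSS by (auto simp: A_def B_def comb_seq_def)
    qed
    also have "emeasure (S \<Otimes>\<^sub>M S) (A i \<times> B 0) = emeasure S (A i) * emeasure S (B 0)"
      using A B by (intro P.emeasure_pair_measure_Times) auto
    finally show ?thesis by (simp add: B0)
  qed
  have "?p * (\<integral>\<^sup>+ \<omega>. rounds s n \<omega> \<partial>S) = ?p * (\<Sum>i. emeasure S (A i))"
    unfolding r_ind using A by (subst nn_integral_suminf) auto
  also have "\<dots> = (\<Sum>i. ?p * emeasure S (A i))" by (rule ennreal_suminf_cmult[symmetric])
  also have "\<dots> = (\<Sum>i. emeasure S (A i \<inter> B i))" by (simp add: indep mult.commute)
  also have "\<dots> = (\<integral>\<^sup>+ \<omega>. (\<Sum>i. indicator (A i \<inter> B i) \<omega>) \<partial>S)"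
    using A B by (subst nn_integral_suminf) auto
  also have "\<dots> \<le> (\<integral>\<^sup>+ \<omega>. of_nat n \<partial>S)"
  proof (rule nn_integral_mono)
    fix \<omega>
    show "(\<Sum>i. indicator (A i \<inter> B i) \<omega> :: ennreal) \<le> of_nat n"
    proof (rule suminf_le_const)
      fix k
      have "(\<Sum>i<k. indicator (A i \<inter> B i) \<omega> :: ennreal)
        = of_nat (\<Sum>i<k. if successes s n \<omega> i < n \<and> s (\<omega> i) then 1 else 0)"
        unfolding of_nat_sum by (intro sum.cong) (auto simp: A_def B_def indicator_def)
      also have "\<dots> = of_nat (successes s n \<omega> k)" by (simp only: successes_eq_sum)
      also have "\<dots> \<le> of_nat n" using successes_le[of s n \<omega> k] by simp
      finally show "(\<Sum>i<k. indicator (A i \<inter> B i) \<omega> :: ennreal) \<le> of_nat n" .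
    qed simp
  qed
  also have "\<dots> = of_nat n"
    using P.emeasure_space_1 by (simp add: nn_integral_const)
  finally show "?p * (\<integral>\<^sup>+ \<omega>. rounds s n \<omega> \<partial>S) \<le> of_nat n" .
qed

lemma AE_random_tape:
  fixes N :: nat
  assumes "N > 0"
  shows "AE \<omega> in (\<Pi>\<^sub>M i\<in>(UNIV::nat set). measure_pmf (pmf_of_set {..<N})). \<forall>i. \<omega> i < N"
proof -
  have "set_pmf (pmf_of_set {..<N}) = {..<N}"
    using assms by (intro set_pmf_of_set) auto
  hence "AE u in measure_pmf (pmf_of_set {..<N}). u < N"
    by (simp add: AE_measure_pmf_iff)
  hence "AE \<omega> in (\<Pi>\<^sub>M i\<in>(UNIV::nat set). measure_pmf (pmf_of_set {..<N})). \<omega> i < N" for i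
    by (intro AE_PiM_component measure_pmf.prob_space_axioms) auto
  thus ?thesis by (subst AE_all_countable) simp
qed

section \<open>Cost of the search for relations\<close>

context field
begin

lemma ops_powmod: "e < 2 ^ n \<Longrightarrow> ops (powmod c d p e) \<le> 2 * n * mulmod_ops c (degree d)"
proof (induction n arbitrary: e)
  case 0
  thus ?case by (simp add: powmod.simps[of c d p 0])
next
  case (Suc n)
  show ?case
  proof (cases "e = 0")
    case True
    thus ?thesis by (simp add: powmod.simps[of c d p 0])
  next
    case False
    have "e div 2 < 2 ^ n" using Suc.prems by (simp add: div_less_iff_less_mult)
    from Suc.IH[OF this] show ?thesis
      using False by (simp add: powmod.simps[of c d p e] pmulmod_def)
  qed
qed

text \<open>
  The costs depend on the lengths of the tables only, not on what they contain.
\<close>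

definition small_tables :: "'a tables \<Rightarrow> bool" where
  "small_tables T \<longleftrightarrow> length (support T) \<le> order R \<and> length (chirp T) \<le> 2 * order R \<and>
     length (chirp_inv T) \<le> order R - 1"

lemma ops_dft:
  assumes T: "small_tables T" and W: "\<And>n. n \<le> 2 * order R \<Longrightarrow> mult_ops c n \<le> W"
  shows "ops (dft c T p) \<le> 2 * (order R - 1) + W" "length (result (dft c T p)) \<le> order R - 1"
proof -
  define s where "s = result (mapT (\<lambda>(x, t). fmul x t) (zip p (chirp_inv T)))"
  have ls: "length s \<le> order R - 1" using T by (simp add: s_def result_mapT small_tables_def min.coboundedI2)
  have o1: "ops (mapT (\<lambda>(x, t). fmul x t) (zip p (chirp_inv T))) \<le> order R - 1"
    using T by (subst ops_mapT_const[of _ 1]) (auto simp: small_tables_def min.coboundedI2)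
  have o3: "ops (mapT (\<lambda>(j, t). fmul (coeff r (order R - 2 + j)) t) (zip [0..<order R - 1] (chirp_inv T)))
     \<le> order R - 1" for r
    using T by (subst ops_mapT_const[of _ 1]) (auto simp: small_tables_def min.coboundedI2)
  have "length (normalize s) \<le> 2 * order R" "length (normalize (rev (chirp T))) \<le> 2 * order R"
    using normalize_length_le[of s] normalize_length_le[of "rev (chirp T)"] ls T
    by (auto simp: small_tables_def)
  hence o2: "ops (pmul c (normalize s) (normalize (rev (chirp T)))) \<le> W"
    unfolding pmul_def timed.sel by (intro W) auto
  show "ops (dft c T p) \<le> 2 * (order R - 1) + W"
    unfolding dft_def ops_bind s_def[symmetric]
    using o1 o2 o3[of "result (pmul c (normalize s) (normalize (rev (chirp T))))"] by linarith
  show "length (result (dft c T p)) \<le> order R - 1"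
    by (simp add: dft_def result_mapT)
qed

lemma ops_eval_support:
  assumes "small_tables T" "\<And>n. n \<le> 2 * order R \<Longrightarrow> mult_ops c n \<le> W"
  shows "ops (eval_support c T p) \<le> 2 * order R + W" "length (result (eval_support c T p)) \<le> order R - 1 + 1"
  using ops_dft[OF assms, of "map (coeff p) [0..<order R - 1]"]
  by (auto simp: eval_support_def)

lemma ops_interpolate:
  assumes "small_tables T" "\<And>n. n \<le> 2 * order R \<Longrightarrow> mult_ops c n \<le> W" "order R \<ge> 1"
  shows "ops (interpolate c T y) \<le> 3 * order R + W"
proof -
  let ?d = "result (dft c T (tl y))"
  have "ops (mapT fneg ?d) = length ?d" by (subst ops_mapT_const[of _ 1]) auto
  thus ?thesis
    using ops_dft[OF assms(1,2), of "tl y"] assms(3) by (simp add: interpolate_def)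
qed

lemma ops_find_roots:
  assumes "small_tables T" "\<And>n. n \<le> 2 * order R \<Longrightarrow> mult_ops c n \<le> W" "order R \<ge> 1"
  shows "ops (find_roots c T v) \<le> 3 * order R + W"
proof -
  let ?d = "result (eval_support c T v)"
  have "ops (mapT fzero ?d) = length ?d" by (subst ops_mapT_const[of _ 1]) auto
  thus ?thesis
    using ops_eval_support[OF assms(1,2), of v] assms(3) by (simp add: find_roots_def)
qed

lemma ops_received_word: "ops (received_word T fs) \<le> 3 * length fs"
proof -
  have "ops (received_word T fs) = 3 * length (zip fs (zip (qinv T) (xk T)))"
    unfolding received_word_def by (rule ops_mapT_const) (auto split: prod.splits)
  thus ?thesis by simp
qed

lemma ops_make_monic: "ops (make_monic v) = 1 + length v" "length (result (make_monic v)) = length v"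
  by (simp_all add: make_monic_def result_mapT ops_mapT_const[of _ 1])

end

context primitive_modulus
begin

lemma small_tables_precompute:
  assumes "order R \<ge> 4 * h"
  shows "small_tables (result (precompute c Q))"
  using precompute_tables(1)[OF assms, where c=c] support_facts(3)[OF assms, where c=c]
  by (simp add: small_tables_def field_tables_def chirp_tables_def)

text \<open>
  \<open>W\<close> bounds the cost of a product of polynomials of degree at most \<open>2 * order R\<close>, and \<open>L\<close> the
  number of binary digits of the exponents. The last hypothesis, which holds for fixed \<open>h\<close> and large
  fields, absorbs the two modular powers and the Euclidean algorithm into one term \<open>order R\<close>; this
  keeps \<open>h\<close> out of the bound.
\<close>

lemma ops_trial:
  assumes big: "order R \<ge> 4 * h" and u: "u < order R ^ h - 1"
    and W: "\<And>n. n \<le> 2 * order R \<Longrightarrow> mult_ops c n \<le> W"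
    and L: "order R ^ h < 2 ^ L" and few: "4 * L * mulmod_ops c h + xgcd_ops c (2 * h) \<le> order R"
  shows "ops (trial c Q (result (precompute c Q)) u) \<le> 14 * order R + 3 * W"
proof -
  define T where "T = result (precompute c Q)"
  define q where "q = order R"
  define v where "v = locator c (residue u)"
  have T: "small_tables T" unfolding T_def by (rule small_tables_precompute[OF big])
  have q1: "order R \<ge> 1" using order_q by simp
  have f: "result (powmod c Q X u) = residue u"
    using result_powmod[OF Q_poly Q_length_ge X_poly] by (simp add: residue_def)
  have w: "result (interpolate c T (result (received_word T (result (eval_support c T (residue u))))))
    = word_poly c (residue u)"
    unfolding T_def by (rule trial_word[OF big])
  have l: "result (partial_xgcd c ((monom \<one> (order R) \<ominus>\<^bsub>P\<^esub> X) pdiv monom \<one> (order R - 2 * h))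
     (word_poly c (residue u) pdiv monom \<one> (order R - 2 * h)) h) = v"
    by (simp add: locator_def Let_def v_def)
  have qh: "order R \<le> order R ^ h" using order_q h2 by (intro self_le_power) auto
  have o1: "ops (powmod c Q X u) \<le> 2 * L * mulmod_ops c h"
    using ops_powmod[of u L c Q X] u L degQ by simp
  have o2: "ops (eval_support c T (residue u)) \<le> 2 * q + W"
    unfolding q_def by (rule ops_eval_support(1)[OF T W])
  have "length (result (eval_support c T (residue u))) \<le> q"
    using ops_eval_support(2)[OF T W, of "residue u"] q1 by (simp add: q_def)
  hence o3: "ops (received_word T (result (eval_support c T (residue u)))) \<le> 3 * q"
    using ops_received_word[of T "result (eval_support c T (residue u))"] by linarith
  have o4: "ops (interpolate c T (result (received_word T (result (eval_support c T (residue u)))))) \<le> 3 * q + W"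
    unfolding q_def by (rule ops_interpolate[OF T W q1])
  have "degree ((monom \<one> (order R) \<ominus>\<^bsub>P\<^esub> X) pdiv monom \<one> (order R - 2 * h)) = 2 * h"
    using locator_input(6)[OF big residue_facts(1)[of u]] by simp
  hence o5: "ops (partial_xgcd c ((monom \<one> (order R) \<ominus>\<^bsub>P\<^esub> X) pdiv monom \<one> (order R - 2 * h))
     (word_poly c (residue u) pdiv monom \<one> (order R - 2 * h)) h) = xgcd_ops c (2 * h)"
    by (simp add: partial_xgcd_def Let_def)
  have o6: "ops (if degree v \<noteq> h then ret None
     else do {
       v \<leftarrow> make_monic v;
       w \<leftarrow> powmod c v X (order R);
       b \<leftarrow> peq w X;
       if b then do { rs \<leftarrow> find_roots c T v; ret (Some (u, rs)) }
       else ret None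
     }) \<le> (h + 2) + 2 * L * mulmod_ops c h + (h + 2) + (3 * q + W)" (is "ops ?rest \<le> _")
  proof (cases "degree v = h")
    case True
    hence lv: "length (locator c (residue u)) = h + 1" using h2 by (simp add: v_def)
    define m where "m = result (make_monic v)"
    have m: "m \<in> carrier P" "length m = h + 1"
      unfolding m_def v_def by (rule monic_locator_poly[OF big lv])+
    define w where "w = result (powmod c m X (order R))"
    have p1: "ops (make_monic v) = h + 2" using lv by (simp add: ops_make_monic v_def)
    have p2: "ops (powmod c m X (order R)) \<le> 2 * L * mulmod_ops c h"
      using ops_powmod[of "order R" L c m X] qh L m by simp
    have "length w \<le> h"
      using m h2 X_poly var_pow_closed[OF carrier_is_subring, of "order R"]
        result_powmod[of m X c "order R"] length_pmod[of "X [^]\<^bsub>P\<^esub> order R" m]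
      by (auto simp: w_def)
    hence p3: "ops (peq w X) \<le> h + 2" by (simp add: peq_def X_length)
    have p4: "ops (find_roots c T m) \<le> 3 * q + W"
      unfolding q_def by (rule ops_find_roots[OF T W q1])
    have "ops ?rest = ops (make_monic v) + (ops (powmod c m X (order R)) + (ops (peq w X) +
      ops (if result (peq w X) then do { rs \<leftarrow> find_roots c T m; ret (Some (u, rs)) } else ret None)))"
      using True by (simp add: m_def w_def)
    also have "ops (if result (peq w X) then do { rs \<leftarrow> find_roots c T m; ret (Some (u, rs)) } else ret None)
      \<le> 3 * q + W"
      using p4 by simp
    finally show ?thesis using p1 p2 p3 by linarith
  qed simp
  have "ops (trial c Q T u) = ops (powmod c Q X u) + (ops (eval_support c T (residue u)) +
     (ops (received_word T (result (eval_support c T (residue u)))) +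
     (ops (interpolate c T (result (received_word T (result (eval_support c T (residue u)))))) +
     (ops (partial_xgcd c ((monom \<one> (order R) \<ominus>\<^bsub>P\<^esub> X) pdiv monom \<one> (order R - 2 * h))
       (word_poly c (residue u) pdiv monom \<one> (order R - 2 * h)) h) + ops ?rest))))"
    unfolding trial_def Let_def degQ ops_bind f w l ..
  also have "\<dots> \<le> 2 * L * mulmod_ops c h + (2 * q + W) + 3 * q + (3 * q + W) + xgcd_ops c (2 * h)
      + ((h + 2) + 2 * L * mulmod_ops c h + (h + 2) + (3 * q + W))"
    using o1 o2 o3 o4 o5 o6 by linarith
  also have "\<dots> \<le> 14 * q + 3 * W"
    using few big h2 unfolding q_def[symmetric] by linarith
  finally show ?thesis by (simp add: T_def q_def)
qed

lemma ops_precompute: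
  assumes big: "order R \<ge> 4 * h"
    and W: "\<And>n. n \<le> 2 * order R \<Longrightarrow> mult_ops c n \<le> W"
    and L: "order R ^ h < 2 ^ L" and few: "4 * L * mulmod_ops c h + xgcd_ops c (2 * h) \<le> order R"
  shows "ops (precompute c Q) \<le> 11 * order R + W"
proof -
  let ?q = "order R"
  have "(?q ^ h - 1) div (?q - 1) \<le> ?q ^ h - 1" by (rule div_le_dividend)
  hence "(?q ^ h - 1) div (?q - 1) < 2 ^ L" using L by linarith
  hence o1: "ops (powmod c Q X ((?q ^ h - 1) div (?q - 1))) \<le> 2 * L * mulmod_ops c h"
    using ops_powmod[of _ L c Q X] degQ by simp
  define ts where "ts = fst (result (chirps gen (2 * ?q - 3)))"
  have lts: "length ts = 2 * ?q - 3" by (simp add: ts_def length_chirps)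
  have w: "coeff (result (powmod c Q X ((?q ^ h - 1) div (?q - 1)))) 0 = gen"
    using result_powmod[OF Q_poly Q_length_ge X_poly] by (simp add: gen_def norm_exponent_def)
  define gs where "gs = fst (result (powers gen (?q - 1)))"
  have lgs: "length gs = ?q - 1" by (simp add: gs_def length_powers)
  define T0 where "T0 = \<lparr> support = \<zero> # gs,
     xk = \<zero> [^] (?q - 2 * h) # fst (result (powers (gs ! (?q - 2 * h)) (?q - 1))), qinv = [],
     chirp = ts, chirp_inv = result (mapT finv (take (?q - 1) ts)) \<rparr>"
  have T0: "small_tables T0"
    using lts lgs order_q by (simp add: small_tables_def T0_def result_mapT)
  have o2: "ops (mapT finv (take (?q - 1) ts)) \<le> ?q"
    by (subst ops_mapT_const[of _ 1]) auto
  have o3: "ops (eval_support c T0 Q) \<le> 2 * ?q + W" by (rule ops_eval_support(1)[OF T0 W])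
  have o4: "ops (mapT finv (result (eval_support c T0 Q))) \<le> ?q"
    using ops_eval_support(2)[OF T0 W, of Q] order_q by (subst ops_mapT_const[of _ 1]) auto
  have "ops (precompute c Q) = ops (powmod c Q X ((?q ^ h - 1) div (?q - 1))) +
    (ops (powers gen (?q - 1)) + (ops (powers (gs ! (?q - 2 * h)) (?q - 1)) + (ops (chirps gen (2 * ?q - 3)) +
    (ops (mapT finv (take (?q - 1) ts)) + (ops (eval_support c T0 Q) +
      ops (mapT finv (result (eval_support c T0 Q))))))))"
    unfolding precompute_def Let_def degQ ops_bind w case_prod_beta gs_def[symmetric] ts_def[symmetric]
      T0_def[symmetric] by simp
  thus ?thesis
    unfolding ops_powers ops_chirps using o1 o2 o3 o4 few by linarith
qed

lemma ops_search:
  assumes "\<And>j. ops (trial c Q T (tape j)) \<le> k"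
  shows "ops (search c Q T tape i) \<le> i * k"
proof (induction i)
  case (Suc i)
  have "ops (search c Q T tape (Suc i)) \<le> ops (search c Q T tape i) + ops (trial c Q T (tape i))"
    by simp
  thus ?case using Suc assms[of i] by simp
qed simp

text \<open>
  The link between the algorithm and the abstract repetition of trials.
\<close>

lemma length_search:
  "length (result (search c Q T tape i))
    = successes (\<lambda>u. result (trial c Q T u) \<noteq> None) (order R) tape i"
proof (induction i)
  case (Suc i)
  show ?case using Suc by (auto split: option.splits)
qed simp

lemma search_relations:
  assumes big: "order R \<ge> 4 * h"
    and "(u, rs) \<in> set (result (search c Q (result (precompute c Q)) tape i))"
  shows "u \<in> range tape" "length rs \<le> h"
proof -
  have "u \<in> range tape \<and> length rs \<le> h"
    using assms(2)
  proof (induction i)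
    case (Suc i)
    show ?case
    proof (cases "(u, rs) \<in> set (result (search c Q (result (precompute c Q)) tape i))")
      case False
      hence "result (trial c Q (result (precompute c Q)) (tape i)) = Some (u, rs)"
        using Suc.prems by (auto split: if_splits option.splits)
      from trial_relation[OF big this] show ?thesis by auto
    qed (use Suc in auto)
  qed simp
  thus "u \<in> range tape" "length rs \<le> h" by auto
qed

end

section \<open>Binomial coefficients, powers of two and logarithms\<close>

text \<open>
  $k! {n \choose k}$ is the product of the $n - i$ with $i < k$, hence at least $(n-k)^k$, and Bernoulli's
  inequality bounds $(1 - k/n)^k$ from below by $1 - k^2/n$.
\<close>

lemma power_le_choose:
  fixes n k :: nat
  assumes "k \<ge> 1" "2 * k\<^sup>2 \<le> n"
  shows "real n ^ k \<le> 2 * fact k * real (n choose k)"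
proof -
  have "k \<le> 2 * k\<^sup>2" by (simp add: power2_eq_square)
  hence kn: "k \<le> n" and n0: "n > 0" using assms by linarith+
  have "2 * (real k * real k) \<le> real n"
    using assms(2) unfolding power2_eq_square
    by (metis of_nat_le_iff of_nat_mult of_nat_numeral)
  hence "real k * (real k / real n) \<le> 1 / 2" using n0 by (simp add: field_simps)
  hence "1 / 2 \<le> 1 + real k * (- (real k / real n))" by simp
  also have "\<dots> \<le> (1 + - (real k / real n)) ^ k"
    using kn n0 by (intro Bernoulli_inequality) simp
  finally have "real n ^ k * (1 / 2) \<le> real n ^ k * (1 + - (real k / real n)) ^ k"
    by (intro mult_left_mono) auto
  also have "\<dots> = (\<Prod>i = 0..<k. real n - real k)"
  proof -
    have "real n * (1 + - (real k / real n)) = real n - real k" using n0 by (simp add: field_simps)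
    thus ?thesis by (simp flip: power_mult_distrib)
  qed
  also have "\<dots> \<le> (\<Prod>i = 0..<k. real n - real i)"
    using kn by (intro prod_mono) auto
  also have "\<dots> = fact k * (real n gchoose k)" by (rule gbinomial_mult_fact[symmetric])
  also have "\<dots> = fact k * real (n choose k)" by (simp add: binomial_gbinomial)
  finally show ?thesis by simp
qed

lemma square_le_two_fact: "h\<^sup>2 \<le> 2 * (fact h :: nat)"
proof (induction h)
  case (Suc h)
  show ?case
  proof (cases "h \<le> 2")
    case True
    hence "h = 0 \<or> h = 1 \<or> h = 2" by auto
    thus ?thesis by (auto simp: fact_numeral numeral_2_eq_2)
  next
    case False
    hence "2 * h \<le> h\<^sup>2" by (simp add: power2_eq_square)
    hence "Suc h \<le> h\<^sup>2" using False by linarith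
    hence "(Suc h)\<^sup>2 \<le> Suc h * h\<^sup>2" by (simp only: power2_eq_square mult_le_mono2)
    also have "\<dots> \<le> Suc h * (2 * fact h)" using Suc by (rule mult_le_mono2)
    finally show ?thesis by simp
  qed
qed simp

text \<open>
  Applied with the integer part of the binary logarithm of $q$ as \<open>m\<close>, this makes logarithmic costs
  negligible against $q$.
\<close>

lemma linear_le_power_of_two: "\<exists>m0. \<forall>m\<ge>m0. a * (m + 1) + b \<le> (2::nat) ^ m"
proof -
  define s where "s = a + b"
  have s: "a \<le> s" "b \<le> s" by (auto simp: s_def)
  have s3: "s + 1 \<le> 2 ^ s" using less_exp[of s] by (simp add: Suc_le_eq)
  have "a * (m + 1) + b \<le> 2 ^ m" if "m \<ge> 3 * s" for m
    using that
  proof (induction m rule: dec_induct)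
    case base
    have "a * (3 * s + 1) + b \<le> s * (3 * s + 1) + s" using s by (intro add_mono mult_le_mono1)
    also have "\<dots> \<le> (s + 1) ^ 3" by (simp add: power3_eq_cube algebra_simps)
    also have "\<dots> \<le> (2 ^ s) ^ 3" using s3 by (rule power_mono) simp
    also have "\<dots> = 2 ^ (3 * s)" by (simp add: power_mult[symmetric] mult.commute)
    finally show ?case .
  next
    case (step m)
    have "s \<le> m" using step.hyps by simp
    hence "(2::nat) ^ s \<le> 2 ^ m" by (rule power_increasing) simp
    hence "a \<le> 2 ^ m" using s s3 by linarith
    thus ?case using step.IH by simp
  qed
  thus ?thesis by blast
qed

lemma bitlen_le_log:
  assumes "x \<le> 2 powr y" "y \<ge> 0"
  shows "real_of_int (bitlen x) \<le> y + 1"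
proof (cases "x > 0")
  case True
  have "log 2 (real_of_int x) \<le> y" using True assms by (simp add: log_le_iff)
  hence "real_of_int \<lfloor>log 2 (real_of_int x)\<rfloor> \<le> y" by linarith
  thus ?thesis using True by (simp add: bitlen_alt_def)
qed (use assms in \<open>simp add: bitlen_alt_def\<close>)

section \<open>Running time and storage\<close>

context primitive_modulus
begin

text \<open>
  If the search does not terminate, both sides are infinite.
\<close>

lemma running_time_le:
  fixes c :: op_counts
  assumes big: "order R \<ge> 4 * h" and tape: "\<And>i. tape i < order R ^ h - 1"
    and W: "\<And>n. n \<le> 2 * order R \<Longrightarrow> mult_ops c n \<le> W"
    and L: "order R ^ h < 2 ^ L" and few: "4 * L * mulmod_ops c h + xgcd_ops c (2 * h) \<le> order R"
  defines "s \<equiv> (\<lambda>u. result (trial c Q (result (precompute c Q)) u) \<noteq> None)"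
  shows "running_time c Q tape \<le> of_nat (11 * order R + W + sparse_ops c h (order R) * mult_ops c h)
      + of_nat (14 * order R + 3 * W) * rounds s (order R) tape"
proof -
  let ?T = "result (precompute c Q)"
  have finished: "length (result (search c Q ?T tape i)) = order R \<longleftrightarrow> successes s (order R) tape i = order R" for i
    by (simp add: length_search s_def)
  show ?thesis
  proof (cases "\<exists>i. successes s (order R) tape i = order R")
    case False
    hence "rounds s (order R) tape = \<infinity>" by (intro rounds_infinite) auto
    moreover have "of_nat (14 * order R + 3 * W) > (0::ennreal)"
      unfolding of_nat_0_less_iff using order_q by linarith
    ultimately have "of_nat (14 * order R + 3 * W) * rounds s (order R) tape = \<infinity>"
      using order_q by (auto simp: ennreal_mult_top)
    thus ?thesis by simp
  next
    case True
    let ?N = "LEAST i. successes s (order R) tape i = order R"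
    have N: "rounds s (order R) tape = of_nat ?N" using True rounds_eq_Least by blast
    have "ops (search c Q ?T tape ?N) \<le> ?N * (14 * order R + 3 * W)"
      by (intro ops_search ops_trial[OF big tape W L few])
    hence le: "ops (precompute c Q) + (ops (search c Q ?T tape ?N)
       + ops (solve_logs c h (result (search c Q ?T tape ?N))))
      \<le> (11 * order R + W + sparse_ops c h (order R) * mult_ops c h) + (14 * order R + 3 * W) * ?N"
      using ops_precompute[OF big W L few] by (simp add: solve_logs_def mult.commute)
    have "running_time c Q tape = of_nat (ops (precompute c Q) + (ops (search c Q ?T tape ?N)
       + ops (solve_logs c h (result (search c Q ?T tape ?N)))))"
      unfolding running_time_def RSDL_FQ_def Let_def finished degQ using True by simp
    also have "\<dots> \<le> of_nat ((11 * order R + W + sparse_ops c h (order R) * mult_ops c h) + (14 * order R + 3 * W) * ?N)"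
      using le by (rule of_nat_mono)
    also have "\<dots> = of_nat (11 * order R + W + sparse_ops c h (order R) * mult_ops c h)
      + of_nat (14 * order R + 3 * W) * rounds s (order R) tape"
      unfolding N by (simp only: of_nat_add of_nat_mult)
    finally show ?thesis .
  qed
qed

lemma tapes_pos: "order R ^ h - 1 > 0"
  using order_q h2 one_less_power[of "order R" h] by simp

lemma expected_rounds_le:
  fixes c :: op_counts
  assumes big: "order R \<ge> 4 * h" "order R \<ge> 2 * h\<^sup>2"
  defines "s \<equiv> (\<lambda>u. result (trial c Q (result (precompute c Q)) u) \<noteq> None)"
  shows "(\<integral>\<^sup>+ tape. rounds s (order R) tape \<partial>random_tapes h) \<le> of_nat (2 * fact h * order R)"
    "rounds s (order R) \<in> borel_measurable (random_tapes h)"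
proof -
  let ?N = "order R ^ h - 1"
  let ?p = "pmf_of_set {..<?N}"
  let ?E = "\<integral>\<^sup>+ tape. rounds s (order R) tape \<partial>random_tapes h"
  have ne: "{..<?N} \<noteq> {}" using tapes_pos by (metis empty_iff lessThan_iff)
  have "emeasure (measure_pmf ?p) {u. s u} = ennreal (real (card ({..<?N} \<inter> {u. s u})) / real ?N)"
    using emeasure_pmf_of_set[OF ne, of "{u. s u}"] by simp
  also have "\<dots> \<ge> ennreal (1 / (2 * fact h))"
  proof (rule ennreal_leI)
    have "{..<?N} \<inter> {u. s u} = {u \<in> {..<?N}. result (trial c Q (result (precompute c Q)) u) \<noteq> None}"
      by (auto simp: s_def)
    hence c: "real (order R choose h) \<le> real (card ({..<?N} \<inter> {u. s u}))"
      using card_successes[OF big(1), where c=c] by simp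
    have "real ?N \<le> real (order R) ^ h"
      by (metis diff_le_self of_nat_le_iff of_nat_power)
    also have "\<dots> \<le> 2 * fact h * real (order R choose h)"
      using h2 big by (intro power_le_choose) auto
    also have "\<dots> \<le> 2 * fact h * real (card ({..<?N} \<inter> {u. s u}))"
      using c by (intro mult_left_mono) auto
    finally have le: "real ?N \<le> 2 * fact h * real (card ({..<?N} \<inter> {u. s u}))" .
    have *: "1 / y \<le> b / a" if "0 < y" "0 < a" "a \<le> y * b" for a b y :: real
      using that by (simp add: field_simps)
    show "1 / (2 * fact h) \<le> real (card ({..<?N} \<inter> {u. s u})) / real ?N"
      by (rule *[OF _ _ le]) (simp, simp only: of_nat_0_less_iff tapes_pos)
  qed
  finally have p: "ennreal (1 / (2 * fact h)) \<le> emeasure (measure_pmf ?p) {u. s u}" .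
  have "?E = ennreal (2 * fact h) * (ennreal (1 / (2 * fact h)) * ?E)"
    by (simp add: mult.assoc[symmetric] ennreal_mult[symmetric])
  also have "\<dots> \<le> ennreal (2 * fact h) * (emeasure (measure_pmf ?p) {u. s u} * ?E)"
    using p by (intro mult_left_mono mult_right_mono) auto
  also have "\<dots> \<le> ennreal (2 * fact h) * of_nat (order R)"
    using expected_rounds(1)[of ?p s "order R"] by (intro mult_left_mono) (auto simp: random_tapes_def)
  also have "\<dots> = of_nat (2 * fact h * order R)"
    by (simp add: ennreal_of_nat_eq_real_of_nat ennreal_mult[symmetric])
  finally show "?E \<le> of_nat (2 * fact h * order R)" .
  show "rounds s (order R) \<in> borel_measurable (random_tapes h)"
    unfolding random_tapes_def by (rule expected_rounds(2))
qed

text \<open>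
  Exponents outside the prescribed range occur on a null set of tapes only, so the bounds on single
  rounds apply almost everywhere.
\<close>

lemma expected_time_le:
  assumes big: "order R \<ge> 4 * h" "order R \<ge> 2 * h\<^sup>2"
    and W: "\<And>n. n \<le> 2 * order R \<Longrightarrow> mult_ops c n \<le> W"
    and L: "order R ^ h < 2 ^ L" and few: "4 * L * mulmod_ops c h + xgcd_ops c (2 * h) \<le> order R"
  shows "expected_time c Q \<le> of_nat (11 * order R + W + sparse_ops c h (order R) * mult_ops c h
      + (14 * order R + 3 * W) * (2 * fact h * order R))"
proof -
  let ?a = "11 * order R + W + sparse_ops c h (order R) * mult_ops c h"
  let ?b = "14 * order R + 3 * W"
  define s where "s = (\<lambda>u. result (trial c Q (result (precompute c Q)) u) \<noteq> None)"
  note r = expected_rounds_le[OF big, where c=c, folded s_def]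
  interpret prob_space "random_tapes h"
    unfolding random_tapes_def by (intro prob_space_PiM measure_pmf.prob_space_axioms)
  have "AE tape in random_tapes h. \<forall>i. tape i < order R ^ h - 1"
    unfolding random_tapes_def by (rule AE_random_tape[OF tapes_pos])
  hence "AE tape in random_tapes h. running_time c Q tape \<le> of_nat ?a + of_nat ?b * rounds s (order R) tape"
    by eventually_elim (unfold s_def, rule running_time_le[OF big(1) _ W L few], auto)
  hence "expected_time c Q \<le> (\<integral>\<^sup>+ tape. of_nat ?a + of_nat ?b * rounds s (order R) tape \<partial>random_tapes h)"
    unfolding expected_time_def degQ by (rule nn_integral_mono_AE)
  also have "\<dots> = of_nat ?a + of_nat ?b * (\<integral>\<^sup>+ tape. rounds s (order R) tape \<partial>random_tapes h)"
    using r(2) by (subst nn_integral_add) (auto simp: nn_integral_cmult emeasure_space_1)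
  also have "\<dots> \<le> of_nat ?a + of_nat ?b * of_nat (2 * fact h * order R)"
    using r(1) by (intro add_left_mono mult_left_mono) auto
  finally show ?thesis by (simp only: of_nat_add of_nat_mult)
qed

lemma length_storage_le:
  assumes big: "order R \<ge> 4 * h"
  shows "length (storage c Q tape i) \<le> 8 * order R"
proof -
  let ?T = "result (precompute c Q)"
  note T = precompute_tables[OF big, where c=c] support_facts(3)[OF big, where c=c]
  have "length (result (search c Q ?T tape i)) \<le> order R"
    unfolding length_search by (rule successes_le)
  moreover have "length (xk ?T) = order R" "length (qinv ?T) = order R"
    unfolding T(2,3) using T(4) by simp_all
  moreover have "length (chirp ?T) \<le> 2 * order R" "length (chirp_inv ?T) \<le> order R"
    using T(1) by (auto simp: field_tables_def chirp_tables_def)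
  ultimately show ?thesis
    using T(4) Q_length big h2 by (simp add: storage_def Let_def)
qed

lemma storage_entry_le:
  assumes big: "order R \<ge> 4 * h" and tape: "range tape \<subseteq> {..<order R ^ h - 1}"
    and e: "e \<in> set (storage c Q tape i)"
  shows "real_of_int e \<le> 5 * real h * log 2 (real (order R))"
proof -
  let ?l = "log 2 (real (order R))"
  have l1: "?l \<ge> 1" using order_q by (simp add: le_log_iff)
  have pw: "2 powr (real k * ?l) = real (order R) ^ k" for k
  proof -
    have "2 powr (real k * ?l) = (2 powr ?l) powr real k" by (simp add: powr_powr mult.commute)
    thus ?thesis using order_q by (simp add: powr_realpow)
  qed
  have eb: "real_of_int elem_bits \<le> ?l + 1"
    unfolding elem_bits_def using pw[of 1] l1 by (intro bitlen_le_log) auto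
  have hl: "?l \<le> real h * ?l" "real h \<le> real h * ?l" "1 \<le> real h * ?l"
    using l1 h2 mult_mono[of 1 "real h" ?l ?l] mult_mono[of "real h" "real h" 1 ?l]
      mult_mono[of 1 "real h" 1 ?l] by auto
  consider "e = elem_bits"
    | u rs where "(u, rs) \<in> set (result (search c Q (result (precompute c Q)) tape i))"
        "e = bitlen (int u) + int (length rs) * elem_bits"
    using e by (auto simp: storage_def Let_def)
  thus ?thesis
  proof cases
    case 1
    thus ?thesis using eb hl by linarith
  next
    case 2
    note rel = search_relations[OF big 2(1)]
    have "u < order R ^ h" using rel(1) tape by auto
    hence "real u \<le> real (order R) ^ h" by (metis less_imp_le of_nat_le_iff of_nat_power)
    hence "real_of_int (bitlen (int u)) \<le> real h * ?l + 1"
      using l1 by (intro bitlen_le_log) (auto simp: pw)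
    moreover have "real (length rs) * real_of_int elem_bits \<le> real h * (?l + 1)"
      using rel(2) eb bitlen_nonneg[of "int (order R) - 1"] by (intro mult_mono) (auto simp: elem_bits_def)
    ultimately show ?thesis using 2(2) hl by (simp add: algebra_simps)
  qed
qed

end

text \<open>
  The summand \<open>mult_ops c 0\<close> in the last bound is there because the conditions on multiplication times
  do not relate the cost in degree 0 to the others.
\<close>

lemma usual_costs_facts:
  assumes "usual_costs c"
  shows "\<exists>K. \<forall>w n. sparse_ops c w n \<le> K * w * n\<^sup>2"
    and "\<And>n. n \<le> mult_ops c n"
    and "\<And>m n. 1 \<le> m \<Longrightarrow> m \<le> n \<Longrightarrow> mult_ops c m * n \<le> mult_ops c n * m"
    and "\<And>n q. 1 \<le> q \<Longrightarrow> n \<le> 2 * q \<Longrightarrow> mult_ops c n \<le> (mult_ops c 0 + 4) * mult_ops c q"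
proof -
  show lin: "n \<le> mult_ops c n" for n using assms by (auto simp: usual_costs_def)
  show mono: "mult_ops c m * n \<le> mult_ops c n * m" if "1 \<le> m" "m \<le> n" for m n
  proof -
    have "real (mult_ops c m) / real m \<le> real (mult_ops c n) / real n"
      using assms that by (auto simp: usual_costs_def)
    hence "real (mult_ops c m) * real n \<le> real (mult_ops c n) * real m"
      using that by (simp add: field_simps)
    thus ?thesis by (metis of_nat_le_iff of_nat_mult)
  qed
  show dbl: "mult_ops c n \<le> (mult_ops c 0 + 4) * mult_ops c q" if "1 \<le> q" "n \<le> 2 * q" for n q
  proof (cases "n = 0")
    case True
    have "1 \<le> mult_ops c q" using lin[of q] that by linarith
    hence "mult_ops c 0 * 1 \<le> (mult_ops c 0 + 4) * mult_ops c q" by (intro mult_le_mono) auto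
    thus ?thesis using True by simp
  next
    case False
    have "mult_ops c n * (2 * q) \<le> mult_ops c (2 * q) * n" using mono[of n "2 * q"] that False by simp
    also have "\<dots> \<le> mult_ops c (2 * q) * (2 * q)" using that by (intro mult_le_mono2) auto
    finally have "mult_ops c n \<le> mult_ops c (2 * q)" using that by simp
    also have "\<dots> \<le> 2\<^sup>2 * mult_ops c q"
      using assms that unfolding usual_costs_def by (metis one_le_numeral)
    also have "\<dots> \<le> (mult_ops c 0 + 4) * mult_ops c q" by simp
    finally show ?thesis .
  qed
  show "\<exists>K. \<forall>w n. sparse_ops c w n \<le> K * w * n\<^sup>2"
    using assms by (simp add: usual_costs_def)
qed

text \<open>
  The terms with \<open>s * Mh\<close> are the linear system: \<open>Mh * q \<le> M * h\<close> exchanges the multiplication time in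
  degree \<open>h\<close> for the one in degree \<open>q\<close>, and the resulting $h^2$ is at most $2 h!$.
\<close>

lemma total_cost_le:
  fixes q h M W s m K Mh :: nat
  assumes q: "q \<ge> 1" "q \<le> M" and h: "h \<ge> 1" and W: "W = (m + 4) * M"
    and s: "s \<le> K * h * q\<^sup>2" and Mh: "Mh * q \<le> M * h"
  shows "11 * q + W + s * Mh + (14 * q + 3 * W) * (2 * fact h * q)
    \<le> (67 + 7 * m + 2 * K) * fact h * q * M"
proof -
  define Y where "Y = fact h * q * M"
  have f: "(1::nat) \<le> fact h" by simp
  have M1: "M \<ge> 1" using q by simp
  have MY: "M \<le> Y" unfolding Y_def using f q mult_le_mono[of 1 "fact h * q" M M]
    by (metis mult_1 mult_le_mono order_refl)
  have "s * Mh \<le> K * h * q\<^sup>2 * Mh" using s by (rule mult_le_mono1)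
  also have "\<dots> = K * h * q * (Mh * q)" by (simp add: power2_eq_square algebra_simps)
  also have "\<dots> \<le> K * h * q * (M * h)" using Mh by (rule mult_le_mono2)
  also have "\<dots> = K * q * M * h\<^sup>2" by (simp add: power2_eq_square algebra_simps)
  also have "\<dots> \<le> K * q * M * (2 * fact h)" by (intro mult_le_mono2 square_le_two_fact)
  also have "\<dots> = 2 * K * Y" by (simp add: Y_def)
  finally have 1: "s * Mh \<le> 2 * K * Y" .
  have 2: "11 * q \<le> 11 * Y" using q MY by linarith
  have 3: "W \<le> (m + 4) * Y" unfolding W using MY by (rule mult_le_mono2)
  have "14 * q + 3 * W \<le> (14 + 3 * (m + 4)) * M" unfolding W using q by (simp add: algebra_simps)
  hence "(14 * q + 3 * W) * (2 * fact h * q) \<le> (14 + 3 * (m + 4)) * M * (2 * fact h * q)"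
    by (rule mult_le_mono1)
  also have "\<dots> = (52 + 6 * m) * Y" by (simp add: Y_def algebra_simps)
  finally have 4: "(14 * q + 3 * W) * (2 * fact h * q) \<le> (52 + 6 * m) * Y" .
  have "11 * q + W + s * Mh + (14 * q + 3 * W) * (2 * fact h * q)
    \<le> 11 * Y + (m + 4) * Y + 2 * K * Y + (52 + 6 * m) * Y"
    using 1 2 3 4 by linarith
  also have "\<dots> = (67 + 7 * m + 2 * K) * Y" by (simp add: algebra_simps)
  finally show ?thesis by (simp add: Y_def mult.assoc)
qed

theorem proposition5:
  fixes c :: op_counts
  assumes "usual_costs c"
  shows "\<exists>C::real. \<forall>h\<ge>2. \<exists>q0::nat. \<forall>(F :: 'a ring) Q.
    field F \<and> finite (carrier F) \<and> order F \<ge> q0 \<and> primitive_poly F Q \<and> degree Q = h \<longrightarrow>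
      ring.expected_time F c Q
        \<le> ennreal (C * fact h * real (order F) * real (mult_ops c (order F))) \<and>
      (\<forall>tape i. range tape \<subseteq> {..<order F ^ h - 1} \<longrightarrow>
         real (length (ring.storage F c Q tape i)) \<le> C * real (order F) \<and>
         (\<forall>s\<in>set (ring.storage F c Q tape i). real_of_int s \<le> C * real h * log 2 (real (order F))))"
proof -
  from usual_costs_facts(1)[OF assms] obtain K where "\<forall>w n. sparse_ops c w n \<le> K * w * n\<^sup>2" ..
  note c = this[rule_format] usual_costs_facts(2-4)[OF assms]
  define D where "D = 67 + 7 * mult_ops c 0 + 2 * K"
  show ?thesis
  proof (intro exI[of _ "real D"] allI impI)
    fix h :: nat assume h2: "2 \<le> h"
    from linear_le_power_of_two[of "4 * h * mulmod_ops c h" "xgcd_ops c (2 * h)"]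
    obtain m0 where m0: "\<forall>m\<ge>m0. 4 * h * mulmod_ops c h * (m + 1) + xgcd_ops c (2 * h) \<le> 2 ^ m" ..
    show "\<exists>q0. \<forall>(F :: 'a ring) Q.
      field F \<and> finite (carrier F) \<and> order F \<ge> q0 \<and> primitive_poly F Q \<and> degree Q = h \<longrightarrow>
      ring.expected_time F c Q
        \<le> ennreal (real D * fact h * real (order F) * real (mult_ops c (order F))) \<and>
      (\<forall>tape i. range tape \<subseteq> {..<order F ^ h - 1} \<longrightarrow>
         real (length (ring.storage F c Q tape i)) \<le> real D * real (order F) \<and>
         (\<forall>s\<in>set (ring.storage F c Q tape i). real_of_int s \<le> real D * real h * log 2 (real (order F))))"
    \<comment> \<open>the three summands: decoding needs $q \ge 4h$, the success probability $q \ge 2h^2$, and $q \ge 2^{m_0}$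
        makes the modular powers and the Euclidean algorithm cost at most $q$\<close>
    proof (intro exI[of _ "4 * h + 2 * h\<^sup>2 + 2 ^ m0"] allI impI)
      fix F :: "'a ring" and Q
      assume H: "field F \<and> finite (carrier F) \<and> 4 * h + 2 * h\<^sup>2 + 2 ^ m0 \<le> order F \<and>
        primitive_poly F Q \<and> degree Q = h"
      interpret field F using H by simp
      interpret primitive_modulus F Q h by unfold_locales (use H h2 in auto)
      let ?q = "order F"
      have Hq: "4 * h + 2 * h\<^sup>2 + 2 ^ m0 \<le> ?q" using H by blast
      have big: "?q \<ge> 4 * h" "?q \<ge> 2 * h\<^sup>2" "?q \<ge> 2 ^ m0" using Hq by simp_all
      have q1: "?q \<ge> 1" using big(1) h2 by simp
      obtain m where m: "2 ^ m \<le> ?q" "?q < 2 ^ (m + 1)"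
        using ex_power_ivl1[of 2 ?q] q1 by auto
      have "(2::nat) ^ m0 < 2 ^ (m + 1)" using m(2) big(3) by linarith
      hence "m0 < m + 1" by (rule power_less_imp_less_exp[rotated]) simp
      have few: "4 * (h * (m + 1)) * mulmod_ops c h + xgcd_ops c (2 * h) \<le> ?q"
      proof -
        have "4 * h * mulmod_ops c h * (m + 1) + xgcd_ops c (2 * h) \<le> 2 ^ m"
          using m0 \<open>m0 < m + 1\<close> by simp
        thus ?thesis using m(1) by (simp add: algebra_simps)
      qed
      have L: "?q ^ h < 2 ^ (h * (m + 1))"
      proof -
        have "?q ^ h < (2 ^ (m + 1)) ^ h" using m(2) h2 by (intro power_strict_mono) auto
        also have "((2::nat) ^ (m + 1)) ^ h = 2 ^ (h * (m + 1))"
          by (simp only: power_mult[symmetric] mult.commute)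
        finally show ?thesis .
      qed
      define W where "W = (mult_ops c 0 + 4) * mult_ops c ?q"
      have W: "mult_ops c n \<le> W" if "n \<le> 2 * ?q" for n
        unfolding W_def using c(4)[OF q1 that] .
      have "expected_time c Q \<le> of_nat (11 * ?q + W + sparse_ops c h ?q * mult_ops c h
        + (14 * ?q + 3 * W) * (2 * fact h * ?q))"
        by (rule expected_time_le[OF big(1,2) W L few])
      also have "\<dots> \<le> of_nat (D * fact h * ?q * mult_ops c ?q)"
        unfolding D_def
        by (intro of_nat_mono total_cost_le) (use q1 h2 c(1,2) c(3)[of h ?q] big(1) W_def in auto)
      also have "\<dots> = ennreal (real D * fact h * real ?q * real (mult_ops c ?q))"
        by (simp add: ennreal_of_nat_eq_real_of_nat)
      finally have time: "expected_time c Q \<le> ennreal (real D * fact h * real ?q * real (mult_ops c ?q))" .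
      have D8: "8 \<le> real D" "5 \<le> real D" by (auto simp: D_def)
      have l0: "0 \<le> log 2 (real ?q)" using q1 by simp
      have len: "real (length (storage c Q tape i)) \<le> real D * real ?q" for tape i
      proof -
        have "real (length (storage c Q tape i)) \<le> 8 * real ?q"
          using length_storage_le[OF big(1), where c=c and tape=tape and i=i] by linarith
        also have "\<dots> \<le> real D * real ?q" using D8 by (intro mult_right_mono) auto
        finally show ?thesis .
      qed
      have ent: "real_of_int s \<le> real D * real h * log 2 (real ?q)"
        if "range tape \<subseteq> {..<?q ^ h - 1}" "s \<in> set (storage c Q tape i)" for tape i s
      proof -
        have "real_of_int s \<le> 5 * real h * log 2 (real ?q)"
          by (rule storage_entry_le[OF big(1) that])
        also have "\<dots> \<le> real D * real h * log 2 (real ?q)"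
          using D8 l0 by (intro mult_right_mono) auto
        finally show ?thesis .
      qed
      show "expected_time c Q \<le> ennreal (real D * fact h * real ?q * real (mult_ops c ?q)) \<and>
        (\<forall>tape i. range tape \<subseteq> {..<?q ^ h - 1} \<longrightarrow>
         real (length (storage c Q tape i)) \<le> real D * real ?q \<and>
         (\<forall>s\<in>set (storage c Q tape i). real_of_int s \<le> real D * real h * log 2 (real ?q)))"
        using time len ent by blast
    qed
  qed
qed

end
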